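(* Let $d\ge2$, let $X=\{x_0,\dots,x_d\}$ be an affine basis of $\mathbb{R}^d$ and let $\delta$ be a metric on $X$. Then there exists a Lipschitz potential $W:\mathbb{R}^d\to\mathbb{R}_+$ such that $W(z)=1$ for $|z|$ large enough, $W^{-1}(\{0\})=X$, $\mathrm{geod}_W=\delta$ on $X\times X$, and with the following property: for every $u^\pm\in X$, every $\nu\in\mathbb{S}^{d-1}$ with $\nu\cdot(u^+-u^-)=0$ and every $R\in SO(d)$ with $R\nu=e_1$, if $u\in\dot H^1_{div}(\Omega_R,\mathbb{R}^d)$ is a global minimizer of $E_R(u)=\int_{\Omega_R}\frac12|\nabla u|^2+W(u)\,dx$ among maps $u\in\dot H^1_{div}(\Omega_R,\mathbb{R}^d)$ satisfying $$\lim_{t\to\pm\infty}\int_{R^{-1}\mathbb{T}^{d-1}}u(t\nu+\sigma)\,d\mathcal{H}^{d-1}(\sigma)=u^\pm,$$ then $u$ is one-dimensional: $u(x)=g(x\cdot\nu)$ for some $g\in\dot H^1(\mathbb{R},\mathbb{R}^d)$ with $g(\pm\infty)=u^\pm$, and $E_R(u)=\delta(u^-,u^+)$.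
   Context: $\mathbb{T}=\mathbb{R}/\mathbb{Z}$, $\Omega=\mathbb{R}\times\mathbb{T}^{d-1}$ (the quotient of $\mathbb{R}^d$ by $\{0\}\times\mathbb{Z}^{d-1}$). For $R\in SO(d)$, $\Omega_R=R^{-1}\Omega$ is the quotient of $\mathbb{R}^d$ by the lattice $R^{-1}(\{0\}\times\mathbb{Z}^{d-1})$, i.e. maps on $\Omega_R$ are maps on $\mathbb{R}^d$ periodic in the directions $R^{-1}e_k$, $k=2,\dots,d$; $R^{-1}\mathbb{T}^{d-1}$ is the image of $\{0\}\times\mathbb{T}^{d-1}$. $\dot H^1_{div}(\Omega_R,\mathbb{R}^d)=\{u\in H^1_{loc}(\Omega_R,\mathbb{R}^d):\nabla u\in L^2,\ \nabla\cdot u=0\}$. $\mathrm{geod}_W(z^-,z^+)=\inf\{\int_{-1}^1\sqrt{2W(\gamma)}|\dot\gamma|:\gamma\in\mathrm{Lip}([-1,1],\mathbb{R}^d),\ \gamma(\pm1)=z^\pm\}$. *)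

theory Defs
  imports "HOL-Analysis.Analysis"
begin

definition geod :: "(real^'n \<Rightarrow> real) \<Rightarrow> real^'n \<Rightarrow> real^'n \<Rightarrow> real" where
  "geod W a b = (INF \<gamma> \<in> {\<gamma> :: real \<Rightarrow> real^'n. (\<exists>L. L-lipschitz_on {-1..1} \<gamma>) \<and> \<gamma> (-1) = a \<and> \<gamma> 1 = b}.
      integral\<^sup>L (lebesgue_on {-1..1})
        (\<lambda>t. sqrt (2 * W (\<gamma> t)) * norm (vector_derivative \<gamma> (at t))))"

definition metric_on :: "'a set \<Rightarrow> ('a \<Rightarrow> 'a \<Rightarrow> real) \<Rightarrow> bool" where
  "metric_on X \<delta> \<longleftrightarrow>
     (\<forall>x\<in>X. \<forall>y\<in>X. 0 \<le> \<delta> x y \<and> (\<delta> x y = 0 \<longleftrightarrow> x = y) \<and> \<delta> x y = \<delta> y x) \<and>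
     (\<forall>x\<in>X. \<forall>y\<in>X. \<forall>z\<in>X. \<delta> x z \<le> \<delta> x y + \<delta> y z)"

definition SO_matrix :: "real^'n^'n \<Rightarrow> bool" where
  "SO_matrix R \<longleftrightarrow> orthogonal_matrix R \<and> det R = 1"

definition L2_loc :: "(real^'n \<Rightarrow> real) \<Rightarrow> bool" where
  "L2_loc f \<longleftrightarrow> f \<in> borel_measurable lebesgue \<and>
     (\<forall>a b. integrable (lebesgue_on (cbox a b)) (\<lambda>x. (f x)\<^sup>2))"

definition test_fun :: "(real^'n \<Rightarrow> real) \<Rightarrow> (real^'n \<Rightarrow> real^'n) \<Rightarrow> bool" where
  "test_fun \<phi> D\<phi> \<longleftrightarrow> (\<exists>K. compact K \<and> (\<forall>x. x \<notin> K \<longrightarrow> \<phi> x = 0)) \<and>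
     continuous_on UNIV D\<phi> \<and> (\<forall>x. (\<phi> has_derivative (\<lambda>h. D\<phi> x \<bullet> h)) (at x))"

definition weak_grad :: "(real^'n \<Rightarrow> real^'n) \<Rightarrow> (real^'n \<Rightarrow> real^'n^'n) \<Rightarrow> bool" where
  "weak_grad u Du \<longleftrightarrow>
     (\<forall>i. L2_loc (\<lambda>x. u x $ i)) \<and> (\<forall>i j. L2_loc (\<lambda>x. Du x $ i $ j)) \<and>
     (\<forall>\<phi> D\<phi>. test_fun \<phi> D\<phi> \<longrightarrow> (\<forall>i j.
        integral\<^sup>L lebesgue (\<lambda>x. u x $ i * D\<phi> x $ j) = - integral\<^sup>L lebesgue (\<lambda>x. Du x $ i $ j * \<phi> x)))"

text \<open>Fundamental domain of Omega_R = R^{-1}(R x T^{d-1}); i1 is the index of e_1.\<close>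
definition fund_dom :: "'n \<Rightarrow> real^'n^'n \<Rightarrow> (real^'n) set" where
  "fund_dom i1 R = {x. \<forall>k. k \<noteq> i1 \<longrightarrow> (R *v x) $ k \<in> {0..<1}}"

text \<open>Maps on Omega_R: periodic in the directions R^{-1} e_k, k different from 1.\<close>
definition periodic_R :: "'n \<Rightarrow> real^'n^'n \<Rightarrow> (real^'n \<Rightarrow> 'b) \<Rightarrow> bool" where
  "periodic_R i1 R u \<longleftrightarrow> (\<forall>k x. k \<noteq> i1 \<longrightarrow> u (x + transpose R *v axis k 1) = u x)"

definition H1div :: "'n \<Rightarrow> real^'n^'n \<Rightarrow> (real^'n \<Rightarrow> real^'n) \<Rightarrow> (real^'n \<Rightarrow> real^'n^'n) \<Rightarrow> bool" where
  "H1div i1 R u Du \<longleftrightarrow> periodic_R i1 R u \<and> weak_grad u Du \<and>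
     (\<integral>\<^sup>+ x\<in>fund_dom i1 R. ennreal ((norm (Du x))\<^sup>2) \<partial>lebesgue) < \<infinity> \<and>
     (AE x in lebesgue. (\<Sum>i\<in>UNIV. Du x $ i $ i) = 0)"

definition energy :: "(real^'n \<Rightarrow> real) \<Rightarrow> 'n \<Rightarrow> real^'n^'n \<Rightarrow> (real^'n \<Rightarrow> real^'n) \<Rightarrow> (real^'n \<Rightarrow> real^'n^'n) \<Rightarrow> ennreal" where
  "energy W i1 R u Du = (\<integral>\<^sup>+ x\<in>fund_dom i1 R. ennreal ((norm (Du x))\<^sup>2 / 2 + W (u x)) \<partial>lebesgue)"

text \<open>Average of u over the slice t nu + R^{-1} T^{d-1} (a unit (d-1)-cube, parametrised
  isometrically by the coordinates different from i1 of a point of the unit cube).\<close>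
definition slice_avg :: "'n \<Rightarrow> real^'n^'n \<Rightarrow> real^'n \<Rightarrow> (real^'n \<Rightarrow> real^'n) \<Rightarrow> real \<Rightarrow> real^'n" where
  "slice_avg i1 R \<nu> u t = integral\<^sup>L (lebesgue_on (cbox 0 One))
      (\<lambda>y. u (t *\<^sub>R \<nu> + transpose R *v (\<chi> k. if k = i1 then 0 else y $ k)))"

text \<open>Boundary condition: essential limits of the slice averages as t goes to +-infinity.\<close>
definition bc :: "'n \<Rightarrow> real^'n^'n \<Rightarrow> real^'n \<Rightarrow> (real^'n \<Rightarrow> real^'n) \<Rightarrow> real^'n \<Rightarrow> real^'n \<Rightarrow> bool" where
  "bc i1 R \<nu> u um up \<longleftrightarrow>
     (slice_avg i1 R \<nu> u \<longlongrightarrow> up) (inf at_top (ae_filter lborel)) \<and>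
     (slice_avg i1 R \<nu> u \<longlongrightarrow> um) (inf at_bot (ae_filter lborel))"

text \<open>g in \dot H^1(R,R^d) (continuous representative): absolutely continuous with derivative g' in L^2(R).\<close>
definition H1dot_line :: "(real \<Rightarrow> real^'n) \<Rightarrow> (real \<Rightarrow> real^'n) \<Rightarrow> bool" where
  "H1dot_line g g' \<longleftrightarrow> g' \<in> borel_measurable lebesgue \<and>
     (\<forall>a b. a \<le> b \<longrightarrow> g' absolutely_integrable_on {a..b} \<and> (g' has_integral (g b - g a)) {a..b}) \<and>
     integrable lebesgue (\<lambda>t. (norm (g' t))\<^sup>2)"

end

theory Submission
  imports Defs
begin

text \<open>Without the divergence constraint, one-dimensional maps are optimal: on almost every line parallel
  to \<open>\<nu>\<close> the energy of \<open>u\<close> is at least the \<open>geod\<^bsub>W\<^esub>\<close> distance of the two end points, and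
  equality forces the tangential derivatives to vanish. A one-dimensional map \<open>g(x \<bullet> \<nu>)\<close> is divergence
  free iff \<open>g'\<close> is orthogonal to \<open>\<nu>\<close>; so it suffices to choose \<open>W\<close> in such a way that the segments
  between points of \<open>X\<close> are geodesics of length \<open>\<delta>\<close>.

  To this end, for each \<open>a \<in> X\<close> an explicit polynomial \<open>\<psi>\<^sub>a\<close> in the barycentric coordinates is taken with
  \<open>\<psi>\<^sub>a = \<delta> a\<close> on \<open>X\<close> and with gradient tangent to every edge along that edge. With
  \<open>W = max\<^sub>a |\<nabla>\<psi>\<^sub>a|\<^sup>2 / 2\<close> near the simplex, \<open>\<psi>\<^sub>a\<close> calibrates the edges issuing from \<open>a\<close>.

  The end points of almost every line lie in \<open>X\<close>. Their average over a slice is \<open>u\<^sup>\<plusminus>\<close>, which is an extreme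
  point of the convex hull of \<open>X\<close>, so they are equal to \<open>u\<^sup>\<plusminus>\<close>.\<close>

subsection \<open>Almost everywhere differentiability of Lipschitz functions\<close>

text \<open>One potential has to fit all edges at once. Along the edge from \<open>x\<close> to
  \<open>y\<close> the gradient of \<psi>_a has size 30 s^2 (1 - s)^2 |\<delta> a y - \<delta> a x|
  / |y - x|; by the triangle inequality the maximum over \<open>a\<close> is attained at the end
  points and contains exactly \<delta> x y. The profile s^2 (1 - s)^2 comes from the terms that
  straighten the gradient: a factor \<lambda>_x \<lambda>_y would have a gradient on neighbouring
  edges, its square has none there. Since gradients may vanish outside \<open>X\<close>, a small
  polynomial plus a radial term also enters the maximum. The other obstacle is weak regularity.
  \<open>geod\<close> runs over all Lipschitz curves, whence the differentiability theorem;
  \<open>u\<close> has only weak derivatives and essential limits of averages. A finite-increment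
  formula for translations yields curves on lines, and lines are indexed by the points of a unit
  cell of full dimension, so that exceptional lines form a null set for d-dimensional Lebesgue
  measure.\<close>

lemma vitali_image_bound:
  fixes f g :: "real \<Rightarrow> real"
  assumes mono: "strict_mono f" and lip: "K-lipschitz_on UNIV f"
    and gf: "\<And>x. g (f x) = x" and fg: "\<And>y. f (g y) = y" and [measurable]: "g \<in> borel_measurable borel"
    and S[measurable]: "S \<in> sets borel" and fin: "emeasure lborel S < \<infinity>" and r: "0 \<le> r"
    and cov: "\<And>x d. x \<in> S \<Longrightarrow> 0 < d \<Longrightarrow>
      \<exists>c \<rho>. 0 < \<rho> \<and> \<rho> < d \<and> x \<in> cball c \<rho> \<and> f (c + \<rho>) - f (c - \<rho>) \<le> 2 * r * \<rho>"
  shows "emeasure lborel (g -` S) \<le> ennreal r * emeasure lborel S"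
proof -
  \<comment> \<open>As \<open>g\<close> inverts \<open>f\<close>, \<open>N A\<close> is the length
    of the image of \<open>A\<close> under \<open>f\<close>; written as a preimage under a Borel
    map, that image is measurable. The Lipschitz bound makes \<open>N\<close> absolutely continuous,
    so the null remainder of a Vitali covering does not count.\<close>
  define N where "N = distr lborel borel g"
  have N: "emeasure N A = emeasure lborel (g -` A)" if "A \<in> sets borel" for A
    using that unfolding N_def by (subst emeasure_distr) auto
  have gim: "g -` A = f ` A" for A
    using gf fg by (auto simp: image_iff) metis
  have Nnull: "emeasure N A = 0" if A: "A \<in> sets borel" "negligible A" for A
  proof -
    have "negligible (f ` A)"
    proof (rule negligible_locally_Lipschitz_image)
      show "\<exists>T B. open T \<and> x \<in> T \<and> (\<forall>y\<in>A \<inter> T. norm (f y - f x) \<le> B * norm (y - x))" if "x \<in> A" for x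
        using lipschitz_onD[OF lip] by (intro exI[of _ UNIV] exI[of _ K]) (auto simp: dist_norm)
    qed (use A in auto)
    then have "g -` A \<in> null_sets lebesgue"
      by (simp add: gim negligible_iff_null_sets)
    moreover have "g -` A \<in> sets borel"
      using A measurable_sets[of g borel borel A] by auto
    ultimately show ?thesis
      using A by (auto simp: N null_sets_completion_iff)
  qed
  have mul: "f a \<le> f b" if "a \<le> b" for a b using mono that by (simp add: strict_mono_less_eq)
  have main: "emeasure N S \<le> ennreal r * emeasure lborel S + ennreal r * ennreal e" if e: "e > 0" for e
  proof -
    obtain T where T: "open T" "S \<subseteq> T" "T - S \<in> lmeasurable" "emeasure lebesgue (T - S) < ennreal e"
      using sets_lebesgue_outer_open[of S e] S e by (metis sets_completionI_sets sets_lborel)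
    \<comment> \<open>A pair is a centre with a radius. Intervals inside \<open>T\<close> that are
      disjoint have total length at most that of \<open>T\<close>, which exceeds the length of
      \<open>S\<close> by less than \<open>e\<close>.\<close>
    define I where "I = {p. 0 < snd p \<and> cball (fst p) (snd p) \<subseteq> T \<and> f (fst p + snd p) - f (fst p
        - snd p) \<le> 2 * r * snd p}"
    have Ipos: "0 < snd i" if "i \<in> I" for i using that by (simp add: I_def)
    have "\<exists>i. i \<in> I \<and> x \<in> cball (fst i) (snd i) \<and> snd i < d" if x: "x \<in> S" and d: "0 < d" for x d
    proof -
      obtain \<epsilon> where \<epsilon>: "\<epsilon> > 0" "ball x \<epsilon> \<subseteq> T" using T x by (meson openE subsetD)
      obtain c \<rho> where c: "0 < \<rho>" "\<rho> < min d (\<epsilon> / 2)" "x \<in> cball c \<rho>" "f (c + \<rho>) - f (c - \<rho>) \<le> 2 * r * \<rho>"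
        using cov[OF x, of "min d (\<epsilon> / 2)"] d \<epsilon> by auto
      have "cball c \<rho> \<subseteq> ball x \<epsilon>" using c by (auto simp: dist_real_def)
      then show ?thesis using c \<epsilon> unfolding I_def by (intro exI[of _ "(c, \<rho>)"]) auto
    qed
    then obtain C where C: "countable C" "C \<subseteq> I"
      "pairwise (\<lambda>i j. disjnt (cball (fst i) (snd i)) (cball (fst j) (snd j))) C"
      "negligible (S - (\<Union>i\<in>C. cball (fst i) (snd i)))"
      using Vitali_covering_theorem_cballs[of I snd S fst thesis] Ipos by blast
    define U where "U = (\<Union>i\<in>C. cball (fst i) (snd i))"
    have U[measurable]: "U \<in> sets borel"
      unfolding U_def by (intro sets.countable_UN' C) auto
    have disj: "disjoint_family_on (\<lambda>i. cball (fst i) (snd i)) C"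
      using C(3) by (auto simp: disjoint_family_on_def pairwise_def disjnt_def)
    have NI: "emeasure N (cball (fst i) (snd i)) \<le> ennreal r * emeasure lborel (cball (fst i) (snd i))"
        if "i \<in> C" for i
    proof -
      have i: "0 < snd i" "f (fst i + snd i) - f (fst i - snd i) \<le> 2 * r * snd i" using that C(2)
          unfolding I_def by auto
      have "g -` cball (fst i) (snd i) \<subseteq> {f (fst i - snd i) .. f (fst i + snd i)}"
        unfolding gim cball_eq_atLeastAtMost using mul by auto
      then have "emeasure lborel (g -` cball (fst i) (snd i)) \<le> emeasure lborel {f (fst i
          - snd i) .. f (fst i + snd i)}"
        by (intro emeasure_mono) auto
      also have "\<dots> = ennreal (f (fst i + snd i) - f (fst i - snd i))"
        using i mul[of "fst i - snd i" "fst i + snd i"] by simp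
      also have "\<dots> \<le> ennreal (r * (2 * snd i))" using i by (intro ennreal_leI) (simp add: algebra_simps)
      also have "\<dots> = ennreal r * emeasure lborel (cball (fst i) (snd i))"
        using i r by (simp add: cball_eq_atLeastAtMost ennreal_mult)
      finally show ?thesis by (simp add: N)
    qed
    have "emeasure N S \<le> emeasure N ((S - U) \<union> U)"
      by (intro emeasure_mono) (auto simp: N_def)
    also have "\<dots> \<le> emeasure N (S - U) + emeasure N U"
      by (intro emeasure_subadditive) (auto simp: N_def)
    also have "emeasure N (S - U) = 0"
      using C(4) by (intro Nnull) (auto simp: U_def[symmetric])
    also have "emeasure N U = (\<integral>\<^sup>+i. emeasure N (cball (fst i) (snd i)) \<partial>count_space C)"
      unfolding U_def using C disj by (intro emeasure_UN_countable) (auto simp: N_def)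
    also have "\<dots> \<le> (\<integral>\<^sup>+i. ennreal r * emeasure lborel (cball (fst i) (snd i)) \<partial>count_space C)"
      by (intro nn_integral_mono) (auto simp: NI)
    also have "\<dots> = ennreal r * (\<integral>\<^sup>+i. emeasure lborel (cball (fst i) (snd i)) \<partial>count_space C)"
      by (intro nn_integral_cmult) auto
    also have "(\<integral>\<^sup>+i. emeasure lborel (cball (fst i) (snd i)) \<partial>count_space C) = emeasure lborel U"
      unfolding U_def using C disj by (intro emeasure_UN_countable[symmetric]) auto
    also have "emeasure lborel U \<le> emeasure lborel (S \<union> (T - S))"
    proof (intro emeasure_mono)
      show "U \<subseteq> S \<union> (T - S)" using C(2) unfolding U_def I_def by auto
      show "S \<union> (T - S) \<in> sets lborel" using T(1) S by auto
    qed
    also have "\<dots> \<le> emeasure lborel S + emeasure lborel (T - S)"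
      using T(1) S by (intro emeasure_subadditive) auto
    also have "emeasure lborel (T - S) \<le> ennreal e"
      using T S by (simp add: less_imp_le)
    finally show ?thesis by (simp add: distrib_left mult_left_mono add_left_mono)
  qed
  have "emeasure N S \<le> ennreal r * emeasure lborel S"
  proof (rule ennreal_le_epsilon)
    fix e :: real assume e: "0 < e"
    \<comment> \<open>The divisor \<open>r + 1\<close> absorbs the factor \<open>r\<close> before
      the error and is positive even for \<open>r = 0\<close>.\<close>
    have "emeasure N S \<le> ennreal r * emeasure lborel S + ennreal r * ennreal (e / (r + 1))"
      using e r by (intro main) auto
    also have "ennreal r * ennreal (e / (r + 1)) \<le> ennreal e"
      using e r by (subst ennreal_mult[symmetric]) (auto intro!: ennreal_leI simp: field_simps)
    finally show "emeasure N S \<le> ennreal r * emeasure lborel S + ennreal e" by (simp add: add_left_mono)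
  qed
  then show ?thesis by (simp add: N)
qed

text \<open>The covering bound is used twice on a bounded piece \<open>A\<close> of the bad set.
  Quotients below \<open>r\<close> give |f(A)| <= r |A|; quotients above \<open>s\<close>, read for
  the inverse, give |A| <= |f(A)| / s. As r < s, this forces |A| = 0. Expansion makes the inverse
  1-Lipschitz, so the bound applies to it as well.\<close>

lemma expanding_lipschitz_slopes_null:
  fixes f :: "real \<Rightarrow> real"
  assumes lip: "K-lipschitz_on UNIV f" and ex: "\<And>x y. x \<le> y \<Longrightarrow> y - x \<le> f y - f x"
    and rs: "0 < r" "r < s"
  defines "S \<equiv> {x. (\<forall>n::nat. \<exists>h. h \<noteq> 0 \<and> \<bar>h\<bar> < 1 / (real n + 1) \<and> (f (x + h) - f x) / h < r) \<and>
     (\<forall>n::nat. \<exists>h. h \<noteq> 0 \<and> \<bar>h\<bar> < 1 / (real n + 1) \<and> (f (x + h) - f x) / h > s)}"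
  shows "AE x in lborel. x \<notin> S"
proof -
  have cf: "continuous_on UNIV f" by (rule lipschitz_on_continuous_on[OF lip])
  have cf': "continuous_on UNIV (\<lambda>x. f (x + h))" for h
    by (intro continuous_on_compose2[OF cf] continuous_intros) auto
  have mono: "strict_mono f"
    using ex by (intro strict_monoI) (metis diff_gt_0_iff_gt less_imp_le order_less_le_trans)
  have surj: "\<exists>x. f x = y" for y
  proof -
    define a where "a = min 0 (y - f 0)" define b where "b = max 0 (y - f 0)"
    have "f a \<le> y" using ex[of a 0] by (auto simp: a_def min_def)
    moreover have "y \<le> f b" using ex[of 0 b] by (auto simp: b_def max_def)
    moreover have "a \<le> b" by (simp add: a_def b_def)
    ultimately show ?thesis using IVT'[of f a y b] continuous_on_subset[OF cf] by auto
  qed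
  define g where "g = inv f"
  have fg: "f (g y) = y" for y unfolding g_def using surj by (metis f_inv_into_f rangeI)
  have gf: "g (f x) = x" for x unfolding g_def using mono by (simp add: strict_mono_imp_inj_on)
  have glip: "1-lipschitz_on UNIV g"
  proof (rule lipschitz_onI)
    fix x y show "dist (g x) (g y) \<le> 1 * dist x y"
      using ex[of "g x" "g y"] ex[of "g y" "g x"] by (cases "g x \<le> g y") (auto simp: dist_real_def fg)
  qed auto
  have gmono: "strict_mono g"
    using mono fg by (intro strict_monoI) (metis strict_mono_less)
  have [measurable]: "f \<in> borel_measurable borel" "g \<in> borel_measurable borel"
    using cf lipschitz_on_continuous_on[OF glip] by (auto intro: borel_measurable_continuous_onI)
  have Sm: "S \<in> sets borel"
  proof -
    have q: "continuous_on UNIV (\<lambda>x. (f (x + h) - f x) / h)" for h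
      unfolding divide_inverse by (intro continuous_intros cf cf')
    have o1: "open {x. (f (x + h) - f x) / h < r}" "open {x. (f (x + h) - f x) / h > s}" for h
      by (intro open_Collect_less continuous_intros q)+
    \<comment> \<open>For fixed \<open>n\<close> each union over the uncountably many
      \<open>h\<close> is open because \<open>f\<close> is continuous, which leaves a countable
      intersection of open sets.\<close>
    have "S = (\<Inter>n::nat. (\<Union>h\<in>{h. h \<noteq> 0 \<and> \<bar>h\<bar> < 1 / (real n + 1)}. {x. (f (x + h) - f x) / h < r}) \<inter>
           (\<Union>h\<in>{h. h \<noteq> 0 \<and> \<bar>h\<bar> < 1 / (real n + 1)}. {x. (f (x + h) - f x) / h > s}))"
      unfolding S_def by auto
    also have "\<dots> \<in> sets borel"
      by (intro sets.countable_INT sets.Int borel_open open_UN ballI o1 image_subsetI) auto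
    finally show ?thesis .
  qed
  have K: "\<bar>f x - f y\<bar> \<le> K * \<bar>x - y\<bar>" for x y using lipschitz_onD[OF lip, of x y] by (simp add: dist_real_def)
  have K1: "K \<ge> 1" using K[of 1 0] ex[of 0 1] by auto
  have null: "emeasure lborel (S \<inter> {-real n..real n}) = 0" for n
  proof -
    define A where "A = S \<inter> {-real n..real n}"
    have A[measurable]: "A \<in> sets borel" using Sm by (auto simp: A_def)
    have fin: "emeasure lborel A < \<infinity>"
    proof -
      have "emeasure lborel A \<le> emeasure lborel {-real n..real n}" unfolding A_def
          by (intro emeasure_mono) auto
      also have "\<dots> < \<infinity>" by simp
      finally show ?thesis .
    qed
    have B[measurable]: "g -` A \<in> sets borel" using measurable_sets[of g borel borel A] A by auto
    have 1: "emeasure lborel (g -` A) \<le> ennreal r * emeasure lborel A"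
    proof (rule vitali_image_bound[OF mono lip gf fg _ A fin])
      fix x d :: real assume x: "x \<in> A" and d: "0 < d"
      obtain m :: nat where m: "1 / (real m + 1) < d" using reals_Archimedean[OF d]
          by (auto simp: inverse_eq_divide add.commute)
      obtain h where h: "h \<noteq> 0" "\<bar>h\<bar> < 1 / (real m + 1)" "(f (x + h) - f x) / h < r"
        using x unfolding A_def S_def by blast
      \<comment> \<open>The interval between \<open>x\<close> and \<open>x + h\<close> is the ball
        around its midpoint; the covering balls have to contain \<open>x\<close>, not to be centred
        there.\<close>
      have "f ((x + h/2) + \<bar>h\<bar>/2) - f ((x + h/2) - \<bar>h\<bar>/2) \<le> 2 * r * (\<bar>h\<bar>/2)"
      proof (cases "h > 0")
        case True
        then have e: "(x + h/2) + \<bar>h\<bar>/2 = x + h" "(x + h/2) - \<bar>h\<bar>/2 = x" by auto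
        show ?thesis unfolding e using h True by (simp add: field_simps)
      next
        case False
        then have h0: "h < 0" using h by auto
        then have e: "(x + h/2) + \<bar>h\<bar>/2 = x" "(x + h/2) - \<bar>h\<bar>/2 = x + h" by auto
        show ?thesis unfolding e using h h0 by (simp add: field_simps)
      qed
      then show "\<exists>c \<rho>. 0 < \<rho> \<and> \<rho> < d \<and> x \<in> cball c \<rho> \<and> f (c + \<rho>) - f (c - \<rho>) \<le> 2 * r * \<rho>"
        using h m by (intro exI[of _ "x + h/2"] exI[of _ "\<bar>h\<bar>/2"]) (auto simp: dist_real_def)
    qed (use rs in auto)
    have 2: "emeasure lborel (f -` (g -` A)) \<le> ennreal (1/s) * emeasure lborel (g -` A)"
    proof (rule vitali_image_bound[OF gmono glip fg gf _ B])
      show "emeasure lborel (g -` A) < \<infinity>"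
        using 1 fin by (metis ennreal_mult_less_top ennreal_less_top infinity_ennreal_def order_le_less_trans)
      fix y d :: real assume y: "y \<in> g -` A" and d: "0 < d"
      define x where "x = g y"
      \<comment> \<open>A step \<open>h\<close> below \<open>d / K\<close> yields an increment
        \<open>k\<close> of \<open>f\<close> below \<open>d\<close>, and \<open>k\<close> is the
        step for the inverse.\<close>
      obtain m :: nat where m: "1 / (real m + 1) < d / K"
        using reals_Archimedean[of "d / K"] d K1 by (auto simp: inverse_eq_divide add.commute)
      obtain h where h: "h \<noteq> 0" "\<bar>h\<bar> < 1 / (real m + 1)" "(f (x + h) - f x) / h > s"
        using y unfolding A_def S_def x_def by auto
      define k where "k = f (x + h) - f x"
      have gk: "g (y + k) = x + h" using gf[of "x + h"] by (simp add: k_def x_def fg)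
      have kd: "\<bar>k\<bar> < d" 
      proof -
        have "\<bar>k\<bar> \<le> K * \<bar>h\<bar>" using K[of "x + h" x] by (simp add: k_def)
        also have "\<dots> < K * (d / K)" using h m K1 by (intro mult_strict_left_mono) auto
        finally show ?thesis using K1 by simp
      qed
      have kh: "k / h > s" using h by (simp add: k_def)
      have k0: "k \<noteq> 0" using kh rs by auto
      have "g ((y + k/2) + \<bar>k\<bar>/2) - g ((y + k/2) - \<bar>k\<bar>/2) \<le> 2 * (1/s) * (\<bar>k\<bar>/2)"
      proof (cases "h > 0")
        case True 
        then have "k > s * h" using kh by (simp add: field_simps)
        moreover have "k > 0" using True rs calculation by (meson dual_order.strict_trans mult_pos_pos)
        moreover have e: "(y + k/2) + \<bar>k\<bar>/2 = y + k" "(y + k/2) - \<bar>k\<bar>/2 = y" using calculation(2) by auto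
        ultimately show ?thesis unfolding e using gk rs by (simp add: field_simps x_def[symmetric])
      next
        case False
        then have h0: "h < 0" using h by auto
        then have "k < s * h" using kh by (simp add: field_simps)
        moreover have "k < 0" using h0 rs calculation by (meson dual_order.strict_trans mult_pos_neg)
        moreover have e: "(y + k/2) + \<bar>k\<bar>/2 = y" "(y + k/2) - \<bar>k\<bar>/2 = y + k" using calculation(2) by auto
        ultimately show ?thesis unfolding e using gk rs by (simp add: field_simps x_def[symmetric])
      qed
      then show "\<exists>c \<rho>. 0 < \<rho> \<and> \<rho> < d \<and> y \<in> cball c \<rho> \<and> g (c + \<rho>) - g (c - \<rho>) \<le> 2 * (1/s) * \<rho>"
        using k0 kd by (intro exI[of _ "y + k/2"] exI[of _ "\<bar>k\<bar>/2"]) (auto simp: dist_real_def)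
    qed (use rs in auto)
    have eqA: "f -` (g -` A) = A" using gf by auto
    obtain a where a: "emeasure lborel A = ennreal a" "a \<ge> 0" using fin by (cases "emeasure lborel A") auto
    have "ennreal a \<le> ennreal (1/s) * (ennreal r * ennreal a)"
      using order_trans[OF 2 mult_left_mono[OF 1]] unfolding eqA a by simp
    then have "a \<le> 1/s * (r * a)" using rs a by (simp add: ennreal_mult[symmetric])
    then have "s * a \<le> r * a" using rs by (simp add: field_simps)
    then have "a = 0" using rs a by (metis mult_le_cancel_right_pos not_less order_le_less)
    then show ?thesis using a by (simp add: A_def)
  qed
  have "S \<in> null_sets lborel"
  proof -
    have "S = (\<Union>n::nat. S \<inter> {-real n..real n})"
    proof -
      have "\<exists>n::nat. -real n \<le> x \<and> x \<le> real n" for x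
        using real_arch_simple[of "\<bar>x\<bar>"] by (auto simp: abs_le_iff) (metis minus_le_iff)
      then show ?thesis by auto
    qed
    also have "\<dots> \<in> null_sets lborel"
      by (intro null_sets_UN) (auto simp: null_sets_def null Sm)
    finally show ?thesis .
  qed
  then show ?thesis by (rule AE_not_in)
qed

text \<open>Adding a linear function of slope \<open>L + 1\<close> preserves differentiability and
  puts all difference quotients between 1 and \<open>2 * L + 1\<close>. If their lower and upper
  limits differ at a point, two positive rationals lie strictly between them, and there are only
  countably many such pairs.\<close>

theorem lipschitz_real_AE_differentiable:
  fixes f :: "real \<Rightarrow> real"
  assumes lip: "L-lipschitz_on UNIV f"
  shows "AE x in lborel. f differentiable (at x)"
proof -
  define F where "F x = f x + (L + 1) * x" for x
  have L0: "L \<ge> 0" using lip by (rule lipschitz_on_nonneg)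
  have L: "\<bar>f x - f y\<bar> \<le> L * \<bar>x - y\<bar>" for x y using lipschitz_onD[OF lip, of x y] by (simp add: dist_real_def)
  have Flip: "(2 * L + 1)-lipschitz_on UNIV F"
  proof (rule lipschitz_onI)
    fix x y
    have "\<bar>F x - F y\<bar> \<le> \<bar>f x - f y\<bar> + \<bar>(L + 1) * (x - y)\<bar>" unfolding F_def by (simp add: algebra_simps)
    also have "\<dots> \<le> L * \<bar>x - y\<bar> + (L + 1) * \<bar>x - y\<bar>" using L[of x y] L0 by (simp add: abs_mult)
    finally show "dist (F x) (F y) \<le> (2 * L + 1) * dist x y" by (simp add: dist_real_def algebra_simps)
  qed (use L0 in auto)
  have ex: "y - x \<le> F y - F x" if "x \<le> y" for x y
    using L[of y x] that unfolding F_def by (simp add: algebra_simps)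
  define bad where "bad r s x \<longleftrightarrow> (\<forall>n::nat. \<exists>h. h \<noteq> 0 \<and> \<bar>h\<bar> < 1 / (real n + 1) \<and> (F (x + h) - F x) / h < r) \<and>
     (\<forall>n::nat. \<exists>h. h \<noteq> 0 \<and> \<bar>h\<bar> < 1 / (real n + 1) \<and> (F (x + h) - F x) / h > s)" for r s x
  have "AE x in lborel. \<not> bad r s x" if "0 < r" "r < s" for r s
    using expanding_lipschitz_slopes_null[OF Flip ex that] unfolding bad_def by simp
  then have "AE x in lborel. \<not> bad (of_rat r) (of_rat s) x" if "0 < r" "r < s" for r s
    using that by (simp add: of_rat_less)
  then have "AE x in lborel. \<forall>r s. 0 < r \<and> r < s \<longrightarrow> \<not> bad (of_rat r) (of_rat s) x"
    by (simp add: AE_all_countable)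
  then show ?thesis
  proof (eventually_elim)
    case (elim x)
    define q where "q h = (F (x + h) - F x) / h" for h
    have q1: "q h \<ge> 1" "q h \<le> 2 * L + 1" if "h \<noteq> 0" for h
    proof -
      show "q h \<ge> 1" using ex[of x "x + h"] ex[of "x + h" x] that
          by (cases "h > 0") (auto simp: q_def field_simps)
      have "\<bar>q h\<bar> \<le> 2 * L + 1" using lipschitz_onD[OF Flip, of "x + h" x] that
        by (auto simp: q_def dist_real_def field_simps abs_mult)
      then show "q h \<le> 2 * L + 1" by auto
    qed
    have "Liminf (at 0) (\<lambda>h. ereal (q h)) = Limsup (at 0) (\<lambda>h. ereal (q h))"
    proof (rule ccontr)
      assume neq: "Liminf (at 0) (\<lambda>h. ereal (q h)) \<noteq> Limsup (at 0) (\<lambda>h. ereal (q h))"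
      have "Liminf (at 0) (\<lambda>h. ereal (q h)) \<le> Limsup (at 0) (\<lambda>h. ereal (q h))" by (rule Liminf_le_Limsup) simp
      then have less: "Liminf (at 0) (\<lambda>h. ereal (q h)) < Limsup (at 0) (\<lambda>h. ereal (q h))" using neq by simp
      obtain a where a: "Liminf (at 0) (\<lambda>h. ereal (q h)) < ereal (real_of_rat a)"
          "ereal (real_of_rat a) < Limsup (at 0) (\<lambda>h. ereal (q h))"
        using ereal_dense3[OF less] by auto
      obtain b where b: "ereal (real_of_rat a) < ereal (real_of_rat b)" "ereal (real_of_rat b) < Limsup
          (at 0) (\<lambda>h. ereal (q h))"
        using ereal_dense3[OF a(2)] by auto
      have "ereal 1 \<le> Liminf (at 0) (\<lambda>h. ereal (q h))"
        by (rule Liminf_bounded) (auto simp: eventually_at_filter q1)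
      then have "ereal 1 < ereal (real_of_rat a)" using a(1) by (rule order_le_less_trans)
      then have a0: "0 < a" by simp
      have ab: "a < b" using b by (simp add: of_rat_less)
      have "\<not> bad (of_rat a) (of_rat b) x" using elim a0 ab by auto
      then consider n :: nat where "\<And>h. h \<noteq> 0 \<Longrightarrow> \<bar>h\<bar> < 1 / (real n + 1) \<Longrightarrow> q h \<ge> of_rat a"
        | n :: nat where "\<And>h. h \<noteq> 0 \<Longrightarrow> \<bar>h\<bar> < 1 / (real n + 1) \<Longrightarrow> q h \<le> of_rat b"
        unfolding bad_def q_def by (meson not_less)
      then show False
      proof cases
        case 1
        have "eventually (\<lambda>h. ereal (of_rat a) \<le> ereal (q h)) (at 0)"
          unfolding eventually_at using 1 by (intro exI[of _ "1 / (real n + 1)"]) auto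
        then show False using Liminf_bounded a(1) by (metis not_less)
      next
        case 2
        have "eventually (\<lambda>h. ereal (q h) \<le> ereal (of_rat b)) (at 0)"
          unfolding eventually_at using 2 by (intro exI[of _ "1 / (real n + 1)"]) auto
        then show False using Limsup_bounded b(2) by (metis not_less)
      qed
    qed
    moreover have "ereal 1 \<le> Liminf (at 0) (\<lambda>h. ereal (q h))" 
      by (rule Liminf_bounded) (auto simp: eventually_at_filter q1)
    moreover have "Limsup (at 0) (\<lambda>h. ereal (q h)) \<le> ereal (2 * L + 1)"
      by (rule Limsup_bounded) (auto simp: eventually_at_filter q1)
    ultimately obtain l where l: "Liminf (at 0) (\<lambda>h. ereal (q h)) = ereal l" "Limsup (at 0) (\<lambda>h. ereal
        (q h)) = ereal l"
      by (cases "Limsup (at 0) (\<lambda>h. ereal (q h))") auto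
    then have "((\<lambda>h. ereal (q h)) \<longlongrightarrow> ereal l) (at 0)"
      by (intro Liminf_eq_Limsup) auto
    then have "(F has_field_derivative l) (at x)"
      unfolding DERIV_def q_def by simp
    then have "((\<lambda>x. F x - (L + 1) * x) has_field_derivative (l - (L + 1))) (at x)"
      by (auto intro!: derivative_eq_intros)
    then have "(f has_field_derivative (l - (L + 1))) (at x)" by (simp add: F_def)
    then show ?case by (metis field_differentiable_def field_differentiable_imp_differentiable)
  qed
qed

subsection \<open>Calibrations along curves\<close>

text \<open>The local Lipschitz constant of \<open>\<Psi>\<close> at \<open>z\<close> is at most
  \<open>F z\<close>: a form of |\<nabla>\<Psi>| <= F that is stable under maxima and minima, from
  which the calibrations are built.\<close>

definition calibrates :: "('a::real_normed_vector \<Rightarrow> real) \<Rightarrow> ('a \<Rightarrow> real) \<Rightarrow> bool" where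
  "calibrates \<Psi> F \<longleftrightarrow> (\<forall>z. \<forall>e>0. \<exists>r>0. \<forall>w\<in>ball z r. \<forall>w'\<in>ball z r. \<bar>\<Psi> w - \<Psi> w'\<bar> \<le> (F z + e) * norm (w - w'))"

text \<open>Absolute continuity with a chosen derivative \<open>q\<close>, encoded by integrals, so
  that Lipschitz curves and restrictions of Sobolev maps to lines are treated alike.\<close>

definition curve_on :: "real \<Rightarrow> real \<Rightarrow> (real \<Rightarrow> 'a::euclidean_space) \<Rightarrow> (real \<Rightarrow> 'a) \<Rightarrow> bool" where
  "curve_on a b \<gamma> q \<longleftrightarrow> q absolutely_integrable_on {a..b} \<and>
     (\<forall>s t. a \<le> s \<and> s \<le> t \<and> t \<le> b \<longrightarrow> (q has_integral (\<gamma> t - \<gamma> s)) {s..t})"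

lemma curve_on_subinterval: "curve_on a b \<gamma> q \<Longrightarrow> a \<le> c \<Longrightarrow> d \<le> b \<Longrightarrow> curve_on c d \<gamma> q"
  unfolding curve_on_def
  by (auto intro: absolutely_integrable_on_subinterval[where a=c and b=d and S="{a..b}"])

lemma curve_on_continuous:
  assumes "curve_on a b \<gamma> q"
  shows "continuous_on {a..b} \<gamma>"
proof -
  have "continuous_on {a..b} (\<lambda>t. \<gamma> a + integral {a..t} q)"
    using assms set_lebesgue_integral_eq_integral(1)
    by (intro continuous_intros indefinite_integral_continuous_1) (auto simp: curve_on_def)
  moreover have "\<gamma> a + integral {a..t} q = \<gamma> t" if "t \<in> {a..b}" for t
  proof -
    have "(q has_integral (\<gamma> t - \<gamma> a)) {a..t}" using assms that unfolding curve_on_def by auto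
    then show ?thesis by (simp add: integral_unique)
  qed
  ultimately show ?thesis by (metis (no_types, lifting) continuous_on_cong)
qed

lemma curve_on_norm_integrable:
  assumes c: "curve_on a b \<gamma> q" and F: "continuous_on UNIV F"
  shows "(\<lambda>t. (F (\<gamma> t) :: real) * norm (q t)) absolutely_integrable_on {a..b}"
proof -
  have cg: "continuous_on {a..b} (\<lambda>t. F (\<gamma> t))"
    using continuous_on_compose2[OF F curve_on_continuous[OF c]] by auto
  show ?thesis
  proof (rule absolutely_integrable_bounded_measurable_product_real)
    show "(\<lambda>t. F (\<gamma> t)) \<in> borel_measurable (lebesgue_on {a..b})"
      using cg by (intro continuous_imp_measurable_on_sets_lebesgue) auto
    show "bounded ((\<lambda>t. F (\<gamma> t)) ` {a..b})"
      using compact_continuous_image[OF cg] compact_imp_bounded by blast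
    show "(\<lambda>t. norm (q t)) absolutely_integrable_on {a..b}"
      using c unfolding curve_on_def by (simp add: set_integrable_norm)
  qed auto
qed

text \<open>With \<open>F + e\<close> in place of \<open>F\<close> the estimate passes from two
  adjacent intervals to their union and holds on short intervals, where \<open>F\<close> along the
  curve varies by less than \<open>e / 2\<close>. Bisection then gives it on \<open>{a..b}\<close>,
  and \<open>e\<close> tends to 0.\<close>

lemma calibration_bound:
  assumes ab: "a \<le> b" and c: "curve_on a b \<gamma> q" and F: "continuous_on UNIV F"
    and cal: "calibrates \<Psi> F" and F0: "\<And>z. 0 \<le> F z"
  shows "\<bar>\<Psi> (\<gamma> b) - \<Psi> (\<gamma> a)\<bar> \<le> integral {a..b} (\<lambda>t. F (\<gamma> t) * norm (q t))"
proof -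
  have int0: "(\<lambda>t. norm (q t)) integrable_on {s..t}" if "a \<le> s" "t \<le> b" for s t
    using curve_on_subinterval[OF c that] unfolding curve_on_def absolutely_integrable_on_def by auto
  have int1: "(\<lambda>t. F (\<gamma> t) * norm (q t)) integrable_on {s..t}" if "a \<le> s" "t \<le> b" for s t
    using curve_on_norm_integrable[OF curve_on_subinterval[OF c that] F]
        set_lebesgue_integral_eq_integral(1) by blast
  have int2: "(\<lambda>t. (F (\<gamma> t) + e) * norm (q t)) integrable_on {s..t}" if "a \<le> s" "t \<le> b" for s t e
    unfolding distrib_right using int1[OF that] int0[OF that]
    by (intro integrable_add integrable_on_mult_right) auto
  have cg: "continuous_on {a..b} \<gamma>" by (rule curve_on_continuous[OF c])
  have main: "\<bar>\<Psi> (\<gamma> b) - \<Psi> (\<gamma> a)\<bar> \<le> integral {a..b} (\<lambda>t. (F (\<gamma> t) + e) * norm (q t))" if e: "e > 0" for e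
  proof -
    define P where "P s t \<longleftrightarrow> (a \<le> s \<longrightarrow> t \<le> b \<longrightarrow> \<bar>\<Psi> (\<gamma> t) - \<Psi> (\<gamma> s)\<bar> \<le> integral {s..t} (\<lambda>t. (F (\<gamma> t)
        + e) * norm (q t)))" for s t
    have "P a b" using ab
    proof (induction rule: Bolzano)
      case (trans s m t)
      show ?case unfolding P_def
      proof (intro impI)
        assume st: "a \<le> s" "t \<le> b"
        have "integral {s..m} (\<lambda>t. (F (\<gamma> t) + e) * norm (q t)) + integral {m..t} (\<lambda>t. (F (\<gamma> t)
            + e) * norm (q t))
            = integral {s..t} (\<lambda>t. (F (\<gamma> t) + e) * norm (q t))"
          using trans st int2[of s t e] by (intro Henstock_Kurzweil_Integration.integral_combine) auto
        moreover have "\<bar>\<Psi> (\<gamma> m) - \<Psi> (\<gamma> s)\<bar> \<le> integral {s..m} (\<lambda>t. (F (\<gamma> t) + e) * norm (q t))"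
          "\<bar>\<Psi> (\<gamma> t) - \<Psi> (\<gamma> m)\<bar> \<le> integral {m..t} (\<lambda>t. (F (\<gamma> t) + e) * norm (q t))"
          using trans st unfolding P_def by auto
        ultimately show "\<bar>\<Psi> (\<gamma> t) - \<Psi> (\<gamma> s)\<bar> \<le> integral {s..t} (\<lambda>t. (F (\<gamma> t) + e) * norm (q t))"
          by linarith
      qed
    next
      case (local x)
      obtain r where r: "r > 0" "\<And>w w'. w \<in> ball (\<gamma> x) r \<Longrightarrow> w' \<in> ball (\<gamma> x) r \<Longrightarrow> \<bar>\<Psi> w - \<Psi> w'\<bar> \<le> (F (\<gamma> x)
          + e / 2) * norm (w - w')"
        using cal e unfolding calibrates_def by (meson half_gt_zero)
      have "continuous_on {a..b} (\<lambda>t. F (\<gamma> t))" using continuous_on_compose2[OF F cg] by auto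
      then obtain d1 where d1: "d1 > 0" "\<And>t. t \<in> {a..b} \<Longrightarrow> dist t x < d1 \<Longrightarrow> dist (F (\<gamma> t)) (F (\<gamma> x)) < e / 2"
        using local e unfolding continuous_on_iff by (metis atLeastAtMost_iff half_gt_zero)
      obtain d2 where d2: "d2 > 0" "\<And>t. t \<in> {a..b} \<Longrightarrow> dist t x < d2 \<Longrightarrow> dist (\<gamma> t) (\<gamma> x) < r"
        using cg local r(1) unfolding continuous_on_iff by (metis atLeastAtMost_iff)
      show ?case
      proof (intro exI[of _ "min d1 d2"] conjI allI impI)
        show "0 < min d1 d2" using d1 d2 by auto
        fix s t assume st: "s \<le> x \<and> x \<le> t \<and> t - s < min d1 d2"
        show "P s t" unfolding P_def
        proof (intro impI)
          assume ab: "a \<le> s" "t \<le> b"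
          have near: "dist \<tau> x < d1" "dist \<tau> x < d2" "\<tau> \<in> {a..b}" if "\<tau> \<in> {s..t}" for \<tau>
            using that st ab by (auto simp: dist_real_def)
          have FF: "F (\<gamma> x) + e / 2 \<le> F (\<gamma> \<tau>) + e" if "\<tau> \<in> {s..t}" for \<tau>
            using d1(2)[OF near(3)[OF that] near(1)[OF that]] unfolding dist_real_def by argo
          have "\<gamma> s \<in> ball (\<gamma> x) r" "\<gamma> t \<in> ball (\<gamma> x) r"
            using d2(2)[of s] d2(2)[of t] near[of s] near[of t] st by (auto simp: dist_commute)
          then have "\<bar>\<Psi> (\<gamma> t) - \<Psi> (\<gamma> s)\<bar> \<le> (F (\<gamma> x) + e / 2) * norm (\<gamma> t - \<gamma> s)"
            using r(2) by auto
          also have "norm (\<gamma> t - \<gamma> s) \<le> integral {s..t} (\<lambda>t. norm (q t))"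
          proof -
            have hi: "(q has_integral (\<gamma> t - \<gamma> s)) {s..t}" using c st ab unfolding curve_on_def by auto
            have "norm (integral {s..t} q) \<le> integral {s..t} (\<lambda>t. norm (q t))"
              using hi int0[OF ab] by (intro integral_norm_bound_integral) auto
            then show ?thesis using hi by (simp add: integral_unique)
          qed
          also have "(F (\<gamma> x) + e / 2) * integral {s..t} (\<lambda>t. norm (q t)) = integral {s..t} (\<lambda>t. (F (\<gamma>
              x) + e / 2) * norm (q t))"
            by simp
          also have "\<dots> \<le> integral {s..t} (\<lambda>t. (F (\<gamma> t) + e) * norm (q t))"
            using FF int0[OF ab] int2[OF ab] by (intro integral_le mult_right_mono
                integrable_on_mult_right) auto
          finally show "\<bar>\<Psi> (\<gamma> t) - \<Psi> (\<gamma> s)\<bar> \<le> integral {s..t} (\<lambda>t. (F (\<gamma> t) + e) * norm (q t))"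
            using F0[of "\<gamma> x"] e by (simp add: mult_left_mono)
        qed
      qed
    qed
    then show ?thesis by (simp add: P_def)
  qed
  define I where "I = integral {a..b} (\<lambda>t. norm (q t))"
  have I0: "I \<ge> 0" unfolding I_def by (intro integral_nonneg int0) auto
  show ?thesis
  proof (rule field_le_epsilon)
    fix e :: real assume e: "e > 0"
    have "\<bar>\<Psi> (\<gamma> b) - \<Psi> (\<gamma> a)\<bar> \<le> integral {a..b} (\<lambda>t. (F (\<gamma> t) + e / (I + 1)) * norm (q t))"
      using e I0 by (intro main) auto
    also have "\<dots> = integral {a..b} (\<lambda>t. F (\<gamma> t) * norm (q t)) + e / (I + 1) * I"
      unfolding distrib_right I_def using int1[of a b] integrable_on_mult_right[OF int0[of a b], of
          "e / (I + 1)"]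
      by (subst integral_add) (auto simp: I_def)
    also have "e / (I + 1) * I \<le> e" using e I0 by (simp add: field_simps)
    finally show "\<bar>\<Psi> (\<gamma> b) - \<Psi> (\<gamma> a)\<bar> \<le> integral {a..b} (\<lambda>t. F (\<gamma> t) * norm (q t)) + e" by simp
  qed
qed

lemma calibration_energy_bound:
  assumes ab: "a \<le> b" and c: "curve_on a b \<gamma> q" and W: "continuous_on UNIV W"
    and cal: "calibrates \<Psi> (\<lambda>z. sqrt (2 * W z))" and W0: "\<And>z. 0 \<le> W z"
    and q: "(\<lambda>t. (norm (q t))\<^sup>2) integrable_on {a..b}"
  shows "\<bar>\<Psi> (\<gamma> b) - \<Psi> (\<gamma> a)\<bar> \<le> integral {a..b} (\<lambda>t. (norm (q t))\<^sup>2 / 2 + W (\<gamma> t))"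
proof -
  have F: "continuous_on UNIV (\<lambda>z. sqrt (2 * W z))" by (intro continuous_intros W)
  have "\<bar>\<Psi> (\<gamma> b) - \<Psi> (\<gamma> a)\<bar> \<le> integral {a..b} (\<lambda>t. sqrt (2 * W (\<gamma> t)) * norm (q t))"
    by (rule calibration_bound[OF ab c F cal]) (simp add: W0)
  also have "\<dots> \<le> integral {a..b} (\<lambda>t. (norm (q t))\<^sup>2 / 2 + W (\<gamma> t))"
  proof (rule integral_le)
    show "(\<lambda>t. sqrt (2 * W (\<gamma> t)) * norm (q t)) integrable_on {a..b}"
      using curve_on_norm_integrable[OF c F] set_lebesgue_integral_eq_integral(1) by blast
    show "(\<lambda>t. (norm (q t))\<^sup>2 / 2 + W (\<gamma> t)) integrable_on {a..b}"
      using q continuous_on_compose2[OF W curve_on_continuous[OF c]]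
      by (intro integrable_add integrable_on_divide integrable_continuous_interval[of _ _ "\<lambda>t. W (\<gamma> t)"]) auto
    \<comment> \<open>Young's inequality; equality means |q| = sqrt (2 W), the law that the optimal
      profile will obey.\<close>
    show "sqrt (2 * W (\<gamma> t)) * norm (q t) \<le> (norm (q t))\<^sup>2 / 2 + W (\<gamma> t)" for t
    proof -
      have "0 \<le> (sqrt (2 * W (\<gamma> t)) - norm (q t))\<^sup>2" by simp
      then show ?thesis using W0[of "\<gamma> t"] by (simp add: power2_diff algebra_simps)
    qed
  qed
  finally show ?thesis .
qed

text \<open>The difference quotients are bounded by \<open>L\<close> and converge almost everywhere
  to the derivative, so their integrals converge. In terms of a primitive \<open>A\<close> of
  \<open>f\<close> these integrals are difference quotients of \<open>A\<close> at \<open>b\<close>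
  minus those at \<open>a\<close>, which tend to \<open>f b - f a\<close>.\<close>

lemma lipschitz_real_FTC:
  fixes f :: "real \<Rightarrow> real"
  assumes lip: "L-lipschitz_on UNIV f" and ab: "a \<le> b"
  shows "deriv f absolutely_integrable_on {a..b}" "(deriv f has_integral (f b - f a)) {a..b}"
proof -
  define h where "h n = 1 / (real n + 1)" for n
  have h: "0 < h n" "h n \<le> 1" "h n \<noteq> 0" for n by (auto simp: h_def)
  have h0: "h \<longlonglongrightarrow> 0" unfolding h_def by real_asymp
  have hat: "filterlim h (at 0) sequentially" using h0 h by (intro filterlim_atI) auto
  define g where "g n t = (f (t + h n) - f t) / h n" for n t
  have cf: "continuous_on UNIV f" by (rule lipschitz_on_continuous_on[OF lip])
  have cfs: "continuous_on A (\<lambda>t. f (t + c))" for A c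
    by (intro continuous_on_compose2[OF cf] continuous_intros) auto
  have cg: "continuous_on A (g n)" for A n unfolding g_def using h
    by (intro continuous_intros cfs continuous_on_subset[OF cf]) auto
  have diff: "AE t in lebesgue. (f has_real_derivative deriv f t) (at t)"
    using lipschitz_real_AE_differentiable[OF lip]
    by (auto intro!: AE_completion simp: DERIV_deriv_iff_real_differentiable)
  have glim: "AE t in lebesgue. (\<lambda>n. g n t) \<longlonglongrightarrow> deriv f t"
    using diff
  proof eventually_elim
    case (elim t)
    then have "((\<lambda>h. (f (t + h) - f t) / h) \<longlongrightarrow> deriv f t) (at 0)" by (simp add: DERIV_def)
    from filterlim_compose[OF this hat] show ?case by (simp add: g_def)
  qed
  have lim: "AE t in lebesgue_on {a..b}. (\<lambda>n. g n t) \<longlonglongrightarrow> deriv f t"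
    using glim by (subst AE_restrict_space_iff) auto
  have bnd: "norm (g n t) \<le> L" for n t
    using lipschitz_onD[OF lip, of "t + h n" t] h(1)[of n] by (simp add: g_def dist_real_def field_simps)
  have gm: "g n \<in> borel_measurable (lebesgue_on {a..b})" for n
    using cg by (intro continuous_imp_measurable_on_sets_lebesgue) auto
  have dm: "deriv f \<in> borel_measurable (lebesgue_on {a..b})"
  proof -
    have "g n \<in> borel_measurable borel" for n using cg by (rule borel_measurable_continuous_onI)
    then have "(\<lambda>t. lim (\<lambda>n. g n t)) \<in> borel_measurable borel" by (rule borel_measurable_lim_metric)
    then have "(\<lambda>t. lim (\<lambda>n. g n t)) \<in> borel_measurable lebesgue"
      by (simp add: measurable_completion)
    moreover have "AE t in lebesgue. lim (\<lambda>n. g n t) = deriv f t"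
      using glim by eventually_elim (rule limI)
    ultimately have "deriv f \<in> borel_measurable lebesgue" by (rule borel_measurable_AE)
    then show ?thesis by (rule measurable_restrict_space1)
  qed
  have ci: "integrable (lebesgue_on {a..b}) (\<lambda>_. L)" by simp
  have I: "integrable (lebesgue_on {a..b}) (deriv f)"
    using bnd by (intro integrable_dominated_convergence[OF dm gm ci lim]) auto
  have C: "(\<lambda>n. integral\<^sup>L (lebesgue_on {a..b}) (g n)) \<longlonglongrightarrow> integral\<^sup>L (lebesgue_on {a..b}) (deriv f)"
    using bnd by (intro integral_dominated_convergence[OF dm gm ci lim]) auto
  show ai: "deriv f absolutely_integrable_on {a..b}"
    using I by (simp add: integrable_restrict_space set_integrable_def)
  \<comment> \<open>The margins leave room for the steps \<open>h n\<close>, which are at most 1,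
    and make the derivative of \<open>A\<close> two-sided at all points that occur.\<close>
  obtain A where A: "\<And>t. t \<in> {a - 1..b + 2} \<Longrightarrow> (A has_vector_derivative f t) (at t within {a - 1..b + 2})"
    using antiderivative_continuous[of "a - 1" "b + 2" f] continuous_on_subset[OF cf] by blast
  have A': "(A has_real_derivative f t) (at t)" if "a - 1 < t" "t < b + 2" for t
    using A[of t] that at_within_Icc_at[of "a - 1" t "b + 2"]
        by (auto simp: has_real_derivative_iff_has_vector_derivative)
  have gi: "integral\<^sup>L (lebesgue_on {a..b}) (g n) = (A (b + h n) - A b) / h n - (A (a + h n)
      - A a) / h n" for n
  proof -
    have "(g n has_integral ((A (b + h n) - A b) / h n - (A (a + h n) - A a) / h n)) {a..b}"
      unfolding g_def
    proof (rule fundamental_theorem_of_calculus[OF ab])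
      fix t assume t: "t \<in> {a..b}"
      have "((\<lambda>t. (A (t + h n) - A t) / h n) has_real_derivative (f (t + h n) - f t) / h n) (at t)"
        using h[of n] t by (auto intro!: derivative_eq_intros A' DERIV_chain2[where f=A and g="\<lambda>t. t
            + h n", THEN DERIV_cong])
      then show "((\<lambda>t. (A (t + h n) - A t) / h n) has_vector_derivative (f (t + h n)
          - f t) / h n) (at t within {a..b})"
        by (auto simp: has_real_derivative_iff_has_vector_derivative intro: has_vector_derivative_at_within)
    qed
    moreover have "g n absolutely_integrable_on {a..b}"
      using cg absolutely_integrable_continuous_real by blast
    ultimately show ?thesis
      using set_lebesgue_integral_eq_integral(2)[of "{a..b}" "g n"] 
      by (simp add: integral_unique set_lebesgue_integral_def integral_restrict_space)
  qed
  have qlim: "(\<lambda>n. (A (t + h n) - A t) / h n) \<longlonglongrightarrow> f t" if "a \<le> t" "t \<le> b" for t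
    using filterlim_compose[OF _ hat, of "\<lambda>h. (A (t + h) - A t) / h" "nhds (f t)"] A'[of t] that
        by (auto simp: DERIV_def)
  have "(\<lambda>n. integral\<^sup>L (lebesgue_on {a..b}) (g n)) \<longlonglongrightarrow> f b - f a"
    unfolding gi using ab by (intro tendsto_diff qlim) auto
  then have "integral\<^sup>L (lebesgue_on {a..b}) (deriv f) = f b - f a" using C LIMSEQ_unique by blast
  then have "integral {a..b} (deriv f) = f b - f a"
    using set_lebesgue_integral_eq_integral(2)[OF ai] 
    by (simp add: set_lebesgue_integral_def integral_restrict_space)
  then show "(deriv f has_integral (f b - f a)) {a..b}"
    using set_lebesgue_integral_eq_integral(1)[OF ai] by (metis integrable_integral)
qed

text \<open>Connects the integrand of \<open>geod\<close>, written with
  \<open>vector_derivative\<close>, to the calibration bound. Clamping the parameter extends the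
  curve to the line; the end points join the exceptional null set because \<open>\<gamma>\<close> is
  arbitrary outside \<open>{-1..1}\<close>.\<close>

lemma lipschitz_curve_on:
  fixes \<gamma> :: "real \<Rightarrow> real^'n"
  assumes lip: "L-lipschitz_on {-1..1} \<gamma>"
  shows "curve_on (-1) 1 \<gamma> (\<lambda>t. vector_derivative \<gamma> (at t))"
proof -
  define c where "c t = max (-1) (min 1 t)" for t :: real
  define f where "f i t = \<gamma> (c t) $ i" for i t
  have c: "c t \<in> {-1..1}" "t \<in> {-1..1} \<Longrightarrow> c t = t" for t by (auto simp: c_def)
  have flip: "L-lipschitz_on UNIV (f i)" for i
  proof (rule lipschitz_onI)
    fix s t
    have "dist (f i s) (f i t) \<le> dist (\<gamma> (c s)) (\<gamma> (c t))" unfolding f_def by (rule dist_vec_nth_le)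
    also have "\<dots> \<le> L * dist (c s) (c t)" using lipschitz_onD[OF lip] c by blast
    also have "\<dots> \<le> L * dist s t"
      using lipschitz_on_nonneg[OF lip] by (intro mult_left_mono) (auto simp: c_def dist_real_def)
    finally show "dist (f i s) (f i t) \<le> L * dist s t" .
  qed (use lipschitz_on_nonneg[OF lip] in auto)
  define q where "q t = (\<chi> i. deriv (f i) t)" for t
  have qi: "(q has_integral (\<gamma> t - \<gamma> s)) {s..t}" if "-1 \<le> s" "s \<le> t" "t \<le> 1" for s t
  proof (subst has_integral_componentwise_iff, intro ballI)
    fix b :: "real^'n" assume "b \<in> Basis"
    then obtain i where b: "b = axis i 1" by (auto simp: Basis_vec_def)
    show "((\<lambda>x. q x \<bullet> b) has_integral (\<gamma> t - \<gamma> s) \<bullet> b) {s..t}"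
      using lipschitz_real_FTC(2)[OF flip[of i] that(2)] that
      by (simp add: b inner_axis q_def f_def c(2))
  qed
  have qa: "q absolutely_integrable_on {-1..1}"
  proof (subst absolutely_integrable_componentwise_iff, intro ballI)
    fix b :: "real^'n" assume "b \<in> Basis"
    then obtain i where b: "b = axis i 1" by (auto simp: Basis_vec_def)
    show "(\<lambda>x. q x \<bullet> b) absolutely_integrable_on {-1..1}"
      using lipschitz_real_FTC(1)[OF flip[of i], of "-1" 1] by (simp add: b inner_axis q_def)
  qed
  have AE: "AE t in lebesgue. \<forall>i. (f i has_real_derivative deriv (f i) t) (at t)"
    using lipschitz_real_AE_differentiable[OF flip]
    by (auto intro!: AE_completion simp: DERIV_deriv_iff_real_differentiable AE_all_countable)
  define N where "N = {t. \<not> (\<forall>i. (f i has_real_derivative deriv (f i) t) (at t))} \<union> {-1, 1}"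
  obtain N0 where "N0 \<in> null_sets lebesgue" "{t. \<not> (\<forall>i. (f i has_real_derivative deriv (f i) t) (at t))} \<subseteq> N0"
    using AE by (auto simp: eventually_ae_filter)
  then have "negligible {t. \<not> (\<forall>i. (f i has_real_derivative deriv (f i) t) (at t))}"
    by (meson negligible_iff_null_sets negligible_subset)
  then have "negligible N" unfolding N_def by (rule negligible_Un) (rule negligible_finite, simp)
  have qv: "vector_derivative \<gamma> (at t) = q t" if "t \<in> {-1..1} - N" for t
  proof -
    have t: "-1 < t" "t < 1" "\<And>i. (f i has_real_derivative deriv (f i) t) (at t)"
      using that unfolding N_def by (auto simp: less_le)
    have "((\<lambda>t. \<gamma> (c t)) has_vector_derivative q t) (at t)"
      unfolding has_vector_derivative_def
    proof (subst has_derivative_componentwise_within, intro ballI)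
      fix b :: "real^'n" assume "b \<in> Basis"
      then obtain i where b: "b = axis i 1" by (auto simp: Basis_vec_def)
      show "((\<lambda>t. \<gamma> (c t) \<bullet> b) has_derivative (\<lambda>x. (x *\<^sub>R q t) \<bullet> b)) (at t)"
        using t(3)[of i] unfolding has_field_derivative_def f_def[abs_def] q_def
        by (simp add: b inner_axis mult.commute[of _ "deriv _ _"])
    qed
    then have "(\<gamma> has_vector_derivative q t) (at t)"
    proof (rule has_vector_derivative_transform_within_open[where S="{-1<..<1}"])
    qed (use t c in auto)
    then show ?thesis by (rule vector_derivative_at)
  qed
  have sub: "negligible N" by fact
  show ?thesis unfolding curve_on_def
  proof (intro conjI allI impI)
    show "(\<lambda>t. vector_derivative \<gamma> (at t)) absolutely_integrable_on {-1..1}"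
      by (rule absolutely_integrable_spike[OF qa sub]) (use qv in auto)
    fix s t :: real assume "-1 \<le> s \<and> s \<le> t \<and> t \<le> 1"
    then show "((\<lambda>t. vector_derivative \<gamma> (at t)) has_integral (\<gamma> t - \<gamma> s)) {s..t}"
      using qv by (intro has_integral_spike[OF sub _ qi]) auto
  qed
qed

subsection \<open>Weak derivatives\<close>

lemma test_fun_bounds:
  assumes "test_fun \<phi> D\<phi>"
  obtains \<rho> C where "\<rho> > 0" "C > 0" "\<And>x. norm x > \<rho> \<Longrightarrow> \<phi> x = 0" "\<And>x. norm x > \<rho> \<Longrightarrow> D\<phi> x = 0"
    "\<And>x. \<bar>\<phi> x\<bar> \<le> C" "\<And>x. norm (D\<phi> x) \<le> C"
proof -
  obtain K where K: "compact K" "\<And>x. x \<notin> K \<Longrightarrow> \<phi> x = 0" using assms unfolding test_fun_def by auto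
  have der: "(\<phi> has_derivative (\<lambda>h. D\<phi> x \<bullet> h)) (at x)" for x using assms unfolding test_fun_def by auto
  have cD: "continuous_on UNIV D\<phi>" using assms unfolding test_fun_def by auto
  have c\<phi>: "continuous_on UNIV \<phi>"
    using der has_derivative_continuous by (metis continuous_at_imp_continuous_on)
  have D0: "D\<phi> x = 0" if "x \<notin> K" for x
  proof -
    have "((\<lambda>_. 0) has_derivative (\<lambda>h. D\<phi> x \<bullet> h)) (at x)"
      by (rule has_derivative_transform_within_open[OF der, of "- K"])
         (use K that compact_imp_closed in auto)
    then have "(\<lambda>h. D\<phi> x \<bullet> h) = (\<lambda>h. 0)" using has_derivative_unique has_derivative_const by blast
    then have "D\<phi> x \<bullet> D\<phi> x = 0" by metis
    then show ?thesis by simp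
  qed
  obtain \<rho> where \<rho>: "\<rho> > 0" "\<And>x. x \<in> K \<Longrightarrow> norm x \<le> \<rho>"
    using compact_imp_bounded[OF K(1)] unfolding bounded_pos by auto
  obtain C1 where C1: "C1 > 0" "\<And>x. x \<in> K \<Longrightarrow> norm (\<phi> x) \<le> C1"
    using compact_imp_bounded[OF compact_continuous_image[OF continuous_on_subset[OF c\<phi>] K(1)]]
        unfolding bounded_pos by auto
  obtain C2 where C2: "C2 > 0" "\<And>x. x \<in> K \<Longrightarrow> norm (D\<phi> x) \<le> C2"
    using compact_imp_bounded[OF compact_continuous_image[OF continuous_on_subset[OF cD] K(1)]]
        unfolding bounded_pos by auto
  show ?thesis
  proof
    show "\<rho> > 0" "max C1 C2 > 0" using \<rho> C1 by auto
    show "\<phi> x = 0" "D\<phi> x = 0" if "norm x > \<rho>" for x using \<rho>(2)[of x] K(2)[of x] D0[of x] that by force+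
    show "\<bar>\<phi> x\<bar> \<le> max C1 C2" for x using C1 K(2)[of x] by (cases "x \<in> K") (auto simp: le_max_iff_disj)
    show "norm (D\<phi> x) \<le> max C1 C2" for x using C2(2)[of x] C1(1) D0[of x]
        by (cases "x \<in> K") (auto simp: le_max_iff_disj)
  qed
qed

lemma test_fun_measurable:
  assumes "test_fun \<phi> D\<phi>"
  shows "\<phi> \<in> borel_measurable borel" "D\<phi> \<in> borel_measurable borel"
proof -
  have "continuous_on UNIV \<phi>"
    using assms has_derivative_continuous unfolding test_fun_def by (metis continuous_at_imp_continuous_on)
  then show "\<phi> \<in> borel_measurable borel" by (rule borel_measurable_continuous_onI)
  show "D\<phi> \<in> borel_measurable borel"
    using assms unfolding test_fun_def by (intro borel_measurable_continuous_onI) auto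
qed

lemma test_fun_translate:
  assumes "test_fun \<phi> D\<phi>"
  shows "test_fun (\<lambda>x. \<phi> (x + v)) (\<lambda>x. D\<phi> (x + v))"
proof -
  obtain K where K: "compact K" "\<And>x. x \<notin> K \<Longrightarrow> \<phi> x = 0" using assms unfolding test_fun_def by auto
  have der: "(\<phi> has_derivative (\<lambda>h. D\<phi> x \<bullet> h)) (at x)" for x using assms unfolding test_fun_def by auto
  have cD: "continuous_on UNIV D\<phi>" using assms unfolding test_fun_def by auto
  show ?thesis unfolding test_fun_def
  proof (intro conjI allI exI[of _ "(\<lambda>x. x - v) ` K"] impI)
    show "compact ((\<lambda>x. x - v) ` K)" by (intro compact_continuous_image K continuous_intros)
    show "\<phi> (x + v) = 0" if "x \<notin> (\<lambda>x. x - v) ` K" for x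
      using that by (intro K) (metis add_diff_cancel_right' image_eqI)
    show "continuous_on UNIV (\<lambda>x. D\<phi> (x + v))"
      by (intro continuous_on_compose2[OF cD] continuous_intros) auto
    show "((\<lambda>x. \<phi> (x + v)) has_derivative (\<bullet>) (D\<phi> (x + v))) (at x)" for x
      using has_derivative_compose[of "\<lambda>x. x + v" "\<lambda>h. h" x UNIV \<phi> "\<lambda>h. D\<phi> (x + v) \<bullet> h"] der[of "x + v"]
      by (simp add: has_derivative_add_const)
  qed
qed

text \<open>Squaring the positive part of r^2 - |x - c|^2 makes it C1, as \<open>test_fun\<close>
  requires. Together with products, such positivity sets will generate the Borel sets.\<close>

lemma test_fun_ball:
  fixes c :: "real^'n"
  assumes "r > 0"
  shows "\<exists>Z DZ. test_fun Z DZ \<and> (\<forall>x. 0 \<le> Z x) \<and> {x. 0 < Z x} = ball c r"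
proof -
  define t where "t x = r\<^sup>2 - (x - c) \<bullet> (x - c)" for x
  have sq: "((\<lambda>s. (max 0 s)\<^sup>2) has_real_derivative 2 * max 0 s) (at s)" for s :: real
  proof (cases s "0::real" rule: linorder_cases)
    case less
    have "((\<lambda>s. 0::real) has_real_derivative 0) (at s)" by simp
    then have "((\<lambda>s. (max 0 s)\<^sup>2) has_real_derivative 0) (at s)"
      by (rule has_field_derivative_transform_within_open[of _ _ _ "{..<0}"]) (use less in auto)
    then show ?thesis using less by simp
  next
    case equal
    have "((\<lambda>h. ((max 0 (0 + h))\<^sup>2 - (max 0 (0::real))\<^sup>2) / h) \<longlongrightarrow> 0) (at 0)"
    proof (rule Lim_null_comparison)
      show "\<forall>\<^sub>F h in at 0. norm (((max 0 (0 + h))\<^sup>2 - (max 0 (0::real))\<^sup>2) / h) \<le> \<bar>h\<bar>"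
        by (rule always_eventually) (auto simp: max_def power2_eq_square)
      show "((\<lambda>h. \<bar>h\<bar>) \<longlongrightarrow> 0) (at (0::real))" by (intro tendsto_eq_intros) auto
    qed
    then show ?thesis unfolding equal DERIV_def by simp
  next
    case greater
    have "((\<lambda>s. s\<^sup>2) has_real_derivative 2 * s) (at s)" by (auto intro!: derivative_eq_intros)
    then have "((\<lambda>s. (max 0 s)\<^sup>2) has_real_derivative 2 * s) (at s)"
      by (rule has_field_derivative_transform_within_open[of _ _ _ "{0<..}"]) (use greater in auto)
    then show ?thesis using greater by simp
  qed
  have tder: "(t has_derivative (\<lambda>h. - 2 * ((x - c) \<bullet> h))) (at x)" for x
    unfolding t_def by (auto intro!: derivative_eq_intros simp: inner_commute)
  have supp: "t x \<le> 0 \<longleftrightarrow> x \<notin> ball c r" for x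
  proof -
    have "t x \<le> 0 \<longleftrightarrow> r\<^sup>2 \<le> (dist c x)\<^sup>2"
      unfolding t_def dist_commute[of c] by (simp add: dist_norm power2_norm_eq_inner)
    also have "\<dots> \<longleftrightarrow> r \<le> dist c x" using assms by (metis abs_le_square_iff abs_of_nonneg less_imp_le
        zero_le_dist)
    finally show ?thesis by auto
  qed
  have "test_fun (\<lambda>x. (max 0 (t x))\<^sup>2) (\<lambda>x. (2 * max 0 (t x)) *\<^sub>R (- 2 *\<^sub>R (x - c)))"
    unfolding test_fun_def
  proof (intro conjI allI exI[of _ "cball c r"] impI)
    show "compact (cball c r)" by simp
    show "(max 0 (t x))\<^sup>2 = 0" if "x \<notin> cball c r" for x using supp[of x] that by (auto simp: max_def)
    show "continuous_on UNIV (\<lambda>x. (2 * max 0 (t x)) *\<^sub>R (- 2 *\<^sub>R (x - c)))"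
      unfolding t_def by (intro continuous_intros)
    show "((\<lambda>x. (max 0 (t x))\<^sup>2) has_derivative (\<bullet>) ((2 * max 0 (t x)) *\<^sub>R (- 2 *\<^sub>R (x - c)))) (at x)" for x
      by (rule has_derivative_eq_rhs[OF has_derivative_compose[OF tder sq[of "t x", unfolded
          has_field_derivative_def]]])
         (simp add: fun_eq_iff)
  qed
  moreover have "{x. 0 < (max 0 (t x))\<^sup>2} = ball c r"
  proof -
    have "0 < (max 0 (t x))\<^sup>2 \<longleftrightarrow> \<not> t x \<le> 0" for x by (auto simp: max_def)
    then show ?thesis unfolding supp by blast
  qed
  ultimately show ?thesis
    by (intro exI[of _ "\<lambda>x. (max 0 (t x))\<^sup>2"] exI[of _ "\<lambda>x. (2 * max 0 (t x)) *\<^sub>R (- 2 *\<^sub>R (x - c))"]) simp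
qed

lemma test_fun_C1_mult:
  assumes "test_fun f Df" and d: "\<And>x. (g has_derivative (\<lambda>h. Dg x \<bullet> h)) (at x)" "continuous_on UNIV Dg"
  shows "test_fun (\<lambda>x. f x * g x) (\<lambda>x. f x *\<^sub>R Dg x + g x *\<^sub>R Df x)"
proof -
  obtain K where K: "compact K" "\<And>x. x \<notin> K \<Longrightarrow> f x = 0" using assms unfolding test_fun_def by auto
  have df: "(f has_derivative (\<lambda>h. Df x \<bullet> h)) (at x)" for x
    using assms unfolding test_fun_def by auto
  have c: "continuous_on UNIV f" "continuous_on UNIV g"
    using df d(1) has_derivative_continuous by (metis continuous_at_imp_continuous_on)+
  show ?thesis unfolding test_fun_def
  proof (intro conjI allI exI[of _ K] impI)
    show "continuous_on UNIV (\<lambda>x. f x *\<^sub>R Dg x + g x *\<^sub>R Df x)"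
      using assms unfolding test_fun_def by (intro continuous_intros c) auto
    show "((\<lambda>x. f x * g x) has_derivative (\<bullet>) (f x *\<^sub>R Dg x + g x *\<^sub>R Df x)) (at x)" for x
      by (rule derivative_eq_intros d df refl)+ (auto simp: algebra_simps inner_add_left)
  qed (use K in auto)
qed

lemma test_fun_mult:
  assumes "test_fun f Df" "test_fun g Dg"
  shows "test_fun (\<lambda>x. f x * g x) (\<lambda>x. f x *\<^sub>R Dg x + g x *\<^sub>R Df x)"
  using assms by (intro test_fun_C1_mult) (auto simp: test_fun_def)

text \<open>As \<open>n\<close> grows these test functions increase to the indicator of the set
  where \<open>Z\<close> is positive.\<close>

lemma test_fun_saturate:
  assumes Z: "test_fun Z DZ" and pos: "\<And>x. 0 \<le> Z x" and n: "0 \<le> n"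
  shows "test_fun (\<lambda>x. n * Z x / (1 + n * Z x)) (\<lambda>x. (n / (1 + n * Z x)\<^sup>2) *\<^sub>R DZ x)"
proof -
  obtain K where K: "compact K" "\<And>x. x \<notin> K \<Longrightarrow> Z x = 0" using assms unfolding test_fun_def by auto
  have d: "(Z has_derivative (\<lambda>h. DZ x \<bullet> h)) (at x)" for x
    using assms unfolding test_fun_def by auto
  have c: "continuous_on UNIV Z"
    using d has_derivative_continuous by (metis continuous_at_imp_continuous_on)
  have p: "1 + n * Z x > 0" for x using pos n by (simp add: add_pos_nonneg)
  show ?thesis unfolding test_fun_def
  proof (intro conjI allI exI[of _ K] impI)
    show "continuous_on UNIV (\<lambda>x. (n / (1 + n * Z x)\<^sup>2) *\<^sub>R DZ x)"
      using assms p unfolding test_fun_def by (intro continuous_intros c) (auto simp: less_le)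
    show "((\<lambda>x. n * Z x / (1 + n * Z x)) has_derivative (\<bullet>) ((n / (1 + n * Z x)\<^sup>2) *\<^sub>R DZ x)) (at x)" for x
    proof -
      have "((\<lambda>s. n * s / (1 + n * s)) has_real_derivative n / (1 + n * Z x)\<^sup>2) (at (Z x))"
        using p[of x] by (auto intro!: derivative_eq_intros simp: field_simps power2_eq_square)
      from has_derivative_compose[OF d this[unfolded has_field_derivative_def]] show ?thesis
        by (rule has_derivative_eq_rhs) (simp add: fun_eq_iff)
    qed
  qed (use K in auto)
qed

text \<open>The positive and negative parts of \<open>w\<close>, taken as densities, give the same
  finite mass to every set where some nonnegative test function is positive. These sets are stable
  under intersection (multiply the functions) and generate the Borel sets (balls are among them), so
  the two measures coincide, and hence the densities.\<close>

lemma fundamental_lemma: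
  fixes w :: "real^'n \<Rightarrow> real"
  assumes [measurable]: "w \<in> borel_measurable borel"
    and loc: "\<And>r. integrable lborel (\<lambda>x. indicator (cball 0 r) x * w x)"
    and zero: "\<And>\<phi> D\<phi>. test_fun \<phi> D\<phi> \<Longrightarrow> integral\<^sup>L lborel (\<lambda>x. w x * \<phi> x) = 0"
  shows "AE x in lborel. w x = 0"
proof -
  define G :: "(real^'n) set set" where "G = {U. \<exists>Z DZ. test_fun Z DZ \<and> (\<forall>x. 0 \<le> Z x) \<and> U = {x. 0 < Z x}}"
  have ballG: "ball c r \<in> G" if "r > 0" for c r
    using test_fun_ball[OF that, of c] unfolding G_def by auto
  have GU: "\<exists>r. U \<subseteq> cball 0 r \<and> open U \<and> integral\<^sup>L lborel (\<lambda>x. indicator U x * w x) = 0" if U: "U \<in> G" for U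
  proof -
    obtain Z DZ where Z: "test_fun Z DZ" "\<And>x. 0 \<le> Z x" "U = {x. 0 < Z x}" using U unfolding G_def by auto
    obtain \<rho> C where \<rho>: "\<rho> > 0" "\<And>x. norm x > \<rho> \<Longrightarrow> Z x = 0" using test_fun_bounds[OF Z(1)] by metis
    have cZ: "continuous_on UNIV Z"
      using Z(1) has_derivative_continuous unfolding test_fun_def by (metis continuous_at_imp_continuous_on)
    have oU: "open U" unfolding Z(3) by (intro open_Collect_less continuous_intros cZ)
    have [measurable]: "U \<in> sets borel" using oU by auto
    have [measurable]: "Z \<in> borel_measurable borel" by (rule test_fun_measurable[OF Z(1)])
    have sub: "U \<subseteq> cball 0 \<rho>" using \<rho>(2) Z(3) by (force simp: not_le[symmetric])
    define \<phi> where "\<phi> n x = real n * Z x / (1 + real n * Z x)" for n x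
    have \<phi>1: "0 \<le> \<phi> n x" "\<phi> n x \<le> 1" for n x 
    proof -
      have "0 \<le> real n * Z x" using Z(2)[of x] by simp
      then show "0 \<le> \<phi> n x" "\<phi> n x \<le> 1" unfolding \<phi>_def by (auto simp: divide_simps)
    qed
    have "(\<lambda>n. integral\<^sup>L lborel (\<lambda>x. w x * \<phi> n x)) \<longlonglongrightarrow> integral\<^sup>L lborel (\<lambda>x. indicator U x * w x)"
    proof (rule integral_dominated_convergence[where w="\<lambda>x. norm (indicator (cball 0 \<rho>) x * w x)"])
      show "integrable lborel (\<lambda>x. norm (indicator (cball 0 \<rho>) x * w x))" using loc by (rule integrable_norm)
      show "(\<lambda>x. w x * \<phi> n x) \<in> borel_measurable lborel" for n unfolding \<phi>_def by measurable
      show "AE x in lborel. norm (w x * \<phi> n x) \<le> norm (indicator (cball 0 \<rho>) x * w x)" for n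
      proof (rule AE_I2)
        fix x show "norm (w x * \<phi> n x) \<le> norm (indicator (cball 0 \<rho>) x * w x)"
        proof (cases "norm x \<le> \<rho>")
          case True
          then show ?thesis using \<phi>1[of n x] by (simp add: abs_mult mult_left_le)
        next
          case False
          then show ?thesis using \<rho>(2)[of x] by (simp add: \<phi>_def)
        qed
      qed
      show "AE x in lborel. (\<lambda>n. w x * \<phi> n x) \<longlonglongrightarrow> indicator U x * w x"
      proof (rule AE_I2)
        fix x
        show "(\<lambda>n. w x * \<phi> n x) \<longlonglongrightarrow> indicator U x * w x"
        proof (cases "Z x > 0")
          case True
          then have "(\<lambda>n. \<phi> n x) \<longlonglongrightarrow> 1" unfolding \<phi>_def by real_asymp
          then have "(\<lambda>n. w x * \<phi> n x) \<longlonglongrightarrow> w x * 1" by (rule tendsto_mult_left)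
          then show ?thesis using True Z(3) by simp
        next
          case False
          then have "Z x = 0" using Z(2)[of x] by auto
          then show ?thesis using Z(3) by (simp add: \<phi>_def)
        qed
      qed
    qed measurable
    moreover have "integral\<^sup>L lborel (\<lambda>x. w x * \<phi> n x) = 0" for n
      unfolding \<phi>_def by (rule zero[OF test_fun_saturate[OF Z(1,2)]]) auto
    ultimately have "integral\<^sup>L lborel (\<lambda>x. indicator U x * w x) = 0" by (simp add: LIMSEQ_const_iff)
    then show ?thesis using sub oU by blast
  qed
  have emU: "emeasure (density lborel (\<lambda>x. ennreal (w x))) U = emeasure (density lborel (\<lambda>x. ennreal (-
      w x))) U
      \<and> emeasure (density lborel (\<lambda>x. ennreal (w x))) U \<noteq> \<infinity>" if U: "U \<in> G" for U
  proof -
    obtain r where r: "U \<subseteq> cball 0 r" "open U" "integral\<^sup>L lborel (\<lambda>x. indicator U x * w x) = 0"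
        using GU[OF U] by blast
    have [measurable]: "U \<in> sets borel" using r by auto
    have int: "integrable lborel (\<lambda>x. indicator U x * w x)"
      by (rule Bochner_Integration.integrable_bound[OF loc[of r]]) (use r(1) in \<open>auto
          simp: indicator_def intro!: AE_I2\<close>)
    have fin: "(\<integral>\<^sup>+x. ennreal (indicator U x * w x) \<partial>lborel) < \<infinity>" "(\<integral>\<^sup>+x. ennreal (- (indicator U x * w
        x)) \<partial>lborel) < \<infinity>"
      using integrableD(2,3)[OF int] by (auto simp: top.not_eq_extremum)
    moreover have "enn2real (\<integral>\<^sup>+x. ennreal (indicator U x * w x) \<partial>lborel) = enn2real (\<integral>\<^sup>+x. ennreal (-
        (indicator U x * w x)) \<partial>lborel)"
      using real_lebesgue_integral_def[OF int] r(3) by simp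
    ultimately have "(\<integral>\<^sup>+x. ennreal (indicator U x * w x) \<partial>lborel) = (\<integral>\<^sup>+x. ennreal (- (indicator U x *
        w x)) \<partial>lborel)"
      by (metis ennreal_enn2real infinity_ennreal_def)
    moreover have "emeasure (density lborel (\<lambda>x. ennreal (w x))) U = (\<integral>\<^sup>+x. ennreal (indicator U x * w
        x) \<partial>lborel)"
      by (subst emeasure_density) (auto intro!: nn_integral_cong simp: indicator_def)
    moreover have "emeasure (density lborel (\<lambda>x. ennreal (- w x))) U = (\<integral>\<^sup>+x. ennreal (- (indicator U x
        * w x)) \<partial>lborel)"
      by (subst emeasure_density) (auto intro!: nn_integral_cong simp: indicator_def)
    ultimately show ?thesis using fin by auto
  qed
  have sig: "sets (borel :: (real^'n) measure) = sigma_sets UNIV G"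
  proof -
    have "sigma_sets UNIV {S :: (real^'n) set. open S} = sigma_sets UNIV G"
    proof (rule sigma_sets_eqI)
      fix S :: "(real^'n) set" assume "S \<in> {S. open S}"
      then have S: "open S" by simp
      define B where "B = {ball c r | c r. r > 0 \<and> ball c r \<subseteq> S}"
      obtain B' where B': "B' \<subseteq> B" "countable B'" "\<Union>B' = \<Union>B"
        by (rule Lindelof[of B]) (auto simp: B_def)
      have "\<Union>B = S"
      proof
        show "S \<subseteq> \<Union>B"
        proof
          fix x assume "x \<in> S"
          then obtain e where "e > 0" "ball x e \<subseteq> S" using S open_contains_ball by blast
          then show "x \<in> \<Union>B" unfolding B_def by (intro UnionI[of "ball x e"]) auto
        qed
      qed (auto simp: B_def)
      moreover have "\<Union>B' \<in> sigma_sets UNIV G"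
      proof (rule sigma_sets_UNION[OF B'(2)])
        fix b assume "b \<in> B'" then show "b \<in> sigma_sets UNIV G"
          using B'(1) ballG unfolding B_def by (auto intro!: sigma_sets.Basic)
      qed
      ultimately show "S \<in> sigma_sets UNIV G" using B'(3) by simp
    next
      fix U assume "U \<in> G" then show "U \<in> sigma_sets UNIV {S. open S}" using GU[of U]
          by (auto intro!: sigma_sets.Basic)
    qed
    then show ?thesis by (simp add: borel_def)
  qed
  \<comment> \<open>\<open>ennreal\<close> truncates at 0, so these densities are the positive and
    the negative part.\<close>
  have "density lborel (\<lambda>x. ennreal (w x)) = density lborel (\<lambda>x. ennreal (- w x))"
  proof (rule measure_eqI_generator_eq[where E=G and \<Omega>=UNIV and A="\<lambda>n. ball 0 (real (Suc n))"])
    show "Int_stable G"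
    proof (rule Int_stableI)
      fix a b assume "a \<in> G" "b \<in> G"
      then obtain Z DZ Y DY where Z: "test_fun Z DZ" "\<And>x. 0 \<le> Z x" "a = {x. 0 < Z x}"
        "test_fun Y DY" "\<And>x. 0 \<le> Y x" "b = {x. 0 < Y x}" unfolding G_def by blast
      have "a \<inter> b = {x. 0 < Z x * Y x}" using Z(2,5) by (auto simp: Z(3,6) zero_less_mult_iff) (meson leD)+
      then show "a \<inter> b \<in> G" unfolding G_def using test_fun_mult[OF Z(1,4)] Z(2,5) by auto
    qed
    show "(\<Union>n. ball 0 (real (Suc n))) = (UNIV :: (real^'n) set)"
    proof -
      have "\<exists>n. norm x < real (Suc n)" for x :: "real^'n" using reals_Archimedean2[of "norm x"]
          by (metis less_trans lessI of_nat_less_iff)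
      then show ?thesis by auto
    qed
    show "emeasure (density lborel (\<lambda>x. ennreal (w x))) (ball 0 (real (Suc i))) \<noteq> \<infinity>" for i
      using emU[OF ballG[of "real (Suc i)" 0]] of_nat_0_less_iff by blast
  qed (use emU ballG sig in auto)
  then have "AE x in lborel. ennreal (w x) = ennreal (- w x)"
    by (intro sigma_finite_measure.density_unique[OF sigma_finite_lborel]) auto
  then show ?thesis
  proof eventually_elim
    case (elim x) then show ?case by (cases "w x \<ge> 0") (auto simp: ennreal_neg)
  qed
qed

section \<open>Translations, shears and finite increments of weakly differentiable functions\<close>

lemma cball_sets_borel [measurable]: "cball (c :: 'a::metric_space) r \<in> sets borel"
  by (simp add: borel_closed)

lemma borel_measurable_vec_nth [measurable (raw)]:
  fixes f :: "'a \<Rightarrow> real^'n"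
  assumes [measurable]: "f \<in> borel_measurable M"
  shows "(\<lambda>x. f x $ i) \<in> borel_measurable M"
proof -
  have "(\<lambda>x. f x \<bullet> axis i 1) \<in> borel_measurable M" by measurable
  then show ?thesis by (simp add: inner_axis)
qed

lemma nn_integral_lborel_shift:
  fixes v :: "'a::euclidean_space"
  assumes [measurable]: "f \<in> borel_measurable borel"
  shows "(\<integral>\<^sup>+x. f (x + v) \<partial>lborel) = (\<integral>\<^sup>+x. f x \<partial>lborel)"
proof -
  have "(\<integral>\<^sup>+x. f x \<partial>lborel) = (\<integral>\<^sup>+x. f x \<partial>(distr lborel borel ((+) v)))" by (simp add: lborel_distr_plus)
  also have "\<dots> = (\<integral>\<^sup>+x. f (x + v) \<partial>lborel)" by (subst nn_integral_distr) (auto simp: add.commute)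
  finally show ?thesis by simp
qed

lemma integral_lborel_shift:
  fixes v :: "'a::euclidean_space" and f :: "'a \<Rightarrow> 'b::{banach, second_countable_topology}"
  assumes [measurable]: "f \<in> borel_measurable borel"
  shows "integral\<^sup>L lborel (\<lambda>x. f (x + v)) = integral\<^sup>L lborel f"
proof -
  have "integral\<^sup>L lborel f = integral\<^sup>L (distr lborel borel ((+) v)) f" by (simp add: lborel_distr_plus)
  also have "\<dots> = integral\<^sup>L lborel (\<lambda>x. f (x + v))" by (subst integral_distr) (auto simp: add.commute)
  finally show ?thesis by simp
qed

lemma AE_lborel_shift:
  fixes v :: "'a::euclidean_space"
  assumes "AE x in lborel. P x"
  shows "AE x in lborel. P (x + v)"
proof -
  obtain N where N: "N \<in> null_sets lborel" "{x. \<not> P x} \<subseteq> N"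
    using assms by (auto simp: eventually_ae_filter)
  have [measurable]: "N \<in> sets borel" using N by auto
  have "(\<integral>\<^sup>+x. indicator N (x + v) \<partial>lborel) = (\<integral>\<^sup>+x. indicator N x \<partial>lborel)"
    by (rule nn_integral_lborel_shift) auto
  also have "\<dots> = 0" using N by auto
  finally have "AE x in lborel. indicator N (x + v) = (0::ennreal)"
    by (subst (asm) nn_integral_0_iff_AE) auto
  then show ?thesis
  proof eventually_elim
    case (elim x)
    then have "x + v \<notin> N" by (auto simp: indicator_def split: if_splits)
    then show ?case using N(2) by auto
  qed
qed

text \<open>Tonelli with \<open>x\<close> integrated first: for fixed \<open>s\<close> the
  translation preserves the measure and moves the ball of radius \<open>r\<close> into the one of
  radius \<open>R\<close>.\<close>

lemma shear_integrable:
  fixes g :: "'a::euclidean_space \<Rightarrow> real" and y :: 'a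
  assumes [measurable]: "g \<in> borel_measurable borel"
    and loc: "\<And>r. integrable lborel (\<lambda>x. indicator (cball 0 r) x * g x)"
  shows "integrable (lborel \<Otimes>\<^sub>M lborel) (\<lambda>(x,s). indicator (cball 0 r) x * (indicator {a..b} s * g (x
      + s *\<^sub>R y)))"
proof (rule integrableI_bounded)
  define R where "R = r + max \<bar>a\<bar> \<bar>b\<bar> * norm y"
  show "(\<lambda>(x,s). indicator (cball 0 r) x * (indicator {a..b} s * g (x + s *\<^sub>R y))) \<in> borel_measurable
      (lborel \<Otimes>\<^sub>M lborel)"
    by measurable
  have "(\<integral>\<^sup>+z. ennreal (norm (case z of (x,s) \<Rightarrow> indicator (cball 0 r) x * (indicator {a..b} s * g (x
      + s *\<^sub>R y)))) \<partial>(lborel \<Otimes>\<^sub>M lborel))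
    = (\<integral>\<^sup>+s. \<integral>\<^sup>+x. ennreal (norm (indicator (cball 0 r) x * (indicator {a..b} s * g (x + s *\<^sub>R y))))
        \<partial>lborel \<partial>lborel)"
    by (subst lborel_pair.nn_integral_snd[symmetric]) simp_all
  also have "\<dots> \<le> (\<integral>\<^sup>+s. indicator {a..b} s * (\<integral>\<^sup>+x. ennreal (norm (indicator (cball 0 R) x * g x))
      \<partial>lborel) \<partial>lborel)"
  proof (rule nn_integral_mono)
    fix s :: real
    show "(\<integral>\<^sup>+x. ennreal (norm (indicator (cball 0 r) x * (indicator {a..b} s * g (x + s *\<^sub>R y)))) \<partial>lborel)
      \<le> indicator {a..b} s * (\<integral>\<^sup>+x. ennreal (norm (indicator (cball 0 R) x * g x)) \<partial>lborel)"
    proof (cases "s \<in> {a..b}")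
      case True
      have "(\<integral>\<^sup>+x. ennreal (norm (indicator (cball 0 r) x * (indicator {a..b} s * g (x + s *\<^sub>R y)))) \<partial>lborel)
        \<le> (\<integral>\<^sup>+x. ennreal (norm (indicator (cball 0 R) (x + s *\<^sub>R y) * g (x + s *\<^sub>R y))) \<partial>lborel)"
      proof (rule nn_integral_mono)
        fix x :: 'a
        have "norm (x + s *\<^sub>R y) \<le> R" if "norm x \<le> r"
        proof -
          have "norm (x + s *\<^sub>R y) \<le> norm x + \<bar>s\<bar> * norm y" by (metis norm_scaleR norm_triangle_ineq)
          also have "\<dots> \<le> r + max \<bar>a\<bar> \<bar>b\<bar> * norm y" using that True by (intro add_mono mult_right_mono) auto
          finally show ?thesis by (simp add: R_def)
        qed
        then show "ennreal (norm (indicator (cball 0 r) x * (indicator {a..b} s * g (x + s *\<^sub>R y))))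
           \<le> ennreal (norm (indicator (cball 0 R) (x + s *\<^sub>R y) * g (x + s *\<^sub>R y)))"
          using True by (intro ennreal_leI) (auto simp: indicator_def)
      qed
      also have "\<dots> = (\<integral>\<^sup>+x. ennreal (norm (indicator (cball 0 R) x * g x)) \<partial>lborel)"
        by (rule nn_integral_lborel_shift) measurable
      finally show ?thesis using True by simp
    qed simp
  qed
  also have "\<dots> = (\<integral>\<^sup>+s. indicator {a..b} s \<partial>lborel) * (\<integral>\<^sup>+x. ennreal (norm (indicator (cball 0 R) x * g
      x)) \<partial>lborel)"
    by (rule nn_integral_multc) auto
  also have "\<dots> = emeasure lborel {a..b} * (\<integral>\<^sup>+x. ennreal (norm (indicator (cball 0 R) x * g x))
      \<partial>lborel)" by simp
  also have "\<dots> < \<infinity>"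
  proof -
    have "emeasure lborel {a..b} < \<infinity>" by (cases "a \<le> b") auto
    then show ?thesis using loc[of R] by (simp add: integrable_iff_bounded ennreal_mult_less_top)
  qed
  finally show "(\<integral>\<^sup>+z. ennreal (norm (case z of (x,s) \<Rightarrow> indicator (cball 0 r) x * (indicator {a..b} s *
      g (x + s *\<^sub>R y)))) \<partial>(lborel \<Otimes>\<^sub>M lborel)) < \<infinity>" .
qed

text \<open>Fubini on balls and intervals of integer size; their countable number allows one null
  set for all \<open>a\<close> and \<open>b\<close>.\<close>

lemma line_integrable_AE:
  fixes g :: "'a::euclidean_space \<Rightarrow> real" and y :: 'a
  assumes [measurable]: "g \<in> borel_measurable borel"
    and loc: "\<And>r. integrable lborel (\<lambda>x. indicator (cball 0 r) x * g x)"
  shows "AE x in lborel. \<forall>a b. integrable lborel (\<lambda>s. indicator {a..b} s * g (x + s *\<^sub>R y))"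
proof -
  have "AE x in lborel. integrable lborel (\<lambda>s. indicator (cball 0 (real n)) x * (indicator {-real
      n..real n} s * g (x + s *\<^sub>R y)))" for n
    using lborel_pair.AE_integrable_fst'[OF shear_integrable[OF assms, of "real n" "-real n" "real n"
        y]] by simp
  then have "AE x in lborel. \<forall>n. integrable lborel (\<lambda>s. indicator (cball 0 (real n)) x * (indicator
      {-real n..real n} s * g (x + s *\<^sub>R y)))"
    by (simp add: AE_all_countable)
  then show ?thesis
  proof eventually_elim
    case (elim x)
    show ?case
    proof (intro allI)
      fix a b
      obtain n :: nat where n: "max (norm x) (max \<bar>a\<bar> \<bar>b\<bar>) \<le> real n" using real_arch_simple by blast
      then have "integrable lborel (\<lambda>s. indicator {-real n..real n} s * g (x + s *\<^sub>R y))"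
          using elim[rule_format, of n] by simp
      then show "integrable lborel (\<lambda>s. indicator {a..b} s * g (x + s *\<^sub>R y))"
        by (rule Bochner_Integration.integrable_bound) (use n in \<open>auto intro!: AE_I2 simp: indicator_def\<close>)
    qed
  qed
qed

lemma loc_integrable_test_mult:
  fixes g k :: "'a::euclidean_space \<Rightarrow> real"
  assumes [measurable]: "g \<in> borel_measurable borel" "k \<in> borel_measurable borel"
    and loc: "\<And>r. integrable lborel (\<lambda>x. indicator (cball 0 r) x * g x)"
    and k: "\<And>x. norm x > \<rho> \<Longrightarrow> k x = 0" "\<And>x. \<bar>k x\<bar> \<le> C"
  shows "integrable lborel (\<lambda>x. g x * k x)"
proof (rule Bochner_Integration.integrable_bound[where f="\<lambda>x. C * (indicator (cball 0 \<rho>) x * g x)"])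
  show "integrable lborel (\<lambda>x. C * (indicator (cball 0 \<rho>) x * g x))" using loc by simp
  show "AE x in lborel. norm (g x * k x) \<le> norm (C * (indicator (cball 0 \<rho>) x * g x))"
  proof (rule AE_I2)
    fix x
    show "norm (g x * k x) \<le> norm (C * (indicator (cball 0 \<rho>) x * g x))"
    proof (cases "norm x \<le> \<rho>")
      case True
      have "\<bar>g x\<bar> * \<bar>k x\<bar> \<le> \<bar>g x\<bar> * \<bar>C\<bar>" using k(2)[of x] by (intro mult_left_mono) auto
      then show ?thesis using True by (simp add: abs_mult mult.commute)
    next
      case False then show ?thesis using k(1)[of x] by simp
    qed
  qed
qed measurable

text \<open>Tested against \<open>\<phi>\<close>, the shifts move onto \<open>\<phi>\<close>. On the
  right, the weak derivative then trades \<open>p\<close> for \<open>f\<close> and the derivative of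
  \<open>\<phi>\<close> along \<open>y\<close>, whose integral over \<open>s\<close> is the
  difference of \<open>\<phi>\<close> at \<open>x\<close> and \<open>x - y\<close>; the left side
  gives the same expression. The exceptional null set depends on \<open>y\<close>, so later uses fix
  the vector first and exchange quantifiers by Fubini.\<close>

lemma weak_translate:
  fixes f :: "real^'n \<Rightarrow> real" and p :: "real^'n \<Rightarrow> real^'n"
  assumes [measurable]: "f \<in> borel_measurable borel" "p \<in> borel_measurable borel"
    and locf: "\<And>r. integrable lborel (\<lambda>x. indicator (cball 0 r) x * f x)"
    and locp: "\<And>j r. integrable lborel (\<lambda>x. indicator (cball 0 r) x * p x $ j)"
    and weak: "\<And>\<phi> D\<phi> j. test_fun \<phi> D\<phi> \<Longrightarrow>
       integral\<^sup>L lborel (\<lambda>x. f x * D\<phi> x $ j) = - integral\<^sup>L lborel (\<lambda>x. p x $ j * \<phi> x)"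
  shows "AE x in lborel. f (x + y) - f x = integral\<^sup>L lborel (\<lambda>s. indicator {0..1} s * (p (x + s *\<^sub>R y) \<bullet> y))"
proof -
  define P where "P x = p x \<bullet> y" for x
  have [measurable]: "P \<in> borel_measurable borel" unfolding P_def by measurable
  have locP: "integrable lborel (\<lambda>x. indicator (cball 0 r) x * P x)" for r
  proof -
    have "integrable lborel (\<lambda>x. \<Sum>j\<in>UNIV. (indicator (cball 0 r) x * p x $ j) * y $ j)"
      by (intro Bochner_Integration.integrable_sum integrable_mult_left locp)
    then show ?thesis by (simp add: P_def inner_vec_def sum_distrib_left mult.assoc)
  qed
  have weakP: "integral\<^sup>L lborel (\<lambda>x. f x * (D\<phi> x \<bullet> y)) = - integral\<^sup>L lborel (\<lambda>x. P x * \<phi> x)"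
      if t: "test_fun \<phi> D\<phi>" for \<phi> D\<phi>
  proof -
    note [measurable] = test_fun_measurable[OF t]
    obtain \<rho> C where \<rho>: "\<rho> > 0" "C > 0" "\<And>x. norm x > \<rho> \<Longrightarrow> \<phi> x = 0" "\<And>x. norm x > \<rho> \<Longrightarrow> D\<phi> x = 0"
      "\<And>x. \<bar>\<phi> x\<bar> \<le> C" "\<And>x. norm (D\<phi> x) \<le> C" using test_fun_bounds[OF t] by metis
    have i1: "integrable lborel (\<lambda>x. f x * D\<phi> x $ j)" for j
      by (rule loc_integrable_test_mult[OF _ _ locf, where \<rho>=\<rho> and C=C])
         (use \<rho> in \<open>auto intro: order_trans[OF component_le_norm_cart]\<close>)
    have i2: "integrable lborel (\<lambda>x. p x $ j * \<phi> x)" for j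
      by (rule loc_integrable_test_mult[OF _ _ locp, where \<rho>=\<rho> and C=C]) (use \<rho> in auto)
    have "integral\<^sup>L lborel (\<lambda>x. f x * (D\<phi> x \<bullet> y)) = integral\<^sup>L lborel (\<lambda>x. \<Sum>j\<in>UNIV. (f x * D\<phi> x $ j) *
        y $ j)"
      by (simp add: inner_vec_def sum_distrib_left mult.assoc)
    also have "\<dots> = (\<Sum>j\<in>UNIV. integral\<^sup>L lborel (\<lambda>x. f x * D\<phi> x $ j) * y $ j)"
      by (subst Bochner_Integration.integral_sum) (auto intro!: i1)
    also have "\<dots> = - (\<Sum>j\<in>UNIV. integral\<^sup>L lborel (\<lambda>x. p x $ j * \<phi> x) * y $ j)"
      by (simp add: weak[OF t] sum_negf)
    also have "(\<Sum>j\<in>UNIV. integral\<^sup>L lborel (\<lambda>x. p x $ j * \<phi> x) * y $ j)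
        = integral\<^sup>L lborel (\<lambda>x. \<Sum>j\<in>UNIV. (p x $ j * \<phi> x) * y $ j)"
      by (subst Bochner_Integration.integral_sum) (auto intro!: i2)
    also have "(\<lambda>x. \<Sum>j\<in>UNIV. (p x $ j * \<phi> x) * y $ j) = (\<lambda>x. P x * \<phi> x)"
      by (simp add: P_def inner_vec_def sum_distrib_right mult.assoc mult.commute[of "\<phi> _"])
    finally show ?thesis .
  qed
  define A where "A x = integral\<^sup>L lborel (\<lambda>s. indicator {0..1} s * P (x + s *\<^sub>R y))" for x
  have [measurable]: "A \<in> borel_measurable borel" unfolding A_def by measurable
  have locA: "integrable lborel (\<lambda>x. indicator (cball 0 r) x * A x)" for r
    using lborel_pair.integrable_fst'[OF shear_integrable[OF _ locP, of r 0 1 y]] by (simp add: A_def)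
  have locs: "integrable lborel (\<lambda>x. indicator (cball 0 r) x * f (x + y))" for r
  proof -
    have "integrable (distr lborel borel ((+) (- y))) (\<lambda>x. indicator (cball 0 r) x * f (x + y))
        = integrable lborel (\<lambda>x. indicator (cball 0 r) (x - y) * f x)"
      by (subst integrable_distr_eq) (auto simp: algebra_simps)
    moreover have "integrable lborel (\<lambda>x. indicator (cball 0 r) (x - y) * f x)"
    proof (rule Bochner_Integration.integrable_bound[OF locf[of "r + norm y"]])
      show "AE x in lborel. norm (indicator (cball 0 r) (x - y) * f x) \<le> norm (indicator (cball 0 (r
          + norm y)) x * f x)"
      proof (rule AE_I2)
        fix x show "norm (indicator (cball 0 r) (x - y) * f x) \<le> norm (indicator (cball 0 (r
            + norm y)) x * f x)"
          using norm_triangle_sub[of x y] by (auto simp: indicator_def)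
      qed
    qed measurable
    ultimately show ?thesis by (simp add: lborel_distr_plus)
  qed
  have "AE x in lborel. f (x + y) - f x - A x = 0"
  proof (rule fundamental_lemma)
    show "(\<lambda>x. f (x + y) - f x - A x) \<in> borel_measurable borel" by measurable
    show "integrable lborel (\<lambda>x. indicator (cball 0 r) x * (f (x + y) - f x - A x))" for r
      unfolding right_diff_distrib by (intro Bochner_Integration.integrable_diff locA locf locs)
    fix \<phi> :: "real^'n \<Rightarrow> real" and D\<phi> assume t: "test_fun \<phi> D\<phi>"
    note [measurable] = test_fun_measurable[OF t]
    obtain \<rho> C where \<rho>: "\<rho> > 0" "C > 0" "\<And>x. norm x > \<rho> \<Longrightarrow> \<phi> x = 0" "\<And>x. norm x > \<rho> \<Longrightarrow> D\<phi> x = 0"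
      "\<And>x. \<bar>\<phi> x\<bar> \<le> C" "\<And>x. norm (D\<phi> x) \<le> C" using test_fun_bounds[OF t] by metis
    have t': "test_fun (\<lambda>x. \<phi> (x - s *\<^sub>R y)) (\<lambda>x. D\<phi> (x - s *\<^sub>R y))" for s
      using test_fun_translate[OF t, of "- (s *\<^sub>R y)"] by simp
    have far: "norm (x - s *\<^sub>R y) > \<rho>" if "norm x > \<rho> + norm y" "s \<in> {0..1}" for x s
    proof -
      have "norm x \<le> norm (x - s *\<^sub>R y) + \<bar>s\<bar> * norm y" by (metis norm_scaleR norm_triangle_sub add.commute)
      moreover have "\<bar>s\<bar> * norm y \<le> norm y" using that(2) by (simp add: mult_left_le_one_le)
      ultimately show ?thesis using that by linarith
    qed
    have int1: "integrable (lborel \<Otimes>\<^sub>M lborel) (\<lambda>(x,s). indicator {0..1} s * (P (x + s *\<^sub>R y) * \<phi> x))"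
    proof (rule Bochner_Integration.integrable_bound[OF integrable_mult_right[OF shear_integrable[OF _
        locP, of \<rho> 0 1 y]], of C])
      show "AE z in lborel \<Otimes>\<^sub>M lborel. norm (case z of (x,s) \<Rightarrow> indicator {0..1} s * (P (x + s *\<^sub>R y) * \<phi> x))
         \<le> norm (C * (case z of (x,s) \<Rightarrow> indicator (cball 0 \<rho>) x * (indicator {0..1} s * P (x + s *\<^sub>R y))))"
      proof (rule AE_I2)
        fix z :: "(real^'n) \<times> real"
        obtain x s where z: "z = (x,s)" by (cases z)
        have "\<bar>P (x + s *\<^sub>R y)\<bar> * \<bar>\<phi> x\<bar> \<le> \<bar>P (x + s *\<^sub>R y)\<bar> * C" using \<rho>(5)[of x]
            by (intro mult_left_mono) auto
        then show "norm (case z of (x,s) \<Rightarrow> indicator {0..1} s * (P (x + s *\<^sub>R y) * \<phi> x))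
         \<le> norm (C * (case z of (x,s) \<Rightarrow> indicator (cball 0 \<rho>) x * (indicator {0..1} s * P (x + s *\<^sub>R y))))"
          using \<rho>(2) \<rho>(3)[of x] by (cases "norm x \<le> \<rho>") (auto simp: z abs_mult mult.commute indicator_def)
      qed
    qed measurable
    \<comment> \<open>Here \<open>s\<close> occurs in the test function only, so the dominating
      function is a shear along the zero vector.\<close>
    have int2: "integrable (lborel \<Otimes>\<^sub>M lborel) (\<lambda>(x,s). indicator {0..1} s * (f x * (D\<phi> (x - s *\<^sub>R y) \<bullet> y)))"
    proof (rule Bochner_Integration.integrable_bound[OF integrable_mult_right[OF shear_integrable[OF _
        locf, of "\<rho> + norm y" 0 1 0]], of "C * norm y"])
      show "AE z in lborel \<Otimes>\<^sub>M lborel. norm (case z of (x,s) \<Rightarrow> indicator {0..1} s * (f x * (D\<phi> (x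
          - s *\<^sub>R y) \<bullet> y)))
         \<le> norm (C * norm y * (case z of (x,s) \<Rightarrow> indicator (cball 0 (\<rho> + norm y)) x * (indicator {0..1}
             s * f (x + s *\<^sub>R 0))))"
      proof (rule AE_I2)
        fix z :: "(real^'n) \<times> real"
        obtain x s where z: "z = (x,s)" by (cases z)
        have "\<bar>D\<phi> (x - s *\<^sub>R y) \<bullet> y\<bar> \<le> C * norm y"
          using Cauchy_Schwarz_ineq2[of "D\<phi> (x - s *\<^sub>R y)" y] mult_right_mono[OF \<rho>(6)[of "x - s *\<^sub>R y"],
              of "norm y"] by auto
        then have "\<bar>f x\<bar> * \<bar>D\<phi> (x - s *\<^sub>R y) \<bullet> y\<bar> \<le> \<bar>f x\<bar> * (C * norm y)" by (intro mult_left_mono) auto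
        then show "norm (case z of (x,s) \<Rightarrow> indicator {0..1} s * (f x * (D\<phi> (x - s *\<^sub>R y) \<bullet> y)))
         \<le> norm (C * norm y * (case z of (x,s) \<Rightarrow> indicator (cball 0 (\<rho> + norm y)) x * (indicator {0..1}
             s * f (x + s *\<^sub>R 0))))"
          using \<rho>(2) \<rho>(4)[of "x - s *\<^sub>R y"] far[of x s]
          by (cases "norm x \<le> \<rho> + norm y") (auto simp: z abs_mult algebra_simps indicator_def)
      qed
    qed measurable
    have FTC: "integral\<^sup>L lborel (\<lambda>s. indicator {0..1} s * (D\<phi> (x - s *\<^sub>R y) \<bullet> y)) = \<phi> x - \<phi> (x - y)" for x
    proof -
      have der: "((\<lambda>s. - \<phi> (x - s *\<^sub>R y)) has_real_derivative (D\<phi> (x - s *\<^sub>R y) \<bullet> y)) (at s)" for s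
      proof -
        have d: "(\<phi> has_derivative (\<lambda>h. D\<phi> (x - s *\<^sub>R y) \<bullet> h)) (at (x - s *\<^sub>R y))" using t
            unfolding test_fun_def by auto
        have "((\<lambda>s. x - s *\<^sub>R y) has_derivative (\<lambda>h. - (h *\<^sub>R y))) (at s)"
          by (auto intro!: derivative_eq_intros)
        from has_derivative_minus[OF has_derivative_compose[OF this d]] show ?thesis
          unfolding has_field_derivative_def by (rule has_derivative_eq_rhs) (auto simp: fun_eq_iff)
      qed
      have cont: "isCont (\<lambda>s. D\<phi> (x - s *\<^sub>R y) \<bullet> y) s" for s
      proof -
        have cD: "continuous_on UNIV D\<phi>" using t unfolding test_fun_def by auto
        have "continuous_on UNIV (\<lambda>s. D\<phi> (x - s *\<^sub>R y) \<bullet> y)"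
          by (intro continuous_intros continuous_on_compose2[OF cD]) auto
        then show ?thesis by (simp add: continuous_on_eq_continuous_at)
      qed
      have "integral\<^sup>L lborel (\<lambda>s. (D\<phi> (x - s *\<^sub>R y) \<bullet> y) * indicator {0..1} s) = (- \<phi> (x - 1 *\<^sub>R y))
          - (- \<phi> (x - 0 *\<^sub>R y))"
        by (rule integral_FTC_Icc_real) (use der cont in auto)
      then show ?thesis by (simp add: mult.commute)
    qed
    have "integral\<^sup>L lborel (\<lambda>x. A x * \<phi> x) = integral\<^sup>L lborel (\<lambda>x. integral\<^sup>L lborel (\<lambda>s. indicator
        {0..1} s * (P (x + s *\<^sub>R y) * \<phi> x)))"
      unfolding A_def by (simp add: mult.assoc[symmetric])
    also have "\<dots> = integral\<^sup>L lborel (\<lambda>s. integral\<^sup>L lborel (\<lambda>x. indicator {0..1} s * (P (x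
        + s *\<^sub>R y) * \<phi> x)))"
      using lborel_pair.Fubini_integral[OF int1] by simp
    also have "\<dots> = integral\<^sup>L lborel (\<lambda>s. indicator {0..1} s * integral\<^sup>L lborel (\<lambda>x. P (x
        + s *\<^sub>R y) * \<phi> ((x + s *\<^sub>R y) - s *\<^sub>R y)))"
      by simp
    also have "\<dots> = integral\<^sup>L lborel (\<lambda>s. indicator {0..1} s * integral\<^sup>L lborel (\<lambda>x. P x * \<phi> (x - s *\<^sub>R y)))"
      by (subst integral_lborel_shift) auto
    also have "\<dots> = - integral\<^sup>L lborel (\<lambda>s. integral\<^sup>L lborel (\<lambda>x. indicator {0..1} s * (f x * (D\<phi> (x
        - s *\<^sub>R y) \<bullet> y))))"
    proof -
      have "integral\<^sup>L lborel (\<lambda>x. P x * \<phi> (x - s *\<^sub>R y)) = - integral\<^sup>L lborel (\<lambda>x. f x * (D\<phi> (x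
          - s *\<^sub>R y) \<bullet> y))" for s
        using weakP[OF t', of s] by simp
      then show ?thesis by simp
    qed
    also have "\<dots> = - integral\<^sup>L lborel (\<lambda>x. integral\<^sup>L lborel (\<lambda>s. indicator {0..1} s * (f x * (D\<phi> (x
        - s *\<^sub>R y) \<bullet> y))))"
      using lborel_pair.Fubini_integral[OF int2] by simp
    also have "\<dots> = - integral\<^sup>L lborel (\<lambda>x. f x * (\<phi> x - \<phi> (x - y)))"
      by (simp add: FTC[symmetric] mult.left_commute)
    finally have e1: "integral\<^sup>L lborel (\<lambda>x. A x * \<phi> x) = - integral\<^sup>L lborel (\<lambda>x. f x * (\<phi> x - \<phi> (x - y)))" .
    have i1: "integrable lborel (\<lambda>x. f x * \<phi> x)" "integrable lborel (\<lambda>x. A x * \<phi> x)"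
        "integrable lborel (\<lambda>x. f (x + y) * \<phi> x)"
      by (rule loc_integrable_test_mult[OF _ _ locf, where \<rho>=\<rho> and C=C], use \<rho> in auto)
         (rule loc_integrable_test_mult[OF _ _ locA, where \<rho>=\<rho> and C=C], use \<rho> in auto, 
          rule loc_integrable_test_mult[OF _ _ locs, where \<rho>=\<rho> and C=C], use \<rho> in auto)
    have i2: "integrable lborel (\<lambda>x. f x * \<phi> (x - y))"
      by (rule loc_integrable_test_mult[OF _ _ locf, where \<rho>="\<rho> + norm y" and C=C])
         (use \<rho> far[of _ 1] in auto)
    have "integral\<^sup>L lborel (\<lambda>x. f (x + y) * \<phi> x) = integral\<^sup>L lborel (\<lambda>x. f (x + y) * \<phi> ((x + y) - y))"
        by simp
    also have "\<dots> = integral\<^sup>L lborel (\<lambda>x. f x * \<phi> (x - y))" by (rule integral_lborel_shift) measurable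
    finally have e2: "integral\<^sup>L lborel (\<lambda>x. f (x + y) * \<phi> x) = integral\<^sup>L lborel (\<lambda>x. f x * \<phi> (x - y))" .
    have "integral\<^sup>L lborel (\<lambda>x. (f (x + y) - f x - A x) * \<phi> x) = integral\<^sup>L lborel (\<lambda>x. f (x
        + y) * \<phi> x) - integral\<^sup>L lborel (\<lambda>x. f x * \<phi> x) - integral\<^sup>L lborel (\<lambda>x. A x * \<phi> x)"
      by (simp add: left_diff_distrib i1)
    also have "\<dots> = 0" unfolding e1 e2 by (simp add: right_diff_distrib i1 i2)
    finally show "integral\<^sup>L lborel (\<lambda>x. (f (x + y) - f x - A x) * \<phi> x) = 0" .
  qed
  then show ?thesis by (simp add: A_def P_def)
qed

subsection \<open>Slopes and bounded Lipschitz functions\<close>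

definition slope_le :: "'a::real_normed_vector \<Rightarrow> real \<Rightarrow> ('a \<Rightarrow> real) \<Rightarrow> bool" where
  "slope_le z k \<Psi> \<longleftrightarrow> (\<forall>e>0. \<exists>r>0. \<forall>w\<in>ball z r. \<forall>w'\<in>ball z r. \<bar>\<Psi> w - \<Psi> w'\<bar> \<le> (k + e) * norm (w - w'))"

lemma calibrates_iff_slope_le: "calibrates \<Psi> F \<longleftrightarrow> (\<forall>z. slope_le z (F z) \<Psi>)"
  unfolding calibrates_def slope_le_def by simp

lemma slope_le_mono:
  assumes "slope_le z k \<Psi>" "k \<le> k'" shows "slope_le z k' \<Psi>"
  unfolding slope_le_def
proof (intro allI impI)
  fix e :: real assume "e > 0"
  then obtain r where "r > 0" "\<forall>w\<in>ball z r. \<forall>w'\<in>ball z r. \<bar>\<Psi> w - \<Psi> w'\<bar> \<le> (k + e) * norm (w - w')"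
    using assms(1) unfolding slope_le_def by blast
  moreover have "(k + e) * norm (w - w') \<le> (k' + e) * norm (w - w')" for w w'
    using assms(2) by (intro mult_right_mono) auto
  ultimately show "\<exists>r>0. \<forall>w\<in>ball z r. \<forall>w'\<in>ball z r. \<bar>\<Psi> w - \<Psi> w'\<bar> \<le> (k' + e) * norm (w - w')"
    by (meson order_trans)
qed

lemma slope_le_local_const:
  assumes "0 \<le> k" "r > 0" "\<And>w. w \<in> ball z r \<Longrightarrow> \<Psi> w = c" shows "slope_le z k \<Psi>"
  unfolding slope_le_def using assms by (intro allI impI exI[of _ r]) auto

lemma slope_le_lipschitz:
  fixes \<Psi> :: "'a::real_normed_vector \<Rightarrow> real"
  assumes "\<And>w w'. \<bar>\<Psi> w - \<Psi> w'\<bar> \<le> k * norm (w - w')" shows "slope_le z k \<Psi>"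
  unfolding slope_le_def
proof (intro allI impI exI[of _ 1] conjI ballI)
  fix e :: real and w w' :: 'a assume "e > 0"
  then have "k * norm (w - w') \<le> (k + e) * norm (w - w')" by (intro mult_right_mono) auto
  then show "\<bar>\<Psi> w - \<Psi> w'\<bar> \<le> (k + e) * norm (w - w')" using assms[of w w'] by linarith
qed simp

lemma slope_le_max:
  assumes "slope_le z k f" "slope_le z k g"
  shows "slope_le z k (\<lambda>w. max (f w) (g w))" "slope_le z k (\<lambda>w. min (f w) (g w))"
proof -
  have "\<exists>r>0. \<forall>w\<in>ball z r. \<forall>w'\<in>ball z r. \<bar>f w - f w'\<bar> \<le> (k + e) * norm (w - w') \<and> \<bar>g w - g w'\<bar> \<le> (k
      + e) * norm (w - w')" if e: "e > 0" for e
  proof -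
    obtain r1 where "r1 > 0" "\<forall>w\<in>ball z r1. \<forall>w'\<in>ball z r1. \<bar>f w - f w'\<bar> \<le> (k + e) * norm (w - w')"
      using assms(1) e unfolding slope_le_def by blast
    moreover obtain r2 where "r2 > 0" "\<forall>w\<in>ball z r2. \<forall>w'\<in>ball z r2. \<bar>g w - g w'\<bar> \<le> (k + e) * norm (w - w')"
      using assms(2) e unfolding slope_le_def by blast
    ultimately show ?thesis by (intro exI[of _ "min r1 r2"]) auto
  qed
  note * = this
  show "slope_le z k (\<lambda>w. max (f w) (g w))" unfolding slope_le_def
  proof (intro allI impI)
    fix e :: real assume "e > 0"
    from *[OF this] obtain r where r: "r > 0" "\<forall>w\<in>ball z r. \<forall>w'\<in>ball z r. \<bar>f w - f w'\<bar> \<le> (k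
        + e) * norm (w - w') \<and> \<bar>g w - g w'\<bar> \<le> (k + e) * norm (w - w')" by blast
    show "\<exists>r>0. \<forall>w\<in>ball z r. \<forall>w'\<in>ball z r. \<bar>max (f w) (g w) - max (f w') (g w')\<bar> \<le> (k + e) * norm (w - w')"
    proof (intro exI[of _ r] conjI ballI r(1))
      fix w w' assume "w \<in> ball z r" "w' \<in> ball z r"
      then have "\<bar>f w - f w'\<bar> \<le> (k + e) * norm (w - w')" "\<bar>g w - g w'\<bar> \<le> (k + e) * norm (w - w')"
          using r(2) by blast+
      then show "\<bar>max (f w) (g w) - max (f w') (g w')\<bar> \<le> (k + e) * norm (w - w')" by linarith
    qed
  qed
  show "slope_le z k (\<lambda>w. min (f w) (g w))" unfolding slope_le_def
  proof (intro allI impI)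
    fix e :: real assume "e > 0"
    from *[OF this] obtain r where r: "r > 0" "\<forall>w\<in>ball z r. \<forall>w'\<in>ball z r. \<bar>f w - f w'\<bar> \<le> (k
        + e) * norm (w - w') \<and> \<bar>g w - g w'\<bar> \<le> (k + e) * norm (w - w')" by blast
    show "\<exists>r>0. \<forall>w\<in>ball z r. \<forall>w'\<in>ball z r. \<bar>min (f w) (g w) - min (f w') (g w')\<bar> \<le> (k + e) * norm (w - w')"
    proof (intro exI[of _ r] conjI ballI r(1))
      fix w w' assume "w \<in> ball z r" "w' \<in> ball z r"
      then have "\<bar>f w - f w'\<bar> \<le> (k + e) * norm (w - w')" "\<bar>g w - g w'\<bar> \<le> (k + e) * norm (w - w')"
          using r(2) by blast+
      then show "\<bar>min (f w) (g w) - min (f w') (g w')\<bar> \<le> (k + e) * norm (w - w')" by linarith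
    qed
  qed
qed

lemma slope_le_C1:
  fixes f :: "'a::euclidean_space \<Rightarrow> real"
  assumes d: "\<And>z. (f has_derivative (\<lambda>h. Df z \<bullet> h)) (at z)" and c: "isCont Df z"
  shows "slope_le z (norm (Df z)) f"
  unfolding slope_le_def
proof (intro allI impI)
  fix e :: real assume e: "e > 0"
  then obtain r where r: "r > 0" "\<And>w. dist w z < r \<Longrightarrow> dist (Df w) (Df z) < e"
    using c unfolding continuous_at by (auto simp: tendsto_iff eventually_at) (metis dist_self e)
  have bd: "norm (Df w) \<le> norm (Df z) + e" if "w \<in> ball z r" for w
    using r(2)[of w] that norm_triangle_sub[of "Df w" "Df z"] by (simp add: dist_norm norm_minus_commute)
  show "\<exists>r>0. \<forall>w\<in>ball z r. \<forall>w'\<in>ball z r. \<bar>f w - f w'\<bar> \<le> (norm (Df z) + e) * norm (w - w')"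
  proof (intro exI[of _ r] conjI ballI r(1))
    fix w w' assume w: "w \<in> ball z r" "w' \<in> ball z r"
    have "norm (f w - f w') \<le> (norm (Df z) + e) * norm (w - w')"
    proof (rule differentiable_bound[OF convex_ball, of z r f "\<lambda>w h. Df w \<bullet> h"])
      show "(f has_derivative (\<bullet>) (Df x)) (at x within ball z r)" for x
          using d has_derivative_at_withinI by blast
      show "onorm ((\<bullet>) (Df x)) \<le> norm (Df z) + e" if "x \<in> ball z r" for x
        by (rule onorm_le) (metis Cauchy_Schwarz_ineq2 bd[OF that] mult_right_mono norm_ge_zero
            order_trans real_norm_def)
    qed (use w in auto)
    then show "\<bar>f w - f w'\<bar> \<le> (norm (Df z) + e) * norm (w - w')" by simp
  qed
qed

section \<open>Bounded Lipschitz functions\<close>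

text \<open>Boundedness makes the class closed under products; polynomials on bounded sets and norms
  and maxima of them are then handled by introduction rules.\<close>

definition bdd_lipschitz_on :: "'a::metric_space set \<Rightarrow> ('a \<Rightarrow> 'b::real_normed_vector) \<Rightarrow> bool" where
  "bdd_lipschitz_on S f \<longleftrightarrow> bounded (f ` S) \<and> (\<exists>L. L-lipschitz_on S f)"

named_theorems bdd_lipschitz_intros

lemma bdd_lipschitz_const [bdd_lipschitz_intros]: "bdd_lipschitz_on S (\<lambda>_. c)"
  unfolding bdd_lipschitz_on_def by (auto intro!: exI[of _ 0] lipschitz_onI simp: image_constant_conv)

lemma bdd_lipschitz_add [bdd_lipschitz_intros]:
  assumes "bdd_lipschitz_on S f" "bdd_lipschitz_on S g"
  shows "bdd_lipschitz_on S (\<lambda>x. f x + g x)" "bdd_lipschitz_on S (\<lambda>x. f x - g x)"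
  using assms unfolding bdd_lipschitz_on_def
  by (auto intro: bounded_plus_comp bounded_minus_comp lipschitz_on_add lipschitz_on_diff)

lemma bdd_lipschitz_bilinear:
  assumes b: "bounded_bilinear B" and f: "bdd_lipschitz_on S f" and g: "bdd_lipschitz_on S g"
  shows "bdd_lipschitz_on S (\<lambda>x. B (f x) (g x))"
proof -
  interpret bounded_bilinear B by fact
  obtain K where K: "K > 0" "\<And>a b. norm (B a b) \<le> norm a * norm b * K" using pos_bounded by blast
  obtain F where F: "F > 0" "\<And>x. x \<in> S \<Longrightarrow> norm (f x) \<le> F" using f
      unfolding bdd_lipschitz_on_def bounded_pos by auto
  obtain G where G: "G > 0" "\<And>x. x \<in> S \<Longrightarrow> norm (g x) \<le> G" using g
      unfolding bdd_lipschitz_on_def bounded_pos by auto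
  obtain Lf where Lf: "Lf-lipschitz_on S f" using f unfolding bdd_lipschitz_on_def by auto
  obtain Lg where Lg: "Lg-lipschitz_on S g" using g unfolding bdd_lipschitz_on_def by auto
  note L0 = lipschitz_on_nonneg[OF Lf] lipschitz_on_nonneg[OF Lg]
  have "bounded ((\<lambda>x. B (f x) (g x)) ` S)"
    unfolding bounded_iff
  proof (intro exI[of _ "F * G * K"] ballI)
    fix y assume "y \<in> (\<lambda>x. B (f x) (g x)) ` S"
    then obtain x where x: "x \<in> S" "y = B (f x) (g x)" by auto
    have "norm (f x) * norm (g x) * K \<le> F * G * K"
      using x F G K by (intro mult_right_mono mult_mono) auto
    then show "norm y \<le> F * G * K" using K(2)[of "f x" "g x"] unfolding x(2) by linarith
  qed
  moreover have "((Lf * G + F * Lg) * K)-lipschitz_on S (\<lambda>x. B (f x) (g x))"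
  proof (rule lipschitz_onI)
    fix x y assume xy: "x \<in> S" "y \<in> S"
    have "B (f x) (g x) - B (f y) (g y) = B (f x - f y) (g x) + B (f y) (g x - g y)"
      by (simp add: diff_left diff_right)
    then have "dist (B (f x) (g x)) (B (f y) (g y)) \<le> norm (B (f x - f y) (g x)) + norm (B (f y) (g x - g y))"
      by (simp add: dist_norm norm_triangle_ineq)
    also have "\<dots> \<le> norm (f x - f y) * norm (g x) * K + norm (f y) * norm (g x - g y) * K"
      by (intro add_mono K)
    also have "\<dots> \<le> (Lf * dist x y) * G * K + F * (Lg * dist x y) * K"
      using xy F G K lipschitz_onD[OF Lf xy] lipschitz_onD[OF Lg xy] L0
      by (intro add_mono mult_right_mono mult_mono) (auto simp: dist_norm)
    finally show "dist (B (f x) (g x)) (B (f y) (g y)) \<le> (Lf * G + F * Lg) * K * dist x y"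
      by (simp add: algebra_simps)
  qed (use F G K L0 in auto)
  ultimately show ?thesis unfolding bdd_lipschitz_on_def by blast
qed

lemmas bdd_lipschitz_mult [bdd_lipschitz_intros] = bdd_lipschitz_bilinear[OF bounded_bilinear_mult]
lemmas bdd_lipschitz_scaleR [bdd_lipschitz_intros] = bdd_lipschitz_bilinear[OF bounded_bilinear_scaleR]
lemmas bdd_lipschitz_inner [bdd_lipschitz_intros] = bdd_lipschitz_bilinear[OF bounded_bilinear_inner]

lemma bdd_lipschitz_power [bdd_lipschitz_intros]:
  fixes f :: "_ \<Rightarrow> real"
  shows "bdd_lipschitz_on S f \<Longrightarrow> bdd_lipschitz_on S (\<lambda>x. f x ^ n)"
  by (induction n) (auto intro!: bdd_lipschitz_intros)

lemma bdd_lipschitz_sum [bdd_lipschitz_intros]: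
  "(\<And>i. i \<in> I \<Longrightarrow> bdd_lipschitz_on S (f i)) \<Longrightarrow> bdd_lipschitz_on S (\<lambda>x. \<Sum>i\<in>I. f i x)"
  by (induction I rule: infinite_finite_induct) (auto intro!: bdd_lipschitz_intros)

lemma bdd_lipschitz_norm [bdd_lipschitz_intros]:
  assumes "bdd_lipschitz_on S f" shows "bdd_lipschitz_on S (\<lambda>x. norm (f x))"
proof -
  obtain L where L: "L-lipschitz_on S f" using assms unfolding bdd_lipschitz_on_def by auto
  have "L-lipschitz_on S (\<lambda>x. norm (f x))"
  proof (rule lipschitz_onI)
    fix x y assume xy: "x \<in> S" "y \<in> S"
    have "dist (norm (f x)) (norm (f y)) \<le> dist (f x) (f y)" by (simp add: dist_norm norm_triangle_ineq3)
    then show "dist (norm (f x)) (norm (f y)) \<le> L * dist x y" using lipschitz_onD[OF L xy] by linarith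
  qed (rule lipschitz_on_nonneg[OF L])
  then show ?thesis using assms unfolding bdd_lipschitz_on_def by (auto simp: bounded_iff)
qed

lemma bdd_lipschitz_max [bdd_lipschitz_intros]:
  fixes f g :: "_ \<Rightarrow> real"
  assumes "bdd_lipschitz_on S f" "bdd_lipschitz_on S g"
  shows "bdd_lipschitz_on S (\<lambda>x. max (f x) (g x))" "bdd_lipschitz_on S (\<lambda>x. min (f x) (g x))"
proof -
  have m: "max a b = (a + b + norm (a - b)) * (1/2)" "min a b = (a + b - norm (a - b)) * (1/2)"
      for a b :: real by auto
  show "bdd_lipschitz_on S (\<lambda>x. max (f x) (g x))" "bdd_lipschitz_on S (\<lambda>x. min (f x) (g x))"
    unfolding m by (intro bdd_lipschitz_intros assms)+
qed

lemma bdd_lipschitz_Max [bdd_lipschitz_intros]: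
  fixes f :: "_ \<Rightarrow> _ \<Rightarrow> real"
  assumes "finite I" "I \<noteq> {}" "\<And>i. i \<in> I \<Longrightarrow> bdd_lipschitz_on S (f i)"
  shows "bdd_lipschitz_on S (\<lambda>x. Max ((\<lambda>i. f i x) ` I))"
  using assms
proof (induction I rule: finite_ne_induct)
  case (insert i I)
  have "(\<lambda>x. Max ((\<lambda>i. f i x) ` insert i I)) = (\<lambda>x. max (f i x) (Max ((\<lambda>i. f i x) ` I)))"
    using insert by simp
  then show ?case using insert by (auto intro!: bdd_lipschitz_intros)
qed auto

lemma bdd_lipschitz_id [bdd_lipschitz_intros]:
  "bounded S \<Longrightarrow> bdd_lipschitz_on S (\<lambda>x. x)"
  unfolding bdd_lipschitz_on_def by (auto intro: lipschitz_on_id)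

lemma bdd_lipschitz_compose:
  assumes "bdd_lipschitz_on S f" "L-lipschitz_on T g" "g ` T \<subseteq> S"
  shows "bdd_lipschitz_on T (\<lambda>x. f (g x))"
proof -
  obtain K where K: "K-lipschitz_on S f" using assms unfolding bdd_lipschitz_on_def by auto
  have "(K * L)-lipschitz_on T (\<lambda>x. f (g x))"
    using lipschitz_on_compose2[OF assms(2) lipschitz_on_subset[OF K assms(3)]] by (simp add: o_def)
  moreover have "bounded ((\<lambda>x. f (g x)) ` T)"
    using assms unfolding bdd_lipschitz_on_def by (metis bounded_subset image_image image_mono)
  ultimately show ?thesis unfolding bdd_lipschitz_on_def by blast
qed

text \<open>The vectors from \<open>x\<close> to the other points are independent, so a linear
  functional exists that is 1 on all of them; one minus it, based at \<open>x\<close>, is the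
  barycentric coordinate of \<open>x\<close>. It also exhibits \<open>x\<close> as a vertex of the
  hull, which is how the averaging argument uses it.\<close>

lemma barycentric_functional:
  fixes X :: "'a::euclidean_space set"
  assumes "\<not> affine_dependent X" "x \<in> X"
  shows "\<exists>G c. \<forall>y\<in>X. G \<bullet> y + c = (if y = x then 1 else (0::real))"
proof -
  have "independent ((\<lambda>y. - x + y) ` (X - {x}))"
    using assms affine_dependent_iff_dependent2 by blast
  then obtain g :: "'a \<Rightarrow> real" where g: "linear g" "\<And>b. b \<in> (\<lambda>y. - x + y) ` (X - {x}) \<Longrightarrow> g b = 1"
    using linear_independent_extend[of _ "\<lambda>_. 1"] by blast
  have G: "g v = v \<bullet> adjoint g 1" for v using adjoint_works[OF g(1), of v 1] by simp
  have "(- adjoint g 1) \<bullet> y + (1 + g x) = (if y = x then 1 else 0)" if "y \<in> X" for y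
  proof -
    have "(- adjoint g 1) \<bullet> y + (1 + g x) = 1 - g (- x + y)"
      using linear_diff[OF g(1), of y x] by (simp add: G inner_commute)
    then show ?thesis using g(2)[of "- x + y"] that linear_0[OF g(1)] by auto
  qed
  then show ?thesis by blast
qed

subsection \<open>The potential\<close>

locale simplex_metric =
  fixes X :: "(real^'n) set" and \<delta> :: "real^'n \<Rightarrow> real^'n \<Rightarrow> real"
  assumes indep: "\<not> affine_dependent X" and cardX: "card X = CARD('n) + 1" and metric: "metric_on X \<delta>"
begin

lemma finX: "finite X" using cardX card.infinite by fastforce

lemma X_two: "x \<in> X \<Longrightarrow> \<exists>y\<in>X. y \<noteq> x"
proof (rule ccontr)
  assume "x \<in> X" "\<not> (\<exists>y\<in>X. y \<noteq> x)"
  then have "X = {x}" by blast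
  then show False using cardX by simp
qed

lemma X_nonempty: "X \<noteq> {}" using cardX by auto

lemma \<delta>_props:
  assumes "x \<in> X" "y \<in> X"
  shows "0 \<le> \<delta> x y" "\<delta> x y = 0 \<longleftrightarrow> x = y" "\<delta> x y = \<delta> y x"
  using metric assms unfolding metric_on_def by blast+

lemma \<delta>_tri: "x \<in> X \<Longrightarrow> y \<in> X \<Longrightarrow> z \<in> X \<Longrightarrow> \<delta> x z \<le> \<delta> x y + \<delta> y z"
  using metric unfolding metric_on_def by blast

lemma \<delta>_pos: "x \<in> X \<Longrightarrow> y \<in> X \<Longrightarrow> x \<noteq> y \<Longrightarrow> 0 < \<delta> x y"
  using \<delta>_props by (metis less_le)

text \<open>\<open>bG x\<close> and \<open>bc0 x\<close> are the gradient and the constant term of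
  the barycentric coordinate of \<open>x\<close>, an affine function on the whole space.\<close>

definition bG :: "real^'n \<Rightarrow> real^'n" where
  "bG x = (SOME G. \<exists>c. \<forall>y\<in>X. G \<bullet> y + c = (if y = x then 1 else 0))"

definition bc0 :: "real^'n \<Rightarrow> real" where
  "bc0 x = (SOME c. \<forall>y\<in>X. bG x \<bullet> y + c = (if y = x then 1 else 0))"

definition lam :: "real^'n \<Rightarrow> real^'n \<Rightarrow> real" where
  "lam x z = bG x \<bullet> z + bc0 x"

lemma lam_vertex: "x \<in> X \<Longrightarrow> y \<in> X \<Longrightarrow> lam x y = (if y = x then 1 else 0)"
proof -
  assume x: "x \<in> X" and y: "y \<in> X"
  have "\<exists>c. \<forall>y\<in>X. bG x \<bullet> y + c = (if y = x then 1 else 0)"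
    unfolding bG_def using barycentric_functional[OF indep x] by (rule someI_ex)
  then have "\<forall>y\<in>X. bG x \<bullet> y + bc0 x = (if y = x then 1 else 0)"
    unfolding bc0_def by (rule someI_ex)
  then show ?thesis using y by (simp add: lam_def)
qed

lemma lam_barycentric: "(\<Sum>x\<in>X. lam x z) = 1" "(\<Sum>x\<in>X. lam x z *\<^sub>R x) = z"
proof -
  have "z \<in> affine hull X"
    using affine_independent_span_eq[OF indep] cardX by simp
  then obtain u where u: "sum u X = 1" "(\<Sum>v\<in>X. u v *\<^sub>R v) = z"
    unfolding affine_hull_finite[OF finX] by auto
  have "lam x z = u x" if x: "x \<in> X" for x
  proof -
    have "lam x z = (\<Sum>v\<in>X. u v * (bG x \<bullet> v)) + (\<Sum>v\<in>X. u v) * bc0 x"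
      unfolding lam_def u(1) u(2)[symmetric] by (simp add: inner_sum_right)
    also have "\<dots> = (\<Sum>v\<in>X. u v * lam x v)"
      unfolding lam_def by (simp add: sum_distrib_right distrib_left sum.distrib)
    also have "\<dots> = (\<Sum>v\<in>X. if v = x then u x else 0)"
      using x by (intro sum.cong) (auto simp: lam_vertex)
    finally show ?thesis using x finX by simp
  qed
  then show "(\<Sum>x\<in>X. lam x z) = 1" "(\<Sum>x\<in>X. lam x z *\<^sub>R x) = z" using u by simp_all
qed

lemma lam_segment:
  assumes "x \<in> X" "y \<in> X" "x \<noteq> y" "w \<in> X"
  shows "lam w (x + s *\<^sub>R (y - x)) = (if w = x then 1 - s else if w = y then s else 0)"
proof -
  have "lam w (x + s *\<^sub>R (y - x)) = (1 - s) * lam w x + s * lam w y"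
    unfolding lam_def by (simp add: inner_add_right inner_diff_right algebra_simps)
  then show ?thesis using assms by (auto simp: lam_vertex)
qed

lemma bG_edge: "x \<in> X \<Longrightarrow> y \<in> X \<Longrightarrow> x \<noteq> y \<Longrightarrow> bG x \<bullet> (y - x) = -1" "x \<in> X \<Longrightarrow> y \<in> X \<Longrightarrow> x \<noteq> y \<Longrightarrow> bG y \<bullet> (y - x) = 1"
  using lam_vertex[of x x] lam_vertex[of x y] lam_vertex[of y x] lam_vertex[of y y]
  by (auto simp: lam_def inner_diff_right)

section \<open>Functions with prescribed values at vertices and gradients along edges\<close>

text \<open>Ordered pairs: every edge occurs twice, whence the coefficient 15 in \<open>psi\<close>
  against the edge profile 30 s^2 (1 - s)^2.\<close>

definition prs :: "((real^'n) \<times> (real^'n)) set" where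
  "prs = {(x, y). x \<in> X \<and> y \<in> X \<and> x \<noteq> y}"

lemma finprs: "finite prs"
  by (rule finite_subset[of _ "X \<times> X"]) (auto simp: prs_def finX)

lemma prs_nonempty: "prs \<noteq> {}"
  using X_two X_nonempty unfolding prs_def by fastforce

text \<open>On the edge, the gradient of the first sum in \<open>psi\<close> is a multiple of
  \<open>\<delta> a x *\<^sub>R bG x + \<delta> a y *\<^sub>R bG y\<close>. Its inner product with
  \<open>y - x\<close> is \<open>\<delta> a y - \<delta> a x\<close>, so the last term is its
  projection to the edge direction and \<open>nv\<close> is its component normal to the
  edge.\<close>

definition nv :: "real^'n \<Rightarrow> real^'n \<Rightarrow> real^'n \<Rightarrow> real^'n" where
  "nv a x y = \<delta> a x *\<^sub>R bG x + \<delta> a y *\<^sub>R bG y - ((\<delta> a y - \<delta> a x) / (norm (y - x))\<^sup>2) *\<^sub>R (y - x)"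

lemma nv_sym: "nv a y x = nv a x y"
proof -
  have "((\<delta> a x - \<delta> a y) / (norm (x - y))\<^sup>2) *\<^sub>R (x - y) = ((\<delta> a y - \<delta> a x) / (norm (y - x))\<^sup>2) *\<^sub>R (y - x)"
    by (simp add: norm_minus_commute[of x y] scaleR_diff_left scaleR_diff_right diff_divide_distrib)
  then show ?thesis by (simp add: nv_def add.commute)
qed

lemma nv_orth: "x \<in> X \<Longrightarrow> y \<in> X \<Longrightarrow> x \<noteq> y \<Longrightarrow> nv a x y \<bullet> (y - x) = 0"
proof -
  assume xy: "x \<in> X" "y \<in> X" "x \<noteq> y"
  have "((\<delta> a y - \<delta> a x) / (norm (y - x))\<^sup>2) * ((y - x) \<bullet> (y - x)) = \<delta> a y - \<delta> a x"
    using xy by (simp add: power2_norm_eq_inner[symmetric])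
  then have "nv a x y \<bullet> (y - x) = \<delta> a x * (bG x \<bullet> (y - x)) + \<delta> a y * (bG y \<bullet> (y - x)) - (\<delta> a y - \<delta> a x)"
    unfolding nv_def inner_add_left inner_diff_left[of "_ + _"] inner_scaleR_left by simp
  then show ?thesis using bG_edge[OF xy] by simp
qed

text \<open>The first sum takes the prescribed values at the vertices and is critical there; the second sum
  removes its normal derivative along every edge without changing anything else on the edges,
  because each of its terms vanishes to second order on all edges but one.\<close>

definition psi :: "real^'n \<Rightarrow> real^'n \<Rightarrow> real" where
  "psi a z = (\<Sum>x\<in>X. \<delta> a x * (10 * lam x z ^ 3 - 15 * lam x z ^ 4 + 6 * lam x z ^ 5))
     - (\<Sum>(x, y)\<in>prs. 15 * (lam x z)\<^sup>2 * (lam y z)\<^sup>2 * (nv a x y \<bullet> (z - x)))"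

text \<open>The quintic 10 s^3 - 15 s^4 + 6 s^5 has derivative 30 s^2 (1 - s)^2, symmetric under
  exchange of s and 1 - s: on an edge both end points contribute with equal weight.\<close>

definition gpsi :: "real^'n \<Rightarrow> real^'n \<Rightarrow> real^'n" where
  "gpsi a z = (\<Sum>x\<in>X. (\<delta> a x * (30 * (lam x z)\<^sup>2 * (1 - lam x z)\<^sup>2)) *\<^sub>R bG x)
     - (\<Sum>(x, y)\<in>prs. (30 * lam x z * (lam y z)\<^sup>2 * (nv a x y \<bullet> (z - x))) *\<^sub>R bG x
          + (30 * (lam x z)\<^sup>2 * lam y z * (nv a x y \<bullet> (z - x))) *\<^sub>R bG y
          + (15 * (lam x z)\<^sup>2 * (lam y z)\<^sup>2) *\<^sub>R nv a x y)"

lemma psi_derivative: "(psi a has_derivative (\<lambda>h. gpsi a z \<bullet> h)) (at z)"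
proof -
  have l: "(lam x has_derivative (\<lambda>h. bG x \<bullet> h)) (at z)" for x
    unfolding lam_def by (auto intro!: derivative_eq_intros)
  have 1: "((\<lambda>z. \<delta> a x * (10 * lam x z ^ 3 - 15 * lam x z ^ 4 + 6 * lam x z ^ 5)) has_derivative
      (\<lambda>h. ((\<delta> a x * (30 * (lam x z)\<^sup>2 * (1 - lam x z)\<^sup>2)) *\<^sub>R bG x) \<bullet> h)) (at z)" for x
    by (rule derivative_eq_intros l refl)+
       (auto simp: fun_eq_iff power2_eq_square power3_eq_cube algebra_simps eval_nat_numeral)
  have 2: "((\<lambda>z. 15 * (lam x z)\<^sup>2 * (lam y z)\<^sup>2 * (nv a x y \<bullet> (z - x))) has_derivative
      (\<lambda>h. ((30 * lam x z * (lam y z)\<^sup>2 * (nv a x y \<bullet> (z - x))) *\<^sub>R bG x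
          + (30 * (lam x z)\<^sup>2 * lam y z * (nv a x y \<bullet> (z - x))) *\<^sub>R bG y
          + (15 * (lam x z)\<^sup>2 * (lam y z)\<^sup>2) *\<^sub>R nv a x y) \<bullet> h)) (at z)" for x y
    by (rule derivative_eq_intros l refl)+
       (auto simp: fun_eq_iff inner_add_left algebra_simps)
  show ?thesis unfolding psi_def gpsi_def inner_diff_left inner_sum_left
    by (intro has_derivative_diff has_derivative_sum 1) (auto simp: split_beta intro!: 2)
qed

lemma sum_prs_edge:
  fixes f :: "(real^'n) \<times> (real^'n) \<Rightarrow> 'b::comm_monoid_add"
  assumes xy: "x \<in> X" "y \<in> X" "x \<noteq> y"
    and 0: "\<And>v w. (v, w) \<in> prs \<Longrightarrow> {v, w} \<noteq> {x, y} \<Longrightarrow> f (v, w) = 0"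
  shows "sum f prs = f (x, y) + f (y, x)"
proof -
  have "sum f prs = sum f {(x, y), (y, x)}"
  proof (rule sum.mono_neutral_right)
    show "\<forall>i\<in>prs - {(x, y), (y, x)}. f i = 0"
    proof
      fix i assume i: "i \<in> prs - {(x, y), (y, x)}"
      obtain v w where vw: "i = (v, w)" by (cases i)
      have "{v, w} \<noteq> {x, y}" using i vw by (auto simp: doubleton_eq_iff)
      then show "f i = 0" using 0 i vw by auto
    qed
  qed (use xy finprs in \<open>auto simp: prs_def\<close>)
  then show ?thesis using xy by simp
qed

lemma lam_edge_zero:
  assumes xy: "x \<in> X" "y \<in> X" "x \<noteq> y" and vw: "(v, w) \<in> prs" "{v, w} \<noteq> {x, y}"
  shows "lam v (x + s *\<^sub>R (y - x)) = 0 \<or> lam w (x + s *\<^sub>R (y - x)) = 0"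
  using assms lam_segment[OF xy, of v s] lam_segment[OF xy, of w s] unfolding prs_def
      by (auto split: if_splits)

text \<open>On the edge only the coordinates of its end points are nonzero. Of the corrections only
  the two for this edge remain, and in them only the multiples of \<open>nv\<close>, because
  \<open>z - x\<close> and \<open>z - y\<close> are normal to \<open>nv\<close>. Together these
  remove exactly the normal component of the first sum.\<close>

lemma gpsi_edge:
  assumes xy: "x \<in> X" "y \<in> X" "x \<noteq> y"
  shows "gpsi a (x + s *\<^sub>R (y - x)) = (30 * s\<^sup>2 * (1 - s)\<^sup>2 * (\<delta> a y - \<delta> a x) / (norm (y - x))\<^sup>2) *\<^sub>R (y - x)"
proof -
  define z where "z = x + s *\<^sub>R (y - x)"
  define k where "k = 30 * s\<^sup>2 * (1 - s)\<^sup>2"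
  have lx: "lam x z = 1 - s" "lam y z = s" using lam_segment[OF xy, of x s] lam_segment[OF xy, of y s]
      xy by (auto simp: z_def)
  have l0: "lam w z = 0" if "w \<in> X" "w \<noteq> x" "w \<noteq> y" for w using lam_segment[OF xy that(1), of s] that
      by (simp add: z_def)
  have n: "nv a x y \<bullet> (z - x) = 0" "nv a y x \<bullet> (z - y) = 0"
  proof -
    show "nv a x y \<bullet> (z - x) = 0" using nv_orth[OF xy, of a] by (simp add: z_def)
    have "z - y = (s - 1) *\<^sub>R (y - x)" by (simp add: z_def algebra_simps)
    then show "nv a y x \<bullet> (z - y) = 0" using nv_orth[OF xy, of a] by (simp add: nv_sym)
  qed
  have "(\<Sum>w\<in>X. (\<delta> a w * (30 * (lam w z)\<^sup>2 * (1 - lam w z)\<^sup>2)) *\<^sub>R bG w)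
     = (\<Sum>w\<in>{x, y}. (\<delta> a w * (30 * (lam w z)\<^sup>2 * (1 - lam w z)\<^sup>2)) *\<^sub>R bG w)"
    by (rule sum.mono_neutral_right) (use xy finX l0 in auto)
  also have "\<dots> = k *\<^sub>R (\<delta> a x *\<^sub>R bG x + \<delta> a y *\<^sub>R bG y)"
    using xy by (simp add: lx k_def scaleR_add_right mult_ac)
  finally have 1: "(\<Sum>w\<in>X. (\<delta> a w * (30 * (lam w z)\<^sup>2 * (1 - lam w z)\<^sup>2)) *\<^sub>R bG w) = k *\<^sub>R (\<delta> a x *\<^sub>R bG
      x + \<delta> a y *\<^sub>R bG y)" .
  have "(\<Sum>(v, w)\<in>prs. (30 * lam v z * (lam w z)\<^sup>2 * (nv a v w \<bullet> (z - v))) *\<^sub>R bG v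
          + (30 * (lam v z)\<^sup>2 * lam w z * (nv a v w \<bullet> (z - v))) *\<^sub>R bG w
          + (15 * (lam v z)\<^sup>2 * (lam w z)\<^sup>2) *\<^sub>R nv a v w)
     = (15 * (1 - s)\<^sup>2 * s\<^sup>2) *\<^sub>R nv a x y + (15 * s\<^sup>2 * (1 - s)\<^sup>2) *\<^sub>R nv a y x"
    apply (subst sum_prs_edge[OF xy])
    subgoal for v w using lam_edge_zero[OF xy, of v w s] by (auto simp: z_def)
    subgoal using n by (simp add: lx)
    done
  also have "\<dots> = k *\<^sub>R nv a x y"
    unfolding nv_sym[of a x y] scaleR_left_distrib[symmetric] by (simp add: k_def)
  finally have 2: "(\<Sum>(v, w)\<in>prs. (30 * lam v z * (lam w z)\<^sup>2 * (nv a v w \<bullet> (z - v))) *\<^sub>R bG v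
          + (30 * (lam v z)\<^sup>2 * lam w z * (nv a v w \<bullet> (z - v))) *\<^sub>R bG w
          + (15 * (lam v z)\<^sup>2 * (lam w z)\<^sup>2) *\<^sub>R nv a v w) = k *\<^sub>R nv a x y" .
  have "gpsi a z = k *\<^sub>R ((\<delta> a x *\<^sub>R bG x + \<delta> a y *\<^sub>R bG y) - nv a x y)"
    unfolding gpsi_def 1 2 by (simp add: scaleR_diff_right)
  also have "(\<delta> a x *\<^sub>R bG x + \<delta> a y *\<^sub>R bG y) - nv a x y = ((\<delta> a y - \<delta> a x) / (norm (y - x))\<^sup>2) *\<^sub>R (y - x)"
    by (simp add: nv_def)
  finally show ?thesis by (simp add: z_def k_def)
qed

lemma psi_vertex: "x \<in> X \<Longrightarrow> psi a x = \<delta> a x"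
proof -
  assume x: "x \<in> X"
  have "(\<Sum>w\<in>X. \<delta> a w * (10 * lam w x ^ 3 - 15 * lam w x ^ 4 + 6 * lam w x ^ 5)) = (\<Sum>w\<in>X. if w
      = x then \<delta> a x else 0)"
    using x by (intro sum.cong) (auto simp: lam_vertex)
  also have "\<dots> = \<delta> a x" using x finX by simp
  moreover have "(\<Sum>(v, w)\<in>prs. 15 * (lam v x)\<^sup>2 * (lam w x)\<^sup>2 * (nv a v w \<bullet> (x - v))) = 0"
    using x by (intro sum.neutral) (auto simp: prs_def lam_vertex)
  ultimately show ?thesis by (simp add: psi_def)
qed

section \<open>A common bound for all gradients, sharp on the edges\<close>

definition M0 :: real where "M0 = Max (norm ` X)"

lemma norm_X: "x \<in> X \<Longrightarrow> norm x \<le> M0"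
  unfolding M0_def using finX by simp

lemma M0_nonneg: "0 \<le> M0"
  using X_nonempty norm_X norm_ge_zero order_trans by (metis ex_in_conv)

definition dm :: real where "dm = Max ((\<lambda>(x, y). \<delta> x y) ` prs)"

lemma \<delta>_le_dm: "x \<in> X \<Longrightarrow> y \<in> X \<Longrightarrow> \<delta> x y \<le> dm"
proof -
  have ge: "\<delta> x y \<le> dm" if "x \<in> X" "y \<in> X" "x \<noteq> y" for x y
    unfolding dm_def by (rule Max_ge) (use that finprs in \<open>auto simp: prs_def image_iff\<close>)
  assume xy: "x \<in> X" "y \<in> X"
  show ?thesis
  proof (cases "x = y")
    case True
    obtain w where w: "w \<in> X" "w \<noteq> x" using X_two[OF xy(1)] by blast
    have "\<delta> x y = 0" using True \<delta>_props(2)[OF xy] by simp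
    also have "0 \<le> \<delta> w x" using \<delta>_props(1) w xy by blast
    also have "\<dots> \<le> dm" using ge w xy by blast
    finally show ?thesis .
  qed (use ge xy in auto)
qed

lemma dm_nonneg: "0 \<le> dm"
  using X_nonempty \<delta>_le_dm \<delta>_props(1) order_trans by (metis ex_in_conv)

text \<open>Small enough for \<open>lowb\<close> to stay below the calibrating slope on every edge:
  there the sum over ordered pairs equals 2 s^2 (1 - s)^2, which turns 15 into the 30 of the edge
  profile.\<close>

definition eps :: real where "eps = Min ((\<lambda>(x, y). 15 * \<delta> x y / norm (y - x)) ` prs)"

lemma eps_pos: "0 < eps"
  unfolding eps_def using finprs prs_nonempty
  by (subst Min_gr_iff) (auto simp: prs_def \<delta>_pos)

lemma eps_le: "x \<in> X \<Longrightarrow> y \<in> X \<Longrightarrow> x \<noteq> y \<Longrightarrow> eps \<le> 15 * \<delta> x y / norm (y - x)"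
  unfolding eps_def by (rule Min_le) (use finprs in \<open>auto simp: prs_def image_iff\<close>)

text \<open>Keeps the potential positive off \<open>X\<close>, where all gradients of the
  \<open>psi a\<close> might vanish. The radial term supports a barrier of slope 1 from radius
  \<open>M0 + 1\<close> on and vanishes on the simplex.\<close>

definition lowb :: "real^'n \<Rightarrow> real" where
  "lowb z = eps * (\<Sum>(x, y)\<in>prs. (lam x z)\<^sup>2 * (lam y z)\<^sup>2) + max 0 (norm z - M0)"

lemma sum_prs_nonneg: "0 \<le> (\<Sum>(x, y)\<in>prs. (lam x z)\<^sup>2 * (lam y z)\<^sup>2)"
  by (intro sum_nonneg) auto

lemma lowb_nonneg: "0 \<le> lowb z"
  unfolding lowb_def using eps_pos sum_prs_nonneg[of z] by simp

lemma lowb_far: "norm z - M0 \<le> lowb z"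
  unfolding lowb_def using eps_pos sum_prs_nonneg[of z] by (simp add: add_increasing)

text \<open>If all products of two different coordinates vanish, a single coordinate is nonzero, and
  it is 1 because they add up to 1. The coordinates are global affine functions, so this covers the
  whole space.\<close>

lemma lowb_zero: "lowb z = 0 \<Longrightarrow> z \<in> X"
proof -
  assume z: "lowb z = 0"
  have "eps * (\<Sum>(x, y)\<in>prs. (lam x z)\<^sup>2 * (lam y z)\<^sup>2) \<le> 0"
    using z max.cobounded1[of 0 "norm z - M0"] unfolding lowb_def by linarith
  then have "(\<Sum>(x, y)\<in>prs. (lam x z)\<^sup>2 * (lam y z)\<^sup>2) = 0"
    using eps_pos sum_prs_nonneg[of z] by (simp add: mult_le_0_iff)
  then have p: "\<forall>p\<in>prs. (case p of (x, y) \<Rightarrow> (lam x z)\<^sup>2 * (lam y z)\<^sup>2) = 0"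
    by (subst (asm) sum_nonneg_eq_0_iff) (use finprs in auto)
  obtain x where x: "x \<in> X" "lam x z \<noteq> 0" using lam_barycentric(1)[of z] by (metis sum.neutral zero_neq_one)
  have y: "lam y z = 0" if "y \<in> X" "y \<noteq> x" for y
    using p[rule_format, of "(x, y)"] that x by (auto simp: prs_def)
  have "(\<Sum>y\<in>X. lam y z) = (\<Sum>y\<in>X. if y = x then lam x z else 0)" by (rule sum.cong) (auto simp: y)
  then have 1: "lam x z = 1" using lam_barycentric(1)[of z] x finX by simp
  have "(\<Sum>y\<in>X. lam y z *\<^sub>R y) = (\<Sum>y\<in>X. if y = x then x else 0)" by (rule sum.cong) (auto simp: y 1)
  then have "z = x" using lam_barycentric(2)[of z] x finX by simp
  then show ?thesis using x by simp
qed

definition F0 :: "real^'n \<Rightarrow> real" where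
  "F0 z = max (lowb z) (Max ((\<lambda>a. norm (gpsi a z)) ` X))"

lemma F0_ge: "lowb z \<le> F0 z" "a \<in> X \<Longrightarrow> norm (gpsi a z) \<le> F0 z" "0 \<le> F0 z"
proof -
  show "lowb z \<le> F0 z" "0 \<le> F0 z" unfolding F0_def using lowb_nonneg[of z] by auto
  show "norm (gpsi a z) \<le> F0 z" if "a \<in> X"
  proof -
    have "norm (gpsi a z) \<le> Max ((\<lambda>a. norm (gpsi a z)) ` X)" using finX that by (intro Max_ge) auto
    then show ?thesis unfolding F0_def by linarith
  qed
qed

text \<open>The triangle inequality for \<open>\<delta>\<close> enters here: |\<delta> a y -
  \<delta> a x| <= \<delta> x y for every vertex \<open>a\<close>, with equality for
  \<open>a = x\<close>. Hence the maximum over all \<open>a\<close> takes on each edge the value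
  intended for that edge.\<close>

lemma F0_edge:
  assumes xy: "x \<in> X" "y \<in> X" "x \<noteq> y" and s: "0 \<le> s" "s \<le> 1"
  shows "F0 (x + s *\<^sub>R (y - x)) = 30 * s\<^sup>2 * (1 - s)\<^sup>2 * \<delta> x y / norm (y - x)"
    and "norm (x + s *\<^sub>R (y - x)) \<le> M0"
proof -
  define z where "z = x + s *\<^sub>R (y - x)"
  define k where "k = 30 * s\<^sup>2 * (1 - s)\<^sup>2"
  have "z = (1 - s) *\<^sub>R x + s *\<^sub>R y" by (simp add: z_def algebra_simps)
  then have "norm z \<le> (1 - s) * norm x + s * norm y"
    using s norm_triangle_ineq[of "(1 - s) *\<^sub>R x" "s *\<^sub>R y"] by simp
  also have "\<dots> \<le> (1 - s) * M0 + s * M0" using s norm_X xy by (intro add_mono mult_left_mono) auto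
  finally show nz: "norm (x + s *\<^sub>R (y - x)) \<le> M0" by (simp add: z_def algebra_simps)
  have ne: "norm (y - x) > 0" using xy by simp
  have k0: "k \<ge> 0" by (simp add: k_def)
  have g: "norm (gpsi a z) = k * \<bar>\<delta> a y - \<delta> a x\<bar> / norm (y - x)" for a
    unfolding z_def gpsi_edge[OF xy] k_def[symmetric] using k0 by (simp add: abs_mult power2_eq_square)
  have gle: "norm (gpsi a z) \<le> k * \<delta> x y / norm (y - x)" if "a \<in> X" for a
  proof -
    have "\<bar>\<delta> a y - \<delta> a x\<bar> \<le> \<delta> x y"
      using \<delta>_tri[OF that xy(1,2)] \<delta>_tri[OF that xy(2,1)] \<delta>_props(3)[OF xy(1,2)] by linarith
    then show ?thesis unfolding g using k0 ne by (intro divide_right_mono mult_left_mono) auto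
  qed
  have gx: "norm (gpsi x z) = k * \<delta> x y / norm (y - x)"
    unfolding g using \<delta>_props(1)[OF xy(1,2)] \<delta>_props(2)[OF xy(1,1)] by simp
  have "(\<Sum>(v, w)\<in>prs. (lam v z)\<^sup>2 * (lam w z)\<^sup>2) = 2 * (s\<^sup>2 * (1 - s)\<^sup>2)"
    apply (subst sum_prs_edge[OF xy])
    subgoal for v w using lam_edge_zero[OF xy, of v w s] by (auto simp: z_def)
    subgoal using lam_segment[OF xy, of x s] lam_segment[OF xy, of y s] xy by (auto simp: z_def)
    done
  then have "lowb z = eps * (2 * (s\<^sup>2 * (1 - s)\<^sup>2))" using nz by (simp add: lowb_def z_def)
  also have "\<dots> \<le> (15 * \<delta> x y / norm (y - x)) * (2 * (s\<^sup>2 * (1 - s)\<^sup>2))"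
    using eps_le[OF xy] by (intro mult_right_mono) auto
  also have "\<dots> = k * \<delta> x y / norm (y - x)" by (simp add: k_def)
  finally have lw: "lowb z \<le> k * \<delta> x y / norm (y - x)" .
  have "Max ((\<lambda>a. norm (gpsi a z)) ` X) = k * \<delta> x y / norm (y - x)"
    by (rule Max_eqI) (use finX gle gx xy in \<open>auto simp: image_iff intro!: bexI[of _ x]\<close>)
  then show "F0 (x + s *\<^sub>R (y - x)) = 30 * s\<^sup>2 * (1 - s)\<^sup>2 * \<delta> x y / norm (y - x)"
    using lw unfolding F0_def z_def[symmetric] k_def[symmetric] by simp
qed

lemma bdd_lipschitz_lam: "bounded S \<Longrightarrow> bdd_lipschitz_on S (lam x)"
  unfolding lam_def by (intro bdd_lipschitz_intros) auto

lemma bdd_lipschitz_gpsi: "bounded S \<Longrightarrow> bdd_lipschitz_on S (gpsi a)"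
  unfolding gpsi_def split_beta by (intro bdd_lipschitz_intros bdd_lipschitz_lam) auto

lemma bdd_lipschitz_F0: "bounded S \<Longrightarrow> bdd_lipschitz_on S F0"
  unfolding F0_def lowb_def split_beta
  by (intro bdd_lipschitz_intros bdd_lipschitz_lam bdd_lipschitz_gpsi finX X_nonempty) auto

section \<open>Truncation to a potential on the whole space\<close>

text \<open>A barrier of slope 1 that starts at radius \<open>M0 + 1\<close> exceeds
  \<open>dm\<close> on the open unit ball around every point of norm at least
  \<open>M\<close>.\<close>

definition M :: real where "M = M0 + 2 + dm"

definition cutoff :: "real^'n \<Rightarrow> real" where "cutoff z = max 0 (min 1 (M + 1 - norm z))"

text \<open>Projecting to the ball of radius \<open>M\<close> makes the factor bounded and Lipschitz
  and leaves it unchanged inside, where \<open>sqrt (2 * W z)\<close> is \<open>F0 z\<close>. The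
  cutoff interpolates to the constant 1 between the radii \<open>M\<close> and
  \<open>M + 1\<close>.\<close>

definition W :: "real^'n \<Rightarrow> real" where
  "W z = 1 + ((F0 (closest_point (cball 0 M) z))\<^sup>2 * (1/2) - 1) * cutoff z"

lemma M_pos: "0 < M" using M0_nonneg dm_nonneg by (simp add: M_def)

lemma cp:
  fixes z :: "real^'n"
  shows "closest_point (cball 0 M) z \<in> cball 0 M" "norm z \<le> M \<Longrightarrow> closest_point (cball 0 M) z = z"
  using M_pos closest_point_in_set[of "cball 0 M" z] closest_point_self[of z "cball 0 M"] by auto

lemma cp_far:
  fixes z :: "real^'n"
  assumes z: "norm z > M"
  shows "norm (closest_point (cball 0 M) z) = M"
proof -
  have "(M / norm z) *\<^sub>R z = closest_point (cball 0 M) z"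
  proof (rule closest_point_unique)
    show "\<forall>w\<in>cball 0 M. dist z ((M / norm z) *\<^sub>R z) \<le> dist z w"
    proof
      fix w :: "real^'n" assume w: "w \<in> cball 0 M"
      have "z - (M / norm z) *\<^sub>R z = (1 - M / norm z) *\<^sub>R z" by (simp add: algebra_simps)
      then have "dist z ((M / norm z) *\<^sub>R z) = \<bar>1 - M / norm z\<bar> * norm z" unfolding dist_norm by simp
      also have "\<bar>1 - M / norm z\<bar> = 1 - M / norm z"
      proof -
        have "M / norm z \<le> 1" using z M_pos by (intro divide_le_eq_1_pos[THEN iffD2]) auto
        then show ?thesis by simp
      qed
      also have "(1 - M / norm z) * norm z = norm z - M"
      proof -
        have "norm z \<noteq> 0" using z M_pos by linarith
        then show ?thesis by (simp add: left_diff_distrib)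
      qed
      also have "\<dots> \<le> dist z w" using w norm_triangle_sub[of z w] by (simp add: dist_norm)
      finally show "dist z ((M / norm z) *\<^sub>R z) \<le> dist z w" .
    qed
  qed (use z M_pos in \<open>auto simp: field_simps\<close>)
  then show ?thesis using z M_pos by (metis abs_of_pos divide_pos_pos less_trans nonzero_eq_divide_eq
      norm_scaleR norm_zero order_less_irrefl real_norm_def)
qed

lemma W_near: "norm z \<le> M \<Longrightarrow> W z = (F0 z)\<^sup>2 / 2"
  by (simp add: W_def cp cutoff_def)

lemma W_far: "norm z \<ge> M + 1 \<Longrightarrow> W z = 1"
  by (simp add: W_def cutoff_def)

lemma cutoff_01: "0 \<le> cutoff z" "cutoff z \<le> 1" by (auto simp: cutoff_def)

text \<open>Projection keeps the norm at least \<open>M0 + 1\<close>, where \<open>lowb\<close> is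
  at least 1; \<open>W z\<close> is a convex combination of the resulting value, at least 1/2, and
  1.\<close>

lemma W_outside: "M0 + 1 \<le> norm z \<Longrightarrow> 1/2 \<le> W z"
proof -
  assume z: "M0 + 1 \<le> norm z"
  define p where "p = closest_point (cball 0 M) z"
  have "norm p \<ge> M0 + 1"
    using z cp(2)[of z] cp_far[of z] dm_nonneg by (cases "norm z \<le> M") (auto simp: p_def M_def)
  then have "F0 p \<ge> 1" using lowb_far[of p] F0_ge(1)[of p] by linarith
  then have F: "(F0 p)\<^sup>2 \<ge> 1" by (simp add: one_le_power)
  have "W z - 1/2 = ((F0 p)\<^sup>2 - 1) / 2 * cutoff z + (1 - cutoff z) / 2" by (simp add: W_def p_def field_simps)
  also have "\<dots> \<ge> 0" using F cutoff_01[of z] by (intro add_nonneg_nonneg mult_nonneg_nonneg) auto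
  finally show ?thesis by simp
qed

lemma W_nonneg: "0 \<le> W z"
proof (cases "norm z \<le> M")
  case True then show ?thesis by (simp add: W_near)
next
  case False then show ?thesis using W_outside[of z] dm_nonneg by (simp add: M_def)
qed

lemma W_lipschitz: "\<exists>L. L-lipschitz_on UNIV W"
proof -
  have 1: "bdd_lipschitz_on UNIV (\<lambda>z. F0 (closest_point (cball 0 M) z))"
  proof (rule bdd_lipschitz_compose[OF bdd_lipschitz_F0[OF bounded_cball], of 1])
    show "1-lipschitz_on UNIV (closest_point (cball 0 M))"
      using closest_point_lipschitz[of "cball 0 M"] M_pos by (intro lipschitz_onI) auto
    show "range (closest_point (cball 0 M)) \<subseteq> cball (0::real^'n) M" by (intro image_subsetI cp(1))
  qed
  have 2: "bdd_lipschitz_on UNIV cutoff"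
  proof -
    have "1-lipschitz_on UNIV cutoff"
    proof (rule lipschitz_onI)
      fix x y :: "real^'n"
      show "dist (cutoff x) (cutoff y) \<le> 1 * dist x y"
        using norm_triangle_ineq3[of x y] unfolding cutoff_def dist_norm[of x y] dist_real_def by linarith
    qed simp
    moreover have "bounded (range cutoff)" unfolding bounded_iff using cutoff_01 by (intro exI[of _ 1]) auto
    ultimately show ?thesis unfolding bdd_lipschitz_on_def by blast
  qed
  have "bdd_lipschitz_on UNIV W" unfolding W_def by (intro bdd_lipschitz_intros 1 2)
  then show ?thesis unfolding bdd_lipschitz_on_def by blast
qed

lemma W_edge:
  assumes xy: "x \<in> X" "y \<in> X" "x \<noteq> y" and s: "0 \<le> s" "s \<le> 1"
  shows "W (x + s *\<^sub>R (y - x)) = (30 * s\<^sup>2 * (1 - s)\<^sup>2 * \<delta> x y / norm (y - x))\<^sup>2 / 2"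
proof -
  have "norm (x + s *\<^sub>R (y - x)) \<le> M" using F0_edge(2)[OF assms] dm_nonneg by (simp add: M_def)
  then show ?thesis by (simp add: W_near F0_edge(1)[OF assms])
qed

lemma W_zero: "{z. W z = 0} = X"
proof
  show "X \<subseteq> {z. W z = 0}"
  proof
    fix x assume x: "x \<in> X"
    then obtain y where "y \<in> X" "x \<noteq> y" using X_two by metis
    then show "x \<in> {z. W z = 0}" using W_edge[OF x, of y 0] by simp
  qed
  show "{z. W z = 0} \<subseteq> X"
  proof
    fix z assume "z \<in> {z. W z = 0}"
    then have z: "W z = 0" by simp
    then have "norm z \<le> M" using W_outside[of z] dm_nonneg by (cases "norm z \<le> M") (auto simp: M_def)
    then have "F0 z = 0" using z W_near by simp
    then have "lowb z = 0" using F0_ge(1)[of z] lowb_nonneg[of z] by simp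
    then show "z \<in> X" by (rule lowb_zero)
  qed
qed

text \<open>The barrier reaches the cap \<open>dm\<close> before \<open>norm z = M\<close>, so the values of \<open>W\<close> outside that ball are
  irrelevant for the calibration.\<close>

definition Psi :: "real^'n \<Rightarrow> real^'n \<Rightarrow> real" where
  "Psi a z = min dm (max (psi a z) (max 0 (norm z - (M0 + 1))))"

lemma Psi_vertex: "a \<in> X \<Longrightarrow> x \<in> X \<Longrightarrow> Psi a x = \<delta> a x"
  using norm_X[of x] \<delta>_props(1)[of a x] \<delta>_le_dm[of a x] by (simp add: Psi_def psi_vertex)

text \<open>Inside radius \<open>M\<close> every function combined in \<open>Psi a\<close> has slope
  at most \<open>F0\<close>: the gradient of \<open>psi a\<close> by the choice of
  \<open>F0\<close>, the barrier because its slope 1 appears only from radius \<open>M0 + 1\<close>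
  on, where \<open>lowb\<close> is at least 1. From radius \<open>M\<close> on, the cap makes
  \<open>Psi a\<close> locally constant.\<close>

lemma Psi_calibrates:
  assumes a: "a \<in> X"
  shows "calibrates (Psi a) (\<lambda>z. sqrt (2 * W z))"
  unfolding calibrates_iff_slope_le
proof
  fix z
  show "slope_le z (sqrt (2 * W z)) (Psi a)"
  proof (cases "norm z < M")
    case True
    then have F: "sqrt (2 * W z) = F0 z" using F0_ge(3)[of z] by (simp add: W_near)
    have cg: "isCont (gpsi a) z"
    proof -
      obtain L where "L-lipschitz_on (ball z 1) (gpsi a)"
        using bdd_lipschitz_gpsi[OF bounded_ball] unfolding bdd_lipschitz_on_def by blast
      then have "continuous_on (ball z 1) (gpsi a)" by (rule lipschitz_on_continuous_on)
      then show ?thesis by (metis centre_in_ball continuous_on_eq_continuous_at open_ball zero_less_one)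
    qed
    have 1: "slope_le z (F0 z) (psi a)"
      by (rule slope_le_mono[OF slope_le_C1[OF psi_derivative cg] F0_ge(2)[OF a]])
    have 2: "slope_le z (F0 z) (\<lambda>z. max 0 (norm z - (M0 + 1)))"
    proof (cases "norm z < M0 + 1")
      case True
      have "max 0 (norm w - (M0 + 1)) = 0" if "w \<in> ball z (M0 + 1 - norm z)" for w
        using that norm_triangle_sub[of w z] by (simp add: dist_norm norm_minus_commute)
      then show ?thesis using True F0_ge(3)[of z] by (intro slope_le_local_const[of _ "M0 + 1 - norm z"]) auto
    next
      case False
      have "slope_le z 1 (\<lambda>z. max 0 (norm z - (M0 + 1)))"
      proof (rule slope_le_lipschitz)
        fix w w' :: "real^'n"
        show "\<bar>max 0 (norm w - (M0 + 1)) - max 0 (norm w' - (M0 + 1))\<bar> \<le> 1 * norm (w - w')"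
          using norm_triangle_ineq3[of w w'] by linarith
      qed
      moreover have "1 \<le> F0 z" using False lowb_far[of z] F0_ge(1)[of z] by linarith
      ultimately show ?thesis by (rule slope_le_mono)
    qed
    have 3: "slope_le z (F0 z) (\<lambda>_. dm)" using F0_ge(3)[of z] by (intro slope_le_local_const[of _ 1]) auto
    show ?thesis unfolding F Psi_def[abs_def] by (intro slope_le_max 1 2 3)
  next
    case False
    have "Psi a w = dm" if "w \<in> ball z 1" for w
      using that False norm_triangle_sub[of z w] by (simp add: Psi_def M_def dist_norm)
    then show ?thesis by (intro slope_le_local_const[of _ 1]) (auto simp: W_nonneg)
  qed
qed

end

subsection \<open>Rotations, classical gradients and the heteroclinic profile\<close>

lemma orthogonal_matrix_mul_transpose:
  fixes R :: "real^'n^'n"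
  assumes "orthogonal_matrix R"
  shows "R *v (transpose R *v x) = x" "transpose R *v (R *v x) = x"
  using assms unfolding orthogonal_matrix_def
  by (simp_all only: matrix_vector_mul_assoc matrix_vector_mul_lid)

lemma orthogonal_matrix_inner:
  fixes R :: "real^'n^'n"
  assumes "orthogonal_matrix R"
  shows "(R *v x) \<bullet> y = x \<bullet> (transpose R *v y)" "(transpose R *v x) \<bullet> y = x \<bullet> (R *v y)" "norm (R *v x)
      = norm x"
proof -
  show 1: "(transpose R *v x) \<bullet> y = x \<bullet> (R *v y)" for x y :: "real^'n"
    by (simp only: transpose_matrix_vector dot_lmul_matrix)
  show "(R *v x) \<bullet> y = x \<bullet> (transpose R *v y)" by (metis 1 inner_commute)
  show "norm (R *v x) = norm x"
    unfolding norm_eq_sqrt_inner by (metis 1 orthogonal_matrix_mul_transpose(2)[OF assms])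
qed

lemma measurable_matrix_vector_mult [measurable]: "(\<lambda>x. A *v x) \<in> borel_measurable borel"
    for A :: "real^'n^'n"
  by (intro borel_measurable_continuous_onI linear_continuous_on matrix_vector_mul_bounded_linear)

text \<open>Uniqueness of translation-invariant measures: integrating 1_B(y) 1_A(x + y) over the
  product in both orders gives |B| \<mu>(A) = |A| \<mu>(B), and the image measure has the same value
  as Lebesgue measure on the centred ball \<open>B\<close>.\<close>

lemma distr_orthogonal_lborel:
  fixes R :: "real^'n^'n"
  assumes R: "orthogonal_matrix R"
  shows "distr lborel borel (\<lambda>x. R *v x) = lborel"
proof -
  define \<mu> where "\<mu> = distr lborel borel (\<lambda>x. R *v x)"
  note RR = orthogonal_matrix_mul_transpose[OF R]
  note nR = orthogonal_matrix_inner(3)[OF R]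
  have [measurable_cong]: "sets \<mu> = sets borel" by (simp add: \<mu>_def)
  have [simp]: "sets \<mu> = sets borel" "space \<mu> = UNIV" by (auto simp: \<mu>_def)
  have em: "emeasure \<mu> A = emeasure lborel ((\<lambda>x. R *v x) -` A)" if "A \<in> sets borel" for A
    using that unfolding \<mu>_def by (subst emeasure_distr) auto
  have ball: "emeasure \<mu> (ball 0 r) = emeasure lborel (ball (0::real^'n) r)" for r
  proof -
    have "(\<lambda>x. R *v x) -` ball 0 r = ball (0::real^'n) r" using nR by (auto simp: dist_norm)
    then show ?thesis by (simp add: em)
  qed
  have "sigma_finite_measure \<mu>"
  proof
    show "\<exists>A::(real^'n) set set. countable A \<and> A \<subseteq> sets \<mu> \<and> \<Union>A = space \<mu> \<and> (\<forall>a\<in>A. emeasure \<mu> a \<noteq> \<infinity>)"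
    proof (intro exI[of _ "range (\<lambda>n::nat. ball 0 (real n))"] conjI)
      show "\<Union>(range (\<lambda>n::nat. ball 0 (real n))) = space \<mu>"
      proof -
        have "\<exists>n. norm x < real n" for x :: "real^'n" by (rule reals_Archimedean2)
        then show ?thesis by auto
      qed
      show "\<forall>a\<in>range (\<lambda>n::nat. ball 0 (real n)). emeasure \<mu> a \<noteq> \<infinity>"
        using emeasure_lborel_ball_finite by (auto simp: ball less_top)
    qed auto
  qed
  then interpret \<mu>: sigma_finite_measure \<mu> .
  interpret P: pair_sigma_finite lborel \<mu> ..
  have shift: "(\<integral>\<^sup>+x. f (x + v) \<partial>\<mu>) = (\<integral>\<^sup>+x. f x \<partial>\<mu>)" if [measurable]: "f \<in> borel_measurable borel" for f v
  proof -
    have "(\<integral>\<^sup>+x. f (x + v) \<partial>\<mu>) = (\<integral>\<^sup>+x. f (R *v (x + transpose R *v v)) \<partial>lborel)"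
      unfolding \<mu>_def by (subst nn_integral_distr) (simp_all add: matrix_vector_right_distrib RR
          del: transpose_matrix_vector)
    also have "\<dots> = (\<integral>\<^sup>+x. f (R *v x) \<partial>lborel)" by (rule nn_integral_lborel_shift) measurable
    also have "\<dots> = (\<integral>\<^sup>+x. f x \<partial>\<mu>)" unfolding \<mu>_def by (subst nn_integral_distr) auto
    finally show ?thesis .
  qed
  define B where "B = ball (0::real^'n) 1"
  have [measurable]: "B \<in> sets borel" by (simp add: B_def)
  have "emeasure \<mu> A = emeasure lborel A" if [measurable]: "A \<in> sets borel" for A
  proof -
    have "emeasure lborel B * emeasure \<mu> A = (\<integral>\<^sup>+y. indicator B y * (\<integral>\<^sup>+x. indicator A x \<partial>\<mu>) \<partial>lborel)"
      by (subst nn_integral_multc) auto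
    also have "\<dots> = (\<integral>\<^sup>+y. \<integral>\<^sup>+x. indicator B y * indicator A (x + y) \<partial>\<mu> \<partial>lborel)"
    proof (rule nn_integral_cong)
      fix y :: "real^'n"
      have "(\<integral>\<^sup>+x. indicator A x \<partial>\<mu>) = (\<integral>\<^sup>+x. indicator A (x + y) \<partial>\<mu>)" by (rule shift[symmetric]) auto
      then show "indicator B y * (\<integral>\<^sup>+x. indicator A x \<partial>\<mu>) = (\<integral>\<^sup>+x. indicator B y * indicator A (x + y) \<partial>\<mu>)"
        by (subst nn_integral_cmult) auto
    qed
    also have "\<dots> = (\<integral>\<^sup>+x. \<integral>\<^sup>+y. indicator B y * indicator A (x + y) \<partial>lborel \<partial>\<mu>)"
      by (rule P.Fubini'[symmetric]) measurable
    also have "\<dots> = (\<integral>\<^sup>+x. \<integral>\<^sup>+y. indicator B (y - x) * indicator A y \<partial>lborel \<partial>\<mu>)"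
    proof (rule nn_integral_cong)
      fix x :: "real^'n"
      have "(\<integral>\<^sup>+y. indicator B ((y + x) - x) * indicator A (y + x) \<partial>lborel) = (\<integral>\<^sup>+y. indicator B (y
          - x) * indicator A y \<partial>(lborel :: (real^'n) measure) :: ennreal)"
        by (rule nn_integral_lborel_shift) measurable
      then show "(\<integral>\<^sup>+y. indicator B y * indicator A (x + y) \<partial>lborel) = (\<integral>\<^sup>+y. indicator B (y
          - x) * indicator A y \<partial>lborel)"
        by (simp add: add.commute)
    qed
    also have "\<dots> = (\<integral>\<^sup>+y. \<integral>\<^sup>+x. indicator B (y - x) * indicator A y \<partial>\<mu> \<partial>lborel)"
      by (rule P.Fubini') measurable
    also have "\<dots> = (\<integral>\<^sup>+y. indicator A y * emeasure \<mu> B \<partial>lborel)"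
    proof (rule nn_integral_cong)
      fix y :: "real^'n"
      \<comment> \<open>The ball is symmetric, so \<open>y - x\<close> may be replaced by
        \<open>x - y\<close>, a translate in the variable of integration.\<close>
      have "(\<integral>\<^sup>+x. indicator B (y - x) * indicator A y \<partial>\<mu>) = (\<integral>\<^sup>+x. indicator B (x + - y) * indicator A y \<partial>\<mu>)"
        by (intro nn_integral_cong) (auto simp: B_def dist_norm norm_minus_commute indicator_def)
      also have "\<dots> = (\<integral>\<^sup>+x. indicator B x * indicator A y \<partial>\<mu>)" by (rule shift) measurable
      also have "\<dots> = indicator A y * emeasure \<mu> B" by (subst nn_integral_multc) (auto simp: mult.commute)
      finally show "(\<integral>\<^sup>+x. indicator B (y - x) * indicator A y \<partial>\<mu>) = indicator A y * emeasure \<mu> B" .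
    qed
    also have "\<dots> = emeasure lborel A * emeasure \<mu> B" by (subst nn_integral_multc) auto
    also have "emeasure \<mu> B = emeasure lborel B" by (simp add: B_def ball)
    finally have e: "emeasure lborel B * emeasure \<mu> A = emeasure lborel B * emeasure lborel A"
        by (simp add: mult.commute)
    have "emeasure lborel B \<noteq> top" using emeasure_lborel_ball_finite by (auto simp: B_def less_top)
    moreover have "emeasure lborel B \<noteq> 0"
    proof
      assume "emeasure lborel B = 0"
      then have "negligible B" by (auto simp: negligible_iff_null_sets null_sets_completionI null_setsI)
      then show False unfolding B_def by (metis centre_in_ball empty_iff open_ball open_not_negligible
          zero_less_one)
    qed
    ultimately show ?thesis using e by (simp add: ennreal_mult_cancel_left)
  qed
  then show ?thesis unfolding \<mu>_def[symmetric] by (intro measure_eqI) auto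
qed

section \<open>Integration by parts for C1 maps\<close>

text \<open>Averaging over shifts in direction \<open>e\<close> does not change the integral; after
  Fubini the fundamental theorem turns it into the integral of \<open>f (x + e) - f x\<close>, which
  is 0 by translation invariance.\<close>

lemma test_fun_integral_deriv_zero:
  fixes f :: "real^'n \<Rightarrow> real"
  assumes t: "test_fun f Df"
  shows "integral\<^sup>L lborel (\<lambda>x. Df x $ j) = 0"
proof -
  note [measurable] = test_fun_measurable[OF t]
  obtain \<rho> C where \<rho>: "\<rho> > 0" "C > 0" "\<And>x. norm x > \<rho> \<Longrightarrow> f x = 0" "\<And>x. norm x > \<rho> \<Longrightarrow> Df x = 0"
    "\<And>x. \<bar>f x\<bar> \<le> C" "\<And>x. norm (Df x) \<le> C" using test_fun_bounds[OF t] by metis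
  define e where "e = (axis j 1 :: real^'n)"
  have ne: "norm e = 1" by (simp add: e_def)
  have fin: "emeasure lborel (cball (0::real^'n) r) < \<infinity>" for r
      by (rule emeasure_bounded_finite[OF bounded_cball])
  have loc: "integrable lborel (\<lambda>x. indicator (cball 0 r) x * k x)"
      if [measurable]: "k \<in> borel_measurable borel" and "\<And>x. \<bar>k x\<bar> \<le> C" for r and k :: "real^'n \<Rightarrow> real"
  proof (rule Bochner_Integration.integrable_bound[where f="\<lambda>x. indicator (cball 0 r) x * C"])
    show "integrable lborel (\<lambda>x. indicator (cball (0::real^'n) r) x * C)"
      using fin[of r] by (intro integrable_mult_left integrable_real_indicator) auto
  qed (use that \<rho>(2) in \<open>auto simp: indicator_def intro!: AE_I2\<close>)
  have cle: "\<bar>Df x $ j\<bar> \<le> C" for x using component_le_norm_cart[of "Df x" j] \<rho>(6)[of x] by linarith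
  have int: "integrable (lborel \<Otimes>\<^sub>M lborel) (\<lambda>(x,s). indicator {0..1} s * Df (x + s *\<^sub>R e) $ j)"
  proof (rule Bochner_Integration.integrable_bound[OF shear_integrable[OF _ loc, of "\<lambda>x. Df x $ j"
      "\<rho> + 1" 0 1 e]])
    show "AE z in lborel \<Otimes>\<^sub>M lborel. norm (case z of (x, s) \<Rightarrow> indicator {0..1} s * Df (x + s *\<^sub>R e) $ j)
      \<le> norm (case z of (x, s) \<Rightarrow> indicator (cball 0 (\<rho> + 1)) x * (indicator {0..1} s * Df (x + s *\<^sub>R e) $ j))"
    proof (rule AE_I2)
      fix z :: "(real^'n) \<times> real"
      obtain x s where z: "z = (x,s)" by (cases z)
      have "Df (x + s *\<^sub>R e) = 0" if "norm x > \<rho> + 1" "0 \<le> s" "s \<le> 1"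
      proof (rule \<rho>(4))
        have "norm x \<le> norm (x + s *\<^sub>R e) + norm (s *\<^sub>R e)" by (metis add_diff_cancel norm_triangle_ineq4)
        then show "\<rho> < norm (x + s *\<^sub>R e)" using that ne by simp
      qed
      then show "norm (case z of (x, s) \<Rightarrow> indicator {0..1} s * Df (x + s *\<^sub>R e) $ j)
      \<le> norm (case z of (x, s) \<Rightarrow> indicator (cball 0 (\<rho> + 1)) x * (indicator {0..1} s * Df (x + s *\<^sub>R e) $ j))"
        by (auto simp: z indicator_def)
    qed
  qed (use cle in auto)
  have FTC: "integral\<^sup>L lborel (\<lambda>s. indicator {0..1} s * Df (x + s *\<^sub>R e) $ j) = f (x + e) - f x" for x
  proof -
    have der: "((\<lambda>s. f (x + s *\<^sub>R e)) has_real_derivative (Df (x + s *\<^sub>R e) $ j)) (at s)" for s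
    proof -
      have d: "(f has_derivative (\<lambda>h. Df (x + s *\<^sub>R e) \<bullet> h)) (at (x + s *\<^sub>R e))" using t
          unfolding test_fun_def by auto
      have "((\<lambda>s. x + s *\<^sub>R e) has_derivative (\<lambda>h. h *\<^sub>R e)) (at s)"
        by (auto intro!: derivative_eq_intros)
      from has_derivative_compose[OF this d] show ?thesis
        unfolding has_field_derivative_def by (rule has_derivative_eq_rhs) (auto simp: fun_eq_iff e_def
            inner_axis)
    qed
    have cont: "isCont (\<lambda>s. Df (x + s *\<^sub>R e) $ j) s" for s
    proof -
      have cD: "continuous_on UNIV Df" using t unfolding test_fun_def by auto
      have "continuous_on UNIV (\<lambda>s. Df (x + s *\<^sub>R e) $ j)"
        by (intro continuous_intros continuous_on_compose2[OF cD]) auto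
      then show ?thesis by (simp add: continuous_on_eq_continuous_at)
    qed
    have "integral\<^sup>L lborel (\<lambda>s. (Df (x + s *\<^sub>R e) $ j) * indicator {0..1} s) = f (x + 1 *\<^sub>R e) - f (x
        + 0 *\<^sub>R e)"
      by (rule integral_FTC_Icc_real) (use der cont in auto)
    then show ?thesis by (simp add: mult.commute)
  qed
  have fi: "integrable lborel f"
  proof -
    have "integrable lborel (\<lambda>x. indicator (cball 0 \<rho>) x * f x)" by (rule loc) (use \<rho> in auto)
    moreover have "(\<lambda>x. indicator (cball 0 \<rho>) x * f x) = f" using \<rho>(3)
        by (auto simp: fun_eq_iff indicator_def)
    ultimately show ?thesis by simp
  qed
  have fi': "integrable lborel (\<lambda>x. f (x + e))"
  proof -
    have "integrable (distr lborel borel ((+) e)) f" using fi by (simp add: lborel_distr_plus)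
    then show ?thesis by (subst (asm) integrable_distr_eq) (auto simp: add.commute)
  qed
  have "integral\<^sup>L lborel (\<lambda>x. Df x $ j) = integral\<^sup>L lborel (\<lambda>s::real. indicator {0..1} s * integral\<^sup>L
      lborel (\<lambda>x. Df x $ j))"
    by (simp add: content_real)
  also have "\<dots> = integral\<^sup>L lborel (\<lambda>s. integral\<^sup>L lborel (\<lambda>x. indicator {0..1} s * Df (x + s *\<^sub>R e) $ j))"
    by (simp add: integral_lborel_shift[of "\<lambda>x. Df x $ j"])
  also have "\<dots> = integral\<^sup>L lborel (\<lambda>x. integral\<^sup>L lborel (\<lambda>s. indicator {0..1} s * Df (x + s *\<^sub>R e) $ j))"
    using lborel_pair.Fubini_integral[OF int] by simp
  also have "\<dots> = integral\<^sup>L lborel (\<lambda>x. f (x + e)) - integral\<^sup>L lborel f"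
    unfolding FTC by (rule Bochner_Integration.integral_diff[OF fi' fi])
  also have "\<dots> = 0" by (simp add: integral_lborel_shift)
  finally show ?thesis .
qed

text \<open>A C1 component times a test function is a test function, so its partial derivatives
  integrate to 0.\<close>

lemma C1_weak_grad:
  fixes v :: "real^'n \<Rightarrow> real^'n" and Dv :: "real^'n \<Rightarrow> real^'n^'n"
  assumes d: "\<And>x i. ((\<lambda>x. v x $ i) has_derivative (\<lambda>h. Dv x $ i \<bullet> h)) (at x)"
    and c: "\<And>i. continuous_on UNIV (\<lambda>x. Dv x $ i)"
  shows "weak_grad v Dv"
proof -
  have cv: "continuous_on UNIV (\<lambda>x. v x $ i)" for i
    using d has_derivative_continuous by (metis continuous_at_imp_continuous_on)
  have cD: "continuous_on UNIV (\<lambda>x. Dv x $ i $ j)" for i j by (intro continuous_intros c)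
  have L2: "L2_loc f" if f: "continuous_on UNIV f" for f :: "real^'n \<Rightarrow> real"
    unfolding L2_loc_def
  proof (intro conjI allI)
    show "f \<in> borel_measurable lebesgue" using borel_measurable_continuous_onI[OF f]
        by (simp add: measurable_completion)
    show "integrable (lebesgue_on (cbox a b)) (\<lambda>x. (f x)\<^sup>2)" for a b
      by (intro continuous_imp_integrable continuous_intros continuous_on_subset[OF f]) auto
  qed
  show ?thesis unfolding weak_grad_def
  proof (intro conjI allI impI L2 cv cD)
    fix \<phi> :: "real^'n \<Rightarrow> real" and D\<phi> i j assume t: "test_fun \<phi> D\<phi>"
    note [measurable] = test_fun_measurable[OF t]
    have [measurable]: "(\<lambda>x. v x $ i) \<in> borel_measurable borel" "(\<lambda>x. Dv x $ i $ j) \<in> borel_measurable borel"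
      using cv cD by (auto intro: borel_measurable_continuous_onI)
    obtain \<rho> C where \<rho>: "\<rho> > 0" "C > 0" "\<And>x. norm x > \<rho> \<Longrightarrow> \<phi> x = 0" "\<And>x. norm x > \<rho> \<Longrightarrow> D\<phi> x = 0"
      "\<And>x. \<bar>\<phi> x\<bar> \<le> C" "\<And>x. norm (D\<phi> x) \<le> C" using test_fun_bounds[OF t] by metis
    have loc: "integrable lborel (\<lambda>x. indicator (cball 0 r) x * k x)" if "continuous_on UNIV k"
        for r and k :: "real^'n \<Rightarrow> real"
      using borel_integrable_compact[of "cball 0 r" k] continuous_on_subset[OF that]
          by (simp add: indicator_def if_distrib cong: if_cong) 
    have i1: "integrable lborel (\<lambda>x. v x $ i * D\<phi> x $ j)"
      by (rule loc_integrable_test_mult[OF _ _ loc[OF cv], where \<rho>=\<rho> and C=C])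
         (use \<rho> in \<open>auto intro: order_trans[OF component_le_norm_cart]\<close>)
    have i2: "integrable lborel (\<lambda>x. Dv x $ i $ j * \<phi> x)"
      by (rule loc_integrable_test_mult[OF _ _ loc[OF cD], where \<rho>=\<rho> and C=C]) (use \<rho> in auto)
    have "integral\<^sup>L lborel (\<lambda>x. (\<phi> x *\<^sub>R Dv x $ i + v x $ i *\<^sub>R D\<phi> x) $ j) = 0"
      by (rule test_fun_integral_deriv_zero[OF test_fun_C1_mult[OF t d c]])
    then have "integral\<^sup>L lborel (\<lambda>x. v x $ i * D\<phi> x $ j + Dv x $ i $ j * \<phi> x) = 0"
      by (simp add: algebra_simps)
    then have "integral\<^sup>L lborel (\<lambda>x. v x $ i * D\<phi> x $ j) = - integral\<^sup>L lborel (\<lambda>x. Dv x $ i $ j * \<phi> x)"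
      using i1 i2 by simp
    then show "integral\<^sup>L lebesgue (\<lambda>x. v x $ i * D\<phi> x $ j) = - integral\<^sup>L lebesgue (\<lambda>x. Dv x $ i $ j * \<phi> x)"
      by (subst (1 2) integral_completion) auto
  qed
qed

text \<open>Separation of variables: \<open>T\<close> is a primitive of 1 / (c s^2 (1 - s)^2), found
  by partial fractions. It increases from -\<infinity> to \<infinity> on the open unit interval, so
  its inverse solves the equation on the whole line and reaches 0 and 1 only in the limit.\<close>

lemma heteroclinic_profile:
  fixes c :: real
  assumes c: "c > 0"
  obtains s where "\<And>t. 0 < s t" "\<And>t. s t < 1" "\<And>t. (s has_real_derivative c * (s t)\<^sup>2 * (1 - s t)\<^sup>2) (at t)"
    "(s \<longlongrightarrow> 1) at_top" "(s \<longlongrightarrow> 0) at_bot"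
proof -
  define T where "T s = (- 1 / s + 1 / (1 - s) + 2 * ln s - 2 * ln (1 - s)) / c" for s :: real
  have der: "(T has_real_derivative 1 / (c * s\<^sup>2 * (1 - s)\<^sup>2)) (at s)" if "0 < s" "s < 1" for s
  proof -
    have "(T has_real_derivative (1 / s\<^sup>2 + 1 / (1 - s)\<^sup>2 + 2 / s + 2 / (1 - s)) / c) (at s)"
    proof -
      have "((\<lambda>s. - 1 / s) has_real_derivative 1 / s\<^sup>2) (at s)" "((\<lambda>s. 1 / (1 - s)) has_real_derivative
          1 / (1 - s)\<^sup>2) (at s)"
        "((\<lambda>s. 2 * ln s) has_real_derivative 2 / s) (at s)" "((\<lambda>s. 2 * ln (1 - s)) has_real_derivative
            - (2 / (1 - s))) (at s)"
        using that by (auto intro!: derivative_eq_intros simp: power2_eq_square)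
      from DERIV_cdivide[OF DERIV_diff[OF DERIV_add[OF DERIV_add[OF this(1,2)] this(3)] this(4)], of c]
      show ?thesis unfolding T_def by simp
    qed
    moreover have "(1 / s\<^sup>2 + 1 / (1 - s)\<^sup>2 + 2 / s + 2 / (1 - s)) / c = 1 / (c * s\<^sup>2 * (1 - s)\<^sup>2)"
    proof -
      have s: "s \<noteq> 0" "1 - s \<noteq> 0" using that by auto
      have "1 / s\<^sup>2 + 1 / (1 - s)\<^sup>2 + 2 / s + 2 / (1 - s) = ((1 - s)\<^sup>2 + s\<^sup>2 + 2 * s * (1 - s)\<^sup>2
          + 2 * (1 - s) * s\<^sup>2) / (s\<^sup>2 * (1 - s)\<^sup>2)"
        using s by (simp add: divide_simps) (simp add: power2_eq_square algebra_simps)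
      also have "(1 - s)\<^sup>2 + s\<^sup>2 + 2 * s * (1 - s)\<^sup>2 + 2 * (1 - s) * s\<^sup>2 = 1"
        by (simp add: power2_eq_square algebra_simps)
      finally show ?thesis by (simp add: mult.assoc)
    qed
    ultimately show ?thesis by simp
  qed
  have cont: "isCont T s" if "0 < s" "s < 1" for s using der[OF that] DERIV_isCont by blast
  have mono: "T a < T b" if "0 < a" "a < b" "b < 1" for a b
  proof (rule DERIV_pos_imp_increasing[OF that(2)])
    fix x assume "a \<le> x" "x \<le> b"
    then have "0 < x" "x < 1" using that by auto
    then show "\<exists>y. (T has_real_derivative y) (at x) \<and> 0 < y" using der[of x] c
        by (intro exI[of _ "1 / (c * x\<^sup>2 * (1 - x)\<^sup>2)"]) auto
  qed
  have top: "filterlim T at_top (at_left 1)" unfolding T_def using c by real_asymp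
  have bot: "filterlim T at_bot (at_right 0)" unfolding T_def using c by real_asymp
  have surj: "\<exists>s. 0 < s \<and> s < 1 \<and> T s = t" for t
  proof -
    have "eventually (\<lambda>s. T s \<ge> t \<and> 1/2 < s \<and> s < 1) (at_left 1)"
      using top unfolding filterlim_at_top
      by (intro eventually_conj) (auto intro!: eventually_at_leftI[of "1/2"])
    then obtain b where b: "T b \<ge> t" "1/2 < b" "b < 1" using eventually_happens'
        by (metis (mono_tags, lifting) trivial_limit_at_left_real)
    have "eventually (\<lambda>s. T s \<le> t \<and> 0 < s \<and> s < 1/2) (at_right 0)"
      using bot unfolding filterlim_at_bot
      by (intro eventually_conj) (auto intro!: eventually_at_rightI[of _ "1/2"])
    then obtain a where a: "T a \<le> t" "0 < a" "a < 1/2" using eventually_happens'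
        by (metis (mono_tags, lifting) trivial_limit_at_right_real)
    have "\<exists>s\<ge>a. s \<le> b \<and> T s = t"
      by (rule IVT) (use a b cont in auto)
    then obtain s where "a \<le> s" "s \<le> b" "T s = t" by blast
    then show ?thesis using a b by (intro exI[of _ s]) linarith
  qed
  define s where "s t = (SOME s. 0 < s \<and> s < 1 \<and> T s = t)" for t
  have s: "0 < s t" "s t < 1" "T (s t) = t" for t using someI_ex[OF surj[of t]] unfolding s_def by auto
  have sT: "s (T a) = a" if "0 < a" "a < 1" for a
    using mono[of a "s (T a)"] mono[of "s (T a)" a] s[of "T a"] that
        by (cases a "s (T a)" rule: linorder_cases) auto
  have sc: "isCont s t" for t
  proof -
    have "isCont s (T (s t))"
      by (rule isCont_inverse_function2[of "s t / 2" "s t" "(1 + s t) / 2"]) (use s[of t] sT cont in auto)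
    then show ?thesis by (simp add: s)
  qed
  have sd: "(s has_real_derivative c * (s t)\<^sup>2 * (1 - s t)\<^sup>2) (at t)" for t
  proof -
    have s0: "s t \<noteq> 0" "s t \<noteq> 1" using s(1,2)[of t] by auto
    have "(s has_real_derivative inverse (1 / (c * (s t)\<^sup>2 * (1 - s t)\<^sup>2))) (at t)"
      by (rule DERIV_inverse_function[OF der, of s t "t - 1" "t + 1"]) (use s[of t] s c sc s0 in auto)
    then show ?thesis by simp
  qed
  have sm: "a < s t" if "0 < a" "a < 1" "T a < t" for a t
    using mono[of "s t" a] s[of t] that by (cases a "s t" rule: linorder_cases) auto
  have sm': "s t < a" if "0 < a" "a < 1" "T a > t" for a t
    using mono[of a "s t"] s[of t] that by (cases a "s t" rule: linorder_cases) auto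
  have "(s \<longlongrightarrow> 1) at_top"
  proof (rule order_tendstoI)
    fix a :: real assume "a < 1"
    define a' where "a' = max a (1/2)"
    have a': "0 < a'" "a' < 1" "a \<le> a'" using \<open>a < 1\<close> by (auto simp: a'_def)
    show "\<forall>\<^sub>F t in at_top. a < s t"
      using eventually_gt_at_top[of "T a'"] by eventually_elim (use sm a' in force)
  next
    fix a :: real assume "1 < a"
    then show "\<forall>\<^sub>F t in at_top. s t < a" using s(2) by (intro always_eventually) (meson less_trans)
  qed
  moreover have "(s \<longlongrightarrow> 0) at_bot"
  proof (rule order_tendstoI)
    fix a :: real assume "0 < a"
    define a' where "a' = min a (1/2)"
    have a': "0 < a'" "a' < 1" "a' \<le> a" using \<open>0 < a\<close> by (auto simp: a'_def)
    show "\<forall>\<^sub>F t in at_bot. s t < a"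
      using eventually_gt_at_bot[of "T a'"] by eventually_elim (use sm' a' in force)
  next
    fix a :: real assume "a < 0"
    then show "\<forall>\<^sub>F t in at_bot. a < s t" using s(1) by (intro always_eventually) (meson less_trans)
  qed
  ultimately show ?thesis using that s sd by blast
qed

subsection \<open>Geodesics and one-dimensional competitors\<close>

lemma mem_unit_box: "(x::real^'n) \<in> cbox 0 One \<longleftrightarrow> (\<forall>k. 0 \<le> x $ k \<and> x $ k \<le> 1)" "(x::real^'n) \<in> box 0 One
    \<longleftrightarrow> (\<forall>k. 0 < x $ k \<and> x $ k < 1)"
proof -
  have one: "(One :: real^'n) $ k = 1" for k
    unfolding cart_eq_inner_axis by (rule inner_sum_Basis) (simp add: axis_in_Basis_iff)
  show "(x::real^'n) \<in> cbox 0 One \<longleftrightarrow> (\<forall>k. 0 \<le> x $ k \<and> x $ k \<le> 1)" unfolding mem_box_cart one by simp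
  show "(x::real^'n) \<in> box 0 One \<longleftrightarrow> (\<forall>k. 0 < x $ k \<and> x $ k < 1)" unfolding mem_box_cart one by simp
qed

lemma unit_cube_sets [measurable]: "{x :: real^'n. \<forall>k. x $ k \<in> {0..<1}} \<in> sets borel"
proof -
  have "{x :: real^'n. \<forall>k. x $ k \<in> {0..<1}} = {x \<in> space borel. \<forall>k. x $ k \<in> {0..<1}}" by simp
  also have "\<dots> \<in> sets borel" by measurable
  finally show ?thesis .
qed

lemma emeasure_unit_cube: "emeasure lborel {x :: real^'n. \<forall>k. x $ k \<in> {0..<1}} = 1"
proof (rule antisym)
  have "emeasure lborel {x :: real^'n. \<forall>k. x $ k \<in> {0..<1}} \<le> emeasure lborel (cbox 0 One :: (real^'n) set)"
    by (intro emeasure_mono) (auto simp: mem_unit_box less_imp_le)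
  also have "\<dots> = 1" by (simp add: emeasure_lborel_cbox_eq)
  finally show "emeasure lborel {x :: real^'n. \<forall>k. x $ k \<in> {0..<1}} \<le> 1" .
  have "1 = emeasure lborel (box 0 One :: (real^'n) set)" by (simp add: emeasure_lborel_box_eq)
  also have "\<dots> \<le> emeasure lborel {x :: real^'n. \<forall>k. x $ k \<in> {0..<1}}"
    by (intro emeasure_mono) (auto simp: mem_unit_box less_imp_le)
  finally show "1 \<le> emeasure lborel {x :: real^'n. \<forall>k. x $ k \<in> {0..<1}}" .
qed

lemma norm_outer: "norm (\<chi> i. (a $ i) *\<^sub>R b) = norm a * norm (b :: real^'n)" for a :: "real^'n"
  by (simp add: norm_vec_def[of "\<chi> i. (a $ i) *\<^sub>R b"] norm_vec_def[of a] L2_set_left_distrib)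

section \<open>Lines parallel to the direction of transition\<close>

locale frame =
  fixes i1 :: "'n::finite" and R :: "real^'n^'n" and \<nu> :: "real^'n"
  assumes SO: "SO_matrix R" and R\<nu>: "R *v \<nu> = axis i1 1"
begin

lemma orth: "orthogonal_matrix R" using SO by (simp add: SO_matrix_def)

lemma \<nu>_eq: "\<nu> = transpose R *v axis i1 1"
  using orthogonal_matrix_mul_transpose(2)[OF orth, of \<nu>] R\<nu> by simp

lemma norm_\<nu>: "norm \<nu> = 1"
  using orthogonal_matrix_inner(3)[OF orth, of \<nu>] R\<nu> by simp

lemma inner_\<nu>: "x \<bullet> \<nu> = (R *v x) $ i1"
  using orthogonal_matrix_inner(1)[OF orth, of x "axis i1 1"] by (simp add: \<nu>_eq inner_axis)

definition D0 :: "(real^'n) set" where "D0 = {x. \<forall>k. (R *v x) $ k \<in> {0..<1}}"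

lemma D0_sets [measurable]: "D0 \<in> sets borel"
proof -
  have "D0 = {x \<in> space borel. \<forall>k. (R *v x) $ k \<in> {0..<1}}" by (simp add: D0_def)
  also have "\<dots> \<in> sets borel" by measurable
  finally show ?thesis .
qed

lemma fund_dom_sets [measurable]: "fund_dom i1 R \<in> sets borel"
proof -
  have "fund_dom i1 R = {x \<in> space borel. \<forall>k. k \<noteq> i1 \<longrightarrow> (R *v x) $ k \<in> {0..<1}}" by (simp add: fund_dom_def)
  also have "\<dots> \<in> sets borel" by measurable
  finally show ?thesis .
qed

lemma emeasure_D0: "emeasure lborel D0 = 1"
proof -
  have "emeasure (distr lborel borel (\<lambda>x. R *v x)) {x :: real^'n. \<forall>k. x $ k \<in> {0..<1}} = emeasure lborel D0"
    by (subst emeasure_distr) (auto simp: D0_def vimage_def)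
  then show ?thesis using emeasure_unit_cube[where 'n='n] by (simp add: distr_orthogonal_lborel[OF orth])
qed

text \<open>A point of the strip is met by the lines with base points in \<open>D0\<close> with
  total weight 1: translating it back by \<open>s\<close> lands in \<open>D0\<close> for a
  lattice-free condition on the transverse coordinates and for \<open>s\<close> in an interval of
  length 1.\<close>

lemma nn_integral_fund_dom:
  assumes [measurable]: "h \<in> borel_measurable borel"
  shows "(\<integral>\<^sup>+x. h x * indicator (fund_dom i1 R) x \<partial>lborel) = (\<integral>\<^sup>+x. (\<integral>\<^sup>+s. h (x + s *\<^sub>R \<nu>) \<partial>lborel) *
      indicator D0 x \<partial>lborel)"
proof -
  have ind: "indicator D0 (x - s *\<^sub>R \<nu>) = (indicator (fund_dom i1 R) x * indicator {x \<bullet> \<nu>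
      - 1 <.. x \<bullet> \<nu>} s :: ennreal)" for x s
  proof -
    have "R *v (x - s *\<^sub>R \<nu>) = R *v x - s *\<^sub>R axis i1 1"
      by (simp add: matrix_vector_mult_diff_distrib matrix_vector_mult_scaleR R\<nu>)
    then have c: "(R *v (x - s *\<^sub>R \<nu>)) $ k = (R *v x) $ k - (if k = i1 then s else 0)" for k
      by (simp add: axis_def)
    have "x - s *\<^sub>R \<nu> \<in> D0 \<longleftrightarrow> x \<in> fund_dom i1 R \<and> (R *v x) $ i1 - s \<in> {0..<1}"
      unfolding D0_def fund_dom_def mem_Collect_eq c by auto
    then show ?thesis by (auto simp: indicator_def inner_\<nu>)
  qed
  have "(\<integral>\<^sup>+x. (\<integral>\<^sup>+s. h (x + s *\<^sub>R \<nu>) \<partial>lborel) * indicator D0 x \<partial>lborel) = (\<integral>\<^sup>+x. \<integral>\<^sup>+s. h (x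
      + s *\<^sub>R \<nu>) * indicator D0 x \<partial>lborel \<partial>lborel)"
    by (subst nn_integral_multc) auto
  also have "\<dots> = (\<integral>\<^sup>+s. \<integral>\<^sup>+x. h (x + s *\<^sub>R \<nu>) * indicator D0 x \<partial>lborel \<partial>lborel)"
    by (rule lborel_pair.Fubini'[symmetric]) measurable
  also have "\<dots> = (\<integral>\<^sup>+s. \<integral>\<^sup>+x. h x * indicator D0 (x - s *\<^sub>R \<nu>) \<partial>lborel \<partial>lborel)"
  proof (rule nn_integral_cong)
    fix s :: real
    have "(\<integral>\<^sup>+x. h (x + s *\<^sub>R \<nu>) * indicator D0 ((x + s *\<^sub>R \<nu>) - s *\<^sub>R \<nu>) \<partial>lborel)
        = (\<integral>\<^sup>+x. h x * indicator D0 (x - s *\<^sub>R \<nu>) \<partial>lborel)"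
      by (rule nn_integral_lborel_shift) measurable
    then show "(\<integral>\<^sup>+x. h (x + s *\<^sub>R \<nu>) * indicator D0 x \<partial>lborel) = (\<integral>\<^sup>+x. h x * indicator D0 (x
        - s *\<^sub>R \<nu>) \<partial>lborel)" by simp
  qed
  also have "\<dots> = (\<integral>\<^sup>+x. \<integral>\<^sup>+s. h x * indicator D0 (x - s *\<^sub>R \<nu>) \<partial>lborel \<partial>lborel)"
    by (rule lborel_pair.Fubini') measurable
  also have "\<dots> = (\<integral>\<^sup>+x. \<integral>\<^sup>+s. (h x * indicator (fund_dom i1 R) x) * indicator {x \<bullet> \<nu>
      - 1 <.. x \<bullet> \<nu>} s \<partial>lborel \<partial>lborel)"
    unfolding ind by (simp add: mult.assoc)
  also have "\<dots> = (\<integral>\<^sup>+x. h x * indicator (fund_dom i1 R) x \<partial>lborel)"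
    by (subst nn_integral_cmult) auto
  finally show ?thesis by simp
qed

end

text \<open>Interface between the construction of the potential and the variational argument;
  \<open>\<Psi> a\<close> plays the part of the distance from \<open>a\<close>.\<close>

locale calibrated_potential =
  fixes X :: "(real^'n) set" and \<delta> :: "real^'n \<Rightarrow> real^'n \<Rightarrow> real" and W :: "real^'n \<Rightarrow> real" and \<Psi>
      :: "real^'n \<Rightarrow> real^'n \<Rightarrow> real" and M :: real
  assumes indep: "\<not> affine_dependent X" and finX: "finite X"
    and metric: "metric_on X \<delta>"
    and W_lip: "\<exists>L. L-lipschitz_on UNIV W" and W_nonneg: "\<And>z. 0 \<le> W z"
    and W_far: "\<And>z. M \<le> norm z \<Longrightarrow> W z = 1" and W_zero: "{z. W z = 0} = X"
    and W_edge: "\<And>x y s. x \<in> X \<Longrightarrow> y \<in> X \<Longrightarrow> x \<noteq> y \<Longrightarrow> 0 \<le> s \<Longrightarrow> s \<le> 1 \<Longrightarrow>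
       W (x + s *\<^sub>R (y - x)) = (30 * s\<^sup>2 * (1 - s)\<^sup>2 * \<delta> x y / norm (y - x))\<^sup>2 / 2"
    and \<Psi>_cal: "\<And>a. a \<in> X \<Longrightarrow> calibrates (\<Psi> a) (\<lambda>z. sqrt (2 * W z))"
    and \<Psi>_vertex: "\<And>a x. a \<in> X \<Longrightarrow> x \<in> X \<Longrightarrow> \<Psi> a x = \<delta> a x"
begin

lemma W_cont: "continuous_on UNIV W"
  using W_lip lipschitz_on_continuous_on by blast

lemma W_measurable [measurable]: "W \<in> borel_measurable borel"
  using W_cont by (rule borel_measurable_continuous_onI)

lemma \<delta>_props:
  assumes "x \<in> X" "y \<in> X"
  shows "0 \<le> \<delta> x y" "\<delta> x y = 0 \<longleftrightarrow> x = y"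
  using metric assms unfolding metric_on_def by blast+

text \<open>Calibration by \<open>\<Psi> x\<close> bounds all admissible curves from below. The
  straight segment attains the bound, because on it \<open>sqrt (2 * W)\<close> times the speed is
  \<open>\<delta> x y\<close> times the derivative of the quintic, which rises from 0 to 1.\<close>

lemma geod_eq:
  assumes x: "x \<in> X" and y: "y \<in> X"
  shows "geod W x y = \<delta> x y"
proof -
  define \<Gamma> where "\<Gamma> = {\<gamma> :: real \<Rightarrow> real^'n. (\<exists>L. L-lipschitz_on {-1..1} \<gamma>) \<and> \<gamma> (-1) = x \<and> \<gamma> 1 = y}"
  define E where "E \<gamma> = integral\<^sup>L (lebesgue_on {-1..1}) (\<lambda>t. sqrt (2 * W (\<gamma> t)) * norm
      (vector_derivative \<gamma> (at t)))" for \<gamma>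
  have g: "geod W x y = (INF \<gamma>\<in>\<Gamma>. E \<gamma>)" unfolding geod_def \<Gamma>_def E_def ..
  have lower: "\<delta> x y \<le> E \<gamma>" if g\<Gamma>: "\<gamma> \<in> \<Gamma>" for \<gamma>
  proof -
    obtain L where L: "L-lipschitz_on {-1..1} \<gamma>" and e: "\<gamma> (-1) = x" "\<gamma> 1 = y" using g\<Gamma> unfolding \<Gamma>_def
        by blast
    define q where "q t = vector_derivative \<gamma> (at t)" for t
    have c: "curve_on (-1) 1 \<gamma> q" using lipschitz_curve_on[OF L] by (simp add: q_def[abs_def])
    have F: "continuous_on UNIV (\<lambda>z. sqrt (2 * W z))" by (intro continuous_intros W_cont)
    have "\<bar>\<Psi> x (\<gamma> 1) - \<Psi> x (\<gamma> (-1))\<bar> \<le> integral {-1..1} (\<lambda>t. sqrt (2 * W (\<gamma> t)) * norm (q t))"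
      by (rule calibration_bound[OF _ c F \<Psi>_cal[OF x]]) (auto simp: W_nonneg)
    also have "\<dots> = E \<gamma>"
      using set_lebesgue_integral_eq_integral(2)[OF curve_on_norm_integrable[OF c F]]
      by (simp add: E_def q_def set_lebesgue_integral_def integral_restrict_space)
    finally show ?thesis using \<Psi>_vertex[OF x x] \<Psi>_vertex[OF x y] \<delta>_props[OF x x] by (simp add: e)
  qed
  define \<gamma> where "\<gamma> t = x + ((1 + t) / 2) *\<^sub>R (y - x)" for t
  have vd: "vector_derivative \<gamma> (at t) = (1/2) *\<^sub>R (y - x)" for t
    unfolding \<gamma>_def by (rule vector_derivative_at) (auto intro!: derivative_eq_intros
        simp: has_vector_derivative_def)
  have g\<Gamma>: "\<gamma> \<in> \<Gamma>"
  proof -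
    have "(norm (y - x) / 2)-lipschitz_on {-1..1} \<gamma>"
    proof (rule lipschitz_onI)
      fix s t :: real
      have "\<gamma> s - \<gamma> t = ((s - t) / 2) *\<^sub>R (y - x)"
        unfolding \<gamma>_def by (simp add: scaleR_left_diff_distrib[symmetric] diff_divide_distrib[symmetric]
            del: scaleR_left_diff_distrib)
      then show "dist (\<gamma> s) (\<gamma> t) \<le> norm (y - x) / 2 * dist s t" by (simp add: dist_norm)
    qed simp
    then show ?thesis unfolding \<Gamma>_def by (auto simp: \<gamma>_def)
  qed
  have upper: "E \<gamma> = \<delta> x y"
  proof (cases "x = y")
    case True then show ?thesis using \<delta>_props[OF x y] by (simp add: E_def vd)
  next
    case False
    \<comment> \<open>The segment is run through with parameter (1 + t) / 2; its speed |y - x| / 2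
      halves the 30 of the edge profile.\<close>
    define f where "f t = 15 * ((1 + t) / 2)\<^sup>2 * (1 - (1 + t) / 2)\<^sup>2 * \<delta> x y" for t :: real
    have "E \<gamma> = integral\<^sup>L (lebesgue_on {-1..1}) f"
      unfolding E_def
    proof (rule Bochner_Integration.integral_cong[OF refl])
      fix t :: real assume "t \<in> space (lebesgue_on {-1..1})"
      then have t: "0 \<le> (1 + t) / 2" "(1 + t) / 2 \<le> 1" by auto
      have "sqrt (2 * W (\<gamma> t)) = 30 * ((1 + t) / 2)\<^sup>2 * (1 - (1 + t) / 2)\<^sup>2 * \<delta> x y / norm (y - x)"
        unfolding \<gamma>_def W_edge[OF x y False t] using \<delta>_props[OF x y] by (simp add: real_sqrt_abs)
      then show "sqrt (2 * W (\<gamma> t)) * norm (vector_derivative \<gamma> (at t)) = f t"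
        using False by (simp add: vd f_def)
    qed
    also have "\<dots> = integral {-1..1} f"
    proof -
      have "continuous_on {-1..1} f" unfolding f_def by (intro continuous_intros) auto
      from set_lebesgue_integral_eq_integral(2)[OF absolutely_integrable_continuous_real[OF this]]
      show ?thesis by (simp add: set_lebesgue_integral_def integral_restrict_space)
    qed
    also have "\<dots> = \<delta> x y"
    proof -
      define \<theta> where "\<theta> t = \<delta> x y * (10 * ((1 + t) / 2) ^ 3 - 15 * ((1 + t) / 2) ^ 4 + 6 * ((1
          + t) / 2) ^ 5)" for t :: real
      have "(f has_integral (\<theta> 1 - \<theta> (-1))) {-1..1}"
      proof (rule fundamental_theorem_of_calculus)
        fix t :: real
        have "(\<theta> has_real_derivative f t) (at t)"
          unfolding \<theta>_def f_def by (rule derivative_eq_intros refl | simp)+ (simp add: field_simps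
              power2_eq_square power3_eq_cube power4_eq_xxxx)
        then show "(\<theta> has_vector_derivative f t) (at t within {-1..1})"
          by (auto simp: has_real_derivative_iff_has_vector_derivative intro: has_vector_derivative_at_within)
      qed simp
      then show ?thesis by (simp add: integral_unique \<theta>_def)
    qed
    finally show ?thesis .
  qed
  show ?thesis unfolding g
  proof (rule antisym)
    show "(INF \<gamma>\<in>\<Gamma>. E \<gamma>) \<le> \<delta> x y"
      using lower g\<Gamma> upper by (metis (mono_tags, lifting) bdd_belowI2 cINF_lower)
    show "\<delta> x y \<le> (INF \<gamma>\<in>\<Gamma>. E \<gamma>)"
      using lower g\<Gamma> by (intro cINF_greatest) auto
  qed
qed

text \<open>The segment is parametrised so that |g'| = sqrt (2 W(g)). Then Young's inequality is an
  equality and the energy equals the length in the metric of \<open>geod\<close>; the end points are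
  reached at infinite time.\<close>

lemma optimal_profile:
  assumes um: "um \<in> X" and up: "up \<in> X"
  obtains g :: "real \<Rightarrow> real^'n" and r :: "real \<Rightarrow> real" where
    "\<forall>t. (g has_vector_derivative r t *\<^sub>R (up - um)) (at t)" "continuous_on UNIV r"
    "(g \<longlongrightarrow> up) at_top" "(g \<longlongrightarrow> um) at_bot"
    "(\<integral>\<^sup>+t. ennreal ((norm (r t *\<^sub>R (up - um)))\<^sup>2 / 2 + W (g t)) \<partial>lborel) \<le> ennreal (\<delta> um up)"
proof (cases "um = up")
  case True
  have "W up = 0" using W_zero up by auto
  then show ?thesis using that[of "\<lambda>_. up" "\<lambda>_. 0"] True \<delta>_props[OF um up] by simp
next
  case False
  define d where "d = norm (up - um)"
  have d: "d > 0" using False by (simp add: d_def)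
  have \<delta>: "\<delta> um up > 0" using \<delta>_props[OF um up] False by (simp add: less_le)
  \<comment> \<open>With |g'| = s' d the law |g'| = sqrt (2 W(g)) reads s' d = 30 s^2 (1 - s)^2
    \<delta> / d, which determines this constant.\<close>
  define c where "c = 30 * \<delta> um up / d\<^sup>2"
  have "c > 0" using d \<delta> by (simp add: c_def)
  then obtain s where s: "\<And>t. 0 < s t" "\<And>t. s t < 1" "\<And>t. (s has_real_derivative c * (s t)\<^sup>2 * (1
      - s t)\<^sup>2) (at t)"
    "(s \<longlongrightarrow> 1) at_top" "(s \<longlongrightarrow> 0) at_bot" using heteroclinic_profile by metis
  have sc: "continuous_on UNIV s" using s(3) by (intro continuous_at_imp_continuous_on ballI
      DERIV_isCont) auto
  define r where "r t = c * (s t)\<^sup>2 * (1 - s t)\<^sup>2" for t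
  define g where "g t = um + s t *\<^sub>R (up - um)" for t
  define \<theta> where "\<theta> a = 10 * a ^ 3 - 15 * a ^ 4 + 6 * a ^ 5" for a :: real
  define f where "f t = \<delta> um up * (30 * (s t)\<^sup>2 * (1 - s t)\<^sup>2 * r t)" for t
  have rc: "continuous_on UNIV r" unfolding r_def by (intro continuous_intros sc)
  have fc: "continuous_on UNIV f" unfolding f_def by (intro continuous_intros sc rc)
  have [measurable]: "f \<in> borel_measurable borel" using fc by (rule borel_measurable_continuous_onI)
  have r0: "0 \<le> r t" for t using \<open>c > 0\<close> by (simp add: r_def)
  have f0: "0 \<le> f t" for t using \<delta> r0 by (simp add: f_def)
  have th: "0 \<le> \<theta> a \<and> \<theta> a \<le> 1" if "0 < a" "a < 1" for a
  proof -
    have q: "0 \<le> 10 - 15 * b + 6 * b\<^sup>2" for b :: real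
    proof -
      have "10 - 15 * b + 6 * b\<^sup>2 = 6 * (b - 5/4)\<^sup>2 + 5/8" by (simp add: power2_eq_square algebra_simps)
      then show ?thesis by simp
    qed
    have "\<theta> a = a ^ 3 * (10 - 15 * a + 6 * a\<^sup>2)" by (simp add: \<theta>_def algebra_simps eval_nat_numeral)
    moreover have "1 - \<theta> a = (1 - a) ^ 3 * (10 - 15 * (1 - a) + 6 * (1 - a)\<^sup>2)"
      by (simp add: \<theta>_def algebra_simps eval_nat_numeral)
    moreover have "0 \<le> a ^ 3 * (10 - 15 * a + 6 * a\<^sup>2)" "0 \<le> (1 - a) ^ 3 * (10 - 15 * (1 - a) + 6 * (1
        - a)\<^sup>2)"
      using that q[of a] q[of "1 - a"] by (intro mult_nonneg_nonneg; simp)+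
    ultimately show ?thesis by simp
  qed
  have en: "(norm (r t *\<^sub>R (up - um)))\<^sup>2 / 2 + W (g t) = f t" for t
  proof -
    have w: "W (g t) = (30 * (s t)\<^sup>2 * (1 - s t)\<^sup>2 * \<delta> um up / d)\<^sup>2 / 2"
      unfolding g_def d_def using s(1,2)[of t] by (intro W_edge um up False) auto
    have "norm (r t *\<^sub>R (up - um)) = r t * d" using r0 by (simp add: d_def)
    moreover have rd: "30 * (s t)\<^sup>2 * (1 - s t)\<^sup>2 * \<delta> um up / d = r t * d"
      using d by (simp add: r_def c_def power2_eq_square)
    ultimately have "(norm (r t *\<^sub>R (up - um)))\<^sup>2 / 2 + W (g t) = (30 * (s t)\<^sup>2 * (1
        - s t)\<^sup>2 * \<delta> um up / d) * (r t * d)"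
      by (simp add: w power2_eq_square)
    also have "\<dots> = f t" using d by (simp add: f_def)
    finally show ?thesis .
  qed
  \<comment> \<open>The energy density is the derivative of \<open>\<delta> um up\<close> times the
    quintic \<open>\<theta>\<close> of \<open>s\<close>, and \<open>\<theta>\<close> takes values
    between 0 and 1.\<close>
  have part: "(\<integral>\<^sup>+t. ennreal (f t) * indicator {- real n..real n} t \<partial>lborel) \<le> ennreal (\<delta> um up)" for n :: nat
  proof -
    have "(\<integral>\<^sup>+t. ennreal (f t) * indicator {- real n..real n} t \<partial>lborel) = ennreal (\<delta> um up * \<theta> (s (real
        n)) - \<delta> um up * \<theta> (s (- real n)))"
    proof (rule nn_integral_FTC_Icc)
      show "((\<lambda>t. \<delta> um up * \<theta> (s t)) has_real_derivative f t) (at t)" for t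
        unfolding \<theta>_def f_def r_def
        by (rule derivative_eq_intros s(3) refl | simp)+ (simp add: algebra_simps power2_eq_square
            power3_eq_cube power4_eq_xxxx)
    qed (use f0 in auto)
    also have "\<dots> \<le> ennreal (\<delta> um up)"
    proof (rule ennreal_leI)
      have "\<delta> um up * \<theta> (s (real n)) \<le> \<delta> um up * 1" using th[OF s(1,2)] \<delta> by (intro mult_left_mono) auto
      moreover have "0 \<le> \<delta> um up * \<theta> (s (- real n))" using th[OF s(1,2)] \<delta> by simp
      ultimately show "\<delta> um up * \<theta> (s (real n)) - \<delta> um up * \<theta> (s (- real n)) \<le> \<delta> um up" by linarith
    qed
    finally show ?thesis .
  qed
  have "(\<integral>\<^sup>+t. ennreal (f t) \<partial>lborel) = (\<integral>\<^sup>+t. (SUP n. ennreal (f t) * indicator {- real n..real n} t)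
      \<partial>lborel)"
  proof (rule nn_integral_cong)
    fix t :: real
    obtain n :: nat where n: "\<bar>t\<bar> \<le> real n" using real_arch_simple by blast
    show "ennreal (f t) = (SUP n. ennreal (f t) * indicator {- real n..real n} t)"
    proof (rule antisym)
      have "ennreal (f t) = ennreal (f t) * indicator {- real n..real n} t" using n by (auto simp: abs_le_iff)
      also have "\<dots> \<le> (SUP n. ennreal (f t) * indicator {- real n..real n} t)" by (rule SUP_upper) simp
      finally show "ennreal (f t) \<le> (SUP n. ennreal (f t) * indicator {- real n..real n} t)" .
    qed (auto intro!: SUP_least simp: indicator_def)
  qed
  also have "\<dots> = (SUP n. \<integral>\<^sup>+t. ennreal (f t) * indicator {- real n..real n} t \<partial>lborel)"
    by (rule nn_integral_monotone_convergence_SUP) (auto simp: incseq_def le_fun_def indicator_def)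
  also have "\<dots> \<le> ennreal (\<delta> um up)" by (rule SUP_least) (rule part)
  finally have tot: "(\<integral>\<^sup>+t. ennreal (f t) \<partial>lborel) \<le> ennreal (\<delta> um up)" .
  have gd: "(g has_vector_derivative r t *\<^sub>R (up - um)) (at t)" for t
    unfolding g_def using s(3)[of t] by (auto intro!: derivative_eq_intros simp: r_def
        has_real_derivative_iff_has_vector_derivative)
  have "(g \<longlongrightarrow> um + 1 *\<^sub>R (up - um)) at_top" "(g \<longlongrightarrow> um + 0 *\<^sub>R (up - um)) at_bot"
    unfolding g_def by (intro tendsto_intros s)+
  moreover have "(\<integral>\<^sup>+t. ennreal ((norm (r t *\<^sub>R (up - um)))\<^sup>2 / 2 + W (g t)) \<partial>lborel) \<le> ennreal (\<delta> um up)"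
    unfolding en by (rule tot)
  ultimately show ?thesis using that[OF allI[OF gd] rc] by simp
qed

end

locale transition = calibrated_potential X \<delta> W \<Psi> M + frame i1 R \<nu>
  for X :: "(real^'n) set" and \<delta> W \<Psi> M and i1 :: "'n::finite" and R :: "real^'n^'n" and \<nu> :: "real^'n" +
  fixes um up :: "real^'n"
  assumes um: "um \<in> X" and up: "up \<in> X" and orth_\<nu>: "\<nu> \<bullet> (up - um) = 0"
begin

text \<open>The optimal profile as a function of \<open>x \<bullet> \<nu>\<close>. The trace of its
  gradient is \<open>g' \<bullet> \<nu>\<close>, a multiple of
  \<open>\<nu> \<bullet> (up - um)\<close>: orthogonality of \<open>\<nu>\<close> to the jump makes
  the field divergence free. Each slice average is a value of \<open>g\<close>.\<close>

lemma competitor: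
  obtains v Dv where "H1div i1 R v Dv" "bc i1 R \<nu> v um up" "energy W i1 R v Dv \<le> ennreal (\<delta> um up)"
proof -
  obtain g :: "real \<Rightarrow> real^'n" and r where g: "\<forall>t. (g has_vector_derivative r t *\<^sub>R (up - um)) (at t)"
      "continuous_on UNIV r"
    "(g \<longlongrightarrow> up) at_top" "(g \<longlongrightarrow> um) at_bot"
    "(\<integral>\<^sup>+t. ennreal ((norm (r t *\<^sub>R (up - um)))\<^sup>2 / 2 + W (g t)) \<partial>lborel) \<le> ennreal (\<delta> um up)"
    using optimal_profile[OF um up] .
  define g' where "g' t = r t *\<^sub>R (up - um)" for t
  have gd: "(g has_vector_derivative g' t) (at t)" for t using g(1) by (simp add: g'_def)
  have gc: "continuous_on UNIV g" using gd has_vector_derivative_continuous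
      by (metis continuous_at_imp_continuous_on)
  have g'c: "continuous_on UNIV g'" unfolding g'_def by (intro continuous_intros g)
  note [measurable] = borel_measurable_continuous_onI[OF gc] borel_measurable_continuous_onI[OF g'c]
  define v where "v x = g (x \<bullet> \<nu>)" for x
  define Dv where "Dv x = (\<chi> i. (g' (x \<bullet> \<nu>) $ i) *\<^sub>R \<nu>)" for x
  have nDv: "norm (Dv x) = norm (g' (x \<bullet> \<nu>))" for x by (simp add: Dv_def norm_outer norm_\<nu>)
  have e: "energy W i1 R v Dv = (\<integral>\<^sup>+t. ennreal ((norm (g' t))\<^sup>2 / 2 + W (g t)) \<partial>lborel)"
  proof -
    define h where "h t = ennreal ((norm (g' t))\<^sup>2 / 2 + W (g t))" for t
    have [measurable]: "h \<in> borel_measurable borel" unfolding h_def by measurable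
    have "energy W i1 R v Dv = (\<integral>\<^sup>+x. h (x \<bullet> \<nu>) * indicator (fund_dom i1 R) x \<partial>lborel)"
      unfolding energy_def nn_integral_completion by (simp add: nDv h_def v_def)
    also have "\<dots> = (\<integral>\<^sup>+x. (\<integral>\<^sup>+s. h ((x + s *\<^sub>R \<nu>) \<bullet> \<nu>) \<partial>lborel) * indicator D0 x \<partial>lborel)"
      by (rule nn_integral_fund_dom) measurable
    also have "\<dots> = (\<integral>\<^sup>+x. (\<integral>\<^sup>+s. h (s + x \<bullet> \<nu>) \<partial>lborel) * indicator D0 x \<partial>lborel)"
      using norm_\<nu> by (simp add: inner_add_left add.commute dot_square_norm)
    also have "\<dots> = (\<integral>\<^sup>+x. (\<integral>\<^sup>+s. h s \<partial>lborel) * indicator D0 x \<partial>lborel)"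
      by (subst nn_integral_lborel_shift) auto
    also have "\<dots> = (\<integral>\<^sup>+s. h s \<partial>lborel)" by (subst nn_integral_cmult) (auto simp: emeasure_D0)
    finally show ?thesis by (simp add: h_def)
  qed
  have en: "energy W i1 R v Dv \<le> ennreal (\<delta> um up)" unfolding e using g(5) by (simp add: g'_def)
  have "H1div i1 R v Dv" unfolding H1div_def
  proof (intro conjI)
    show "periodic_R i1 R v" unfolding periodic_R_def
    proof (intro allI impI)
      fix k x assume "k \<noteq> i1"
      have "(transpose R *v axis k 1) \<bullet> \<nu> = 0"
        unfolding orthogonal_matrix_inner(2)[OF orth] R\<nu> using \<open>k \<noteq> i1\<close> by (simp add: inner_axis_axis)
      then show "v (x + transpose R *v axis k 1) = v x" by (simp add: v_def inner_add_left)
    qed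
    show "weak_grad v Dv"
    proof (rule C1_weak_grad)
      show "((\<lambda>x. v x $ i) has_derivative (\<lambda>h. Dv x $ i \<bullet> h)) (at x)" for x i
      proof -
        have 1: "((\<lambda>x. x \<bullet> \<nu>) has_derivative (\<lambda>h. h \<bullet> \<nu>)) (at x)" by (auto intro!: derivative_eq_intros)
        have 2: "(g has_derivative (\<lambda>h. h *\<^sub>R g' (x \<bullet> \<nu>))) (at (x \<bullet> \<nu>))"
          using gd[of "x \<bullet> \<nu>"] unfolding has_vector_derivative_def .
        from bounded_linear.has_derivative[OF bounded_linear_vec_nth has_derivative_compose[OF 1 2], of i]
        show ?thesis unfolding v_def Dv_def by (rule has_derivative_eq_rhs) (simp add: fun_eq_iff
            inner_commute)
      qed
      show "continuous_on UNIV (\<lambda>x. Dv x $ i)" for i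
        unfolding Dv_def by (simp, intro continuous_intros continuous_on_compose2[OF g'c]) auto
    qed
    show "(\<integral>\<^sup>+x. ennreal ((norm (Dv x))\<^sup>2) * indicator (fund_dom i1 R) x \<partial>lebesgue) < \<infinity>"
    proof -
      have [measurable]: "Dv \<in> borel_measurable borel"
        unfolding Dv_def by (intro borel_measurable_continuous_onI continuous_intros
            continuous_on_compose2[OF g'c]) auto
      have [measurable]: "v \<in> borel_measurable borel" unfolding v_def by measurable
      have "(\<integral>\<^sup>+x. ennreal ((norm (Dv x))\<^sup>2) * indicator (fund_dom i1 R) x \<partial>lebesgue)
          \<le> (\<integral>\<^sup>+x. 2 * (ennreal ((norm (Dv x))\<^sup>2 / 2 + W (v x)) * indicator (fund_dom i1 R) x) \<partial>lebesgue)"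
      proof (rule nn_integral_mono)
        fix x
        have "ennreal ((norm (Dv x))\<^sup>2) \<le> ennreal (2 * ((norm (Dv x))\<^sup>2 / 2 + W (v x)))"
          using W_nonneg[of "v x"] by (intro ennreal_leI) simp
        also have "\<dots> = 2 * ennreal ((norm (Dv x))\<^sup>2 / 2 + W (v x))" using W_nonneg
            by (subst ennreal_mult) auto
        finally show "ennreal ((norm (Dv x))\<^sup>2) * indicator (fund_dom i1 R) x \<le> 2 * (ennreal ((norm (Dv
            x))\<^sup>2 / 2 + W (v x)) * indicator (fund_dom i1 R) x)"
          by (auto simp: indicator_def)
      qed
      also have "\<dots> = 2 * energy W i1 R v Dv"
        unfolding energy_def nn_integral_completion by (rule nn_integral_cmult) measurable
      also have "\<dots> < \<infinity>" using en by (auto simp: ennreal_mult_less_top intro: le_less_trans)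
      finally show ?thesis .
    qed
    show "AE x in lebesgue. (\<Sum>i\<in>UNIV. Dv x $ i $ i) = 0"
    proof (rule AE_I2)
      fix x
      have "(\<Sum>i\<in>UNIV. Dv x $ i $ i) = g' (x \<bullet> \<nu>) \<bullet> \<nu>" by (simp add: Dv_def inner_vec_def)
      also have "\<dots> = 0" using orth_\<nu> by (simp add: g'_def inner_commute)
      finally show "(\<Sum>i\<in>UNIV. Dv x $ i $ i) = 0" .
    qed
  qed
  moreover have "bc i1 R \<nu> v um up"
  proof -
    have "slice_avg i1 R \<nu> v t = g t" for t
    proof -
      have "(t *\<^sub>R \<nu> + transpose R *v (\<chi> k. if k = i1 then 0 else y $ k)) \<bullet> \<nu> = t" for y
        unfolding inner_add_left orthogonal_matrix_inner(2)[OF orth] R\<nu>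
        using norm_\<nu> by (simp add: inner_axis dot_square_norm)
      then have "slice_avg i1 R \<nu> v t = integral\<^sup>L (lebesgue_on (cbox 0 One :: (real^'n) set)) (\<lambda>y. g t)"
        unfolding slice_avg_def v_def by simp
      also have "\<dots> = g t" by (simp add: measure_restrict_space)
      finally show ?thesis .
    qed
    then have "slice_avg i1 R \<nu> v = g" by auto
    \<comment> \<open>The filters in \<open>bc\<close> are finer than \<open>at_top\<close> and
      \<open>at_bot\<close>, so the ordinary limits of \<open>g\<close> imply the essential
      ones.\<close>
    then show ?thesis unfolding bc_def using g(3,4) tendsto_mono[OF inf_le1] by metis
  qed
  ultimately show ?thesis using that en by blast
qed

end

subsection \<open>Curves of finite energy\<close>

lemma calibrates_continuous:
  assumes "calibrates \<Psi> F" shows "isCont \<Psi> z"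
proof -
  obtain r where r: "r > 0" "\<forall>w\<in>ball z r. \<forall>w'\<in>ball z r. \<bar>\<Psi> w - \<Psi> w'\<bar> \<le> (F z + 1) * norm (w - w')"
    using assms unfolding calibrates_def by (meson zero_less_one)
  have "((\<lambda>w. \<Psi> w - \<Psi> z) \<longlongrightarrow> 0) (at z)"
  proof (rule Lim_null_comparison)
    show "\<forall>\<^sub>F w in at z. norm (\<Psi> w - \<Psi> z) \<le> (F z + 1) * norm (w - z)"
      unfolding eventually_at using r by (intro exI[of _ r]) (auto simp: dist_commute)
    have "((\<lambda>w. (F z + 1) * norm (w - z)) \<longlongrightarrow> (F z + 1) * norm (z - z)) (at z)" by (intro tendsto_intros)
    then show "((\<lambda>w. (F z + 1) * norm (w - z)) \<longlongrightarrow> 0) (at z)" by simp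
  qed
  then show ?thesis unfolding isCont_def by (rule LIM_zero_cancel)
qed

lemma clamp_nonexpansive: "\<bar>max r (min s a) - max r (min s b)\<bar> \<le> \<bar>a - b\<bar>" for a b r s :: real
  by (auto simp: max_def min_def abs_if)

lemma scaled_bound: "0 \<le> k \<Longrightarrow> \<bar>a - b\<bar> \<le> n \<Longrightarrow> \<bar>k * a - k * b\<bar> \<le> k * n" for k a b n :: real
  by (metis abs_mult abs_of_nonneg mult_left_mono right_diff_distrib)

lemma le_add_of_abs_diff_le: "\<bar>a - b\<bar> \<le> n \<Longrightarrow> b \<le> a + n" for a b n :: real
  by linarith

context calibrated_potential
begin

text \<open>Compactness inside the ball of radius \<open>M\<close>; outside it \<open>W\<close> is
  1.\<close>

lemma W_pos_away:
  assumes "r > 0"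
  shows "\<exists>c>0. \<forall>z. (\<forall>x\<in>X. r \<le> dist z x) \<longrightarrow> c \<le> W z"
proof (cases "\<exists>z. norm z \<le> M \<and> (\<forall>x\<in>X. r \<le> dist z x)")
  case True
  define K where "K = cball 0 M \<inter> (\<Inter>x\<in>X. {z. r \<le> dist z x})"
  have "compact K" unfolding K_def
    by (intro compact_Int_closed compact_cball closed_INT ballI closed_Collect_le continuous_intros)
  moreover have "K \<noteq> {}" using True by (auto simp: K_def)
  ultimately obtain z0 where z0: "z0 \<in> K" "\<And>z. z \<in> K \<Longrightarrow> W z0 \<le> W z"
    using continuous_attains_inf[of K W] continuous_on_subset[OF W_cont] by (metis subset_UNIV)
  have "z0 \<notin> X" using z0(1) assms by (auto simp: K_def)
  then have "W z0 > 0" using W_zero W_nonneg[of z0] by (auto simp: less_le)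
  moreover have "min (W z0) 1 \<le> W z" if "\<forall>x\<in>X. r \<le> dist z x" for z
    using z0(2)[of z] W_far[of z] that by (cases "norm z \<le> M") (auto simp: K_def)
  ultimately show ?thesis by (intro exI[of _ "min (W z0) 1"]) auto
next
  case False
  then have "1 \<le> W z" if "\<forall>x\<in>X. r \<le> dist z x" for z
  proof -
    have "\<not> norm z \<le> M" using False that by blast
    then show ?thesis using W_far[of z] by simp
  qed
  then show ?thesis by (intro exI[of _ 1]) auto
qed

lemma separation: "\<exists>r>0. \<forall>x\<in>X. \<forall>y\<in>X. x \<noteq> y \<longrightarrow> 4 * r \<le> dist x y"
proof -
  define S where "S = (\<lambda>(x, y). dist x y) ` {(x, y). x \<in> X \<and> y \<in> X \<and> x \<noteq> y}"
  have "finite {(x, y). x \<in> X \<and> y \<in> X \<and> x \<noteq> y}"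
    by (rule finite_subset[of _ "X \<times> X"]) (auto simp: finX)
  then have "finite S" unfolding S_def by (rule finite_imageI)
  then have "\<exists>r>0. \<forall>s\<in>S. r \<le> s"
    by (intro exI[of _ "Min (insert 1 S)"]) (auto simp: S_def)
  then obtain r where "r > 0" "\<forall>s\<in>S. r \<le> s" by blast
  then show ?thesis by (intro exI[of _ "r / 4"]) (auto simp: S_def)
qed

lemma X_norm: "x \<in> X \<Longrightarrow> norm x < M"
  using W_zero W_far[of x] by force

text \<open>The slope 1 occurs only where \<open>W\<close> is 1, and there the admissible slope is
  \<open>sqrt 2\<close>. The function bounds excursions of a curve by its energy.\<close>

lemma barrier_calibrates: "calibrates (\<lambda>z. max 0 (norm z - M)) (\<lambda>z. sqrt (2 * W z))"
  unfolding calibrates_iff_slope_le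
proof
  fix z
  show "slope_le z (sqrt (2 * W z)) (\<lambda>z. max 0 (norm z - M))"
  proof (cases "norm z < M")
    case True
    have "max 0 (norm w - M) = 0" if "w \<in> ball z (M - norm z)" for w
      using that norm_triangle_sub[of w z] by (simp add: dist_norm norm_minus_commute)
    then show ?thesis using True W_nonneg by (intro slope_le_local_const[of _ "M - norm z"]) auto
  next
    case False
    have "slope_le z 1 (\<lambda>z. max 0 (norm z - M))"
    proof (rule slope_le_lipschitz)
      fix w w' :: "real^'n"
      show "\<bar>max 0 (norm w - M) - max 0 (norm w' - M)\<bar> \<le> 1 * norm (w - w')"
        using norm_triangle_ineq3[of w w'] by linarith
    qed
    then show ?thesis by (rule slope_le_mono) (use False W_far in simp)
  qed
qed

text \<open>Makes the passage from distance \<open>r\<close> to distance \<open>2 * r\<close> from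
  \<open>x\<close> cost at least \<open>sqrt (2 * c) * r\<close>. The function varies only at
  distances between these; the other vertices, at least \<open>4 * r\<close> from \<open>x\<close>,
  are then at least \<open>2 * r\<close> away, so that \<open>W\<close> is at least
  \<open>c\<close>.\<close>

lemma annulus_calibrates:
  assumes x: "x \<in> X" and r: "r > 0" "\<And>x y. x \<in> X \<Longrightarrow> y \<in> X \<Longrightarrow> x \<noteq> y \<Longrightarrow> 4 * r \<le> dist x y"
    and c: "0 < c" "\<And>z. (\<forall>x\<in>X. r \<le> dist z x) \<Longrightarrow> c \<le> W z"
  shows "calibrates (\<lambda>z. sqrt (2 * c) * max r (min (2 * r) (dist z x))) (\<lambda>z. sqrt (2 * W z))"
  unfolding calibrates_iff_slope_le
proof
  fix z
  consider "dist z x < r" | "dist z x > 2 * r" | "r \<le> dist z x" "dist z x \<le> 2 * r" by linarith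
  then show "slope_le z (sqrt (2 * W z)) (\<lambda>z. sqrt (2 * c) * max r (min (2 * r) (dist z x)))"
  proof cases
    case 1
    then have pos: "0 < r - dist z x" by simp
    have "sqrt (2 * c) * max r (min (2 * r) (dist w x)) = sqrt (2 * c) * r"
        if "w \<in> ball z (r - dist z x)" for w
    proof -
      have "dist z w < r - dist z x" using that by (simp only: mem_ball)
      then have "dist w x < r" using dist_triangle[of w x z] dist_commute[of w z] by linarith
      then have "max r (min (2 * r) (dist w x)) = r" using r by linarith
      then show ?thesis by (simp only:)
    qed
    then show ?thesis using W_nonneg by (intro slope_le_local_const[OF _ pos]) (simp, blast)
  next
    case 2
    then have pos: "0 < dist z x - 2 * r" by simp
    have "sqrt (2 * c) * max r (min (2 * r) (dist w x)) = sqrt (2 * c) * (2 * r)"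
        if "w \<in> ball z (dist z x - 2 * r)" for w
    proof -
      have "dist z w < dist z x - 2 * r" using that by (simp only: mem_ball)
      then have "dist w x > 2 * r" using dist_triangle[of z x w] by linarith
      then have "max r (min (2 * r) (dist w x)) = 2 * r" using r by linarith
      then show ?thesis by (simp only:)
    qed
    then show ?thesis using W_nonneg by (intro slope_le_local_const[OF _ pos]) (simp, blast)
  next
    case 3
    have "r \<le> dist z y" if "y \<in> X" for y
    proof (cases "y = x")
      case False
      then have "4 * r \<le> dist x y" using r(2)[OF x that] by blast
      then show ?thesis using dist_triangle[of x y z] dist_commute[of x z] 3 r(1) by linarith
    qed (use 3 in simp)
    then have "c \<le> W z" using c by blast
    then have le: "sqrt (2 * c) \<le> sqrt (2 * W z)" by simp
    have "slope_le z (sqrt (2 * c)) (\<lambda>z. sqrt (2 * c) * max r (min (2 * r) (dist z x)))"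
    proof (rule slope_le_lipschitz)
      fix w w' :: "real^'n"
      have "\<bar>max r (min (2 * r) (dist w x)) - max r (min (2 * r) (dist w' x))\<bar> \<le> norm (w - w')"
        using order_trans[OF clamp_nonexpansive[of r "2 * r"] abs_dist_diff_le[of w x w']]
        by (simp only: dist_norm[of w w', symmetric] dist_commute[of w' x])
      then show "\<bar>sqrt (2 * c) * max r (min (2 * r) (dist w x)) - sqrt (2 * c) * max r (min (2 * r)
          (dist w' x))\<bar> \<le> sqrt (2 * c) * norm (w - w')"
        by (rule scaled_bound[rotated]) (use c in simp)
    qed
    then show ?thesis using le by (rule slope_le_mono)
  qed
qed

end

section \<open>Limits and bounds along a single curve\<close>

locale finite_energy_curve = calibrated_potential X \<delta> W \<Psi> M
  for X :: "(real^'n) set" and \<delta> W \<Psi> M +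
  fixes \<gamma> q :: "real \<Rightarrow> real^'n"
  assumes curve: "\<And>a b. curve_on a b \<gamma> q"
    and q_meas [measurable]: "q \<in> borel_measurable borel"
    and fin: "(\<integral>\<^sup>+t. ennreal ((norm (q t))\<^sup>2 / 2 + W (\<gamma> t)) \<partial>lborel) < \<infinity>"
begin

definition en :: "real \<Rightarrow> real" where "en t = (norm (q t))\<^sup>2 / 2 + W (\<gamma> t)"

definition Tot :: real where "Tot = enn2real (\<integral>\<^sup>+t. ennreal (en t) \<partial>lborel)"

lemma \<gamma>_cont: "continuous_on UNIV \<gamma>"
proof -
  have "isCont \<gamma> t" for t
    using curve_on_continuous[OF curve[of "t - 1" "t + 1"]] by (rule continuous_on_interior) auto
  then show ?thesis by (simp add: continuous_at_imp_continuous_on)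
qed

lemma \<gamma>_meas [measurable]: "\<gamma> \<in> borel_measurable borel"
  using \<gamma>_cont by (rule borel_measurable_continuous_onI)

lemma en_nonneg: "0 \<le> en t" using W_nonneg by (simp add: en_def)

lemma en_meas [measurable]: "en \<in> borel_measurable borel" unfolding en_def by measurable

lemma en_integrable: "integrable lborel en"
  using fin en_nonneg by (intro integrableI_nonneg) (auto simp: en_def)

lemma Tot_eq: "integral\<^sup>L lborel en = Tot" "ennreal Tot = (\<integral>\<^sup>+t. ennreal ((norm (q t))\<^sup>2 / 2
    + W (\<gamma> t)) \<partial>lborel)"
proof -
  show "integral\<^sup>L lborel en = Tot" unfolding Tot_def using en_nonneg by (intro integral_eq_nn_integral) auto
  show "ennreal Tot = (\<integral>\<^sup>+t. ennreal ((norm (q t))\<^sup>2 / 2 + W (\<gamma> t)) \<partial>lborel)"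
    unfolding Tot_def en_def using fin by simp
qed

lemma Tot_nonneg: "0 \<le> Tot" by (simp add: Tot_def)

lemma q_square_integrable: "integrable lborel (\<lambda>t. (norm (q t))\<^sup>2)"
proof (rule Bochner_Integration.integrable_bound[OF integrable_mult_right[OF en_integrable, of 2]])
  show "AE t in lborel. norm ((norm (q t))\<^sup>2) \<le> norm (2 * en t)"
    using W_nonneg by (intro AE_I2) (auto simp: en_def abs_of_nonneg)
qed measurable

lemma calibration_step:
  assumes cal: "calibrates \<Phi> (\<lambda>z. sqrt (2 * W z))" and ab: "a \<le> b"
  shows "\<bar>\<Phi> (\<gamma> b) - \<Phi> (\<gamma> a)\<bar> \<le> integral\<^sup>L lborel (\<lambda>t. indicator {a..b} t * en t)"
proof -
  have si: "set_integrable lborel {a..b} en"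
    unfolding set_integrable_def using en_integrable integrable_mult_indicator[of "{a..b}" lborel en] by simp
  have sq: "set_integrable lborel {a..b} (\<lambda>t. (norm (q t))\<^sup>2)"
    unfolding set_integrable_def using q_square_integrable integrable_mult_indicator[of "{a..b}" lborel
        "\<lambda>t. (norm (q t))\<^sup>2"] by simp
  have "\<bar>\<Phi> (\<gamma> b) - \<Phi> (\<gamma> a)\<bar> \<le> integral {a..b} (\<lambda>t. (norm (q t))\<^sup>2 / 2 + W (\<gamma> t))"
    by (rule calibration_energy_bound[OF ab curve W_cont cal W_nonneg
        set_borel_integral_eq_integral(1)[OF sq]])
  also have "\<dots> = integral\<^sup>L lborel (\<lambda>t. indicator {a..b} t * en t)"
    using set_borel_integral_eq_integral(2)[OF si] unfolding set_lebesgue_integral_def en_def[symmetric]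
        by simp
  finally show ?thesis .
qed

lemma calibration_total:
  assumes cal: "calibrates \<Phi> (\<lambda>z. sqrt (2 * W z))" and ab: "a \<le> b"
  shows "\<bar>\<Phi> (\<gamma> b) - \<Phi> (\<gamma> a)\<bar> \<le> Tot"
proof -
  have "integral\<^sup>L lborel (\<lambda>t. indicator {a..b} t * en t) \<le> integral\<^sup>L lborel en"
    using en_integrable integrable_mult_indicator[of "{a..b}" lborel en] en_nonneg
    by (intro integral_mono) (auto simp: indicator_def)
  then show ?thesis using calibration_step[OF assms] Tot_eq(1) by linarith
qed

lemma tail_small:
  assumes "e > 0"
  obtains T where "\<And>a b. T \<le> a \<Longrightarrow> a \<le> b \<Longrightarrow> integral\<^sup>L lborel (\<lambda>t. indicator {a..b} t * en t) < e"
proof -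
  have "(\<lambda>n. integral\<^sup>L lborel (\<lambda>t. indicator {real n..} t * en t)) \<longlonglongrightarrow> integral\<^sup>L lborel (\<lambda>t::real. 0)"
  proof (rule integral_dominated_convergence[where w=en])
    show "AE t in lborel. (\<lambda>n. indicator {real n..} t * en t) \<longlonglongrightarrow> 0"
    proof (rule AE_I2)
      fix t :: real
      obtain N :: nat where "t < real N" using reals_Archimedean2 by blast
      then have "\<forall>\<^sub>F n in sequentially. indicator {real n..} t * en t = 0"
        unfolding eventually_sequentially by (intro exI[of _ N]) (auto simp: indicator_def)
      then show "(\<lambda>n. indicator {real n..} t * en t) \<longlonglongrightarrow> 0" by (rule tendsto_eventually)
    qed
    show "AE t in lborel. norm (indicator {real n..} t * en t) \<le> en t" for n
      using en_nonneg by (intro AE_I2) (auto simp: indicator_def)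
    show "(\<lambda>t. indicator {real n..} t * en t) \<in> borel_measurable lborel" for n by measurable
  qed (simp_all add: en_integrable)
  then have "\<forall>\<^sub>F n in sequentially. integral\<^sup>L lborel (\<lambda>t. indicator {real n..} t * en t) < e"
    using assms by (intro order_tendstoD(2)[of _ 0]) auto
  then obtain n where n: "integral\<^sup>L lborel (\<lambda>t. indicator {real n..} t * en t) < e"
    by (auto simp: eventually_sequentially)
  show ?thesis
  proof (rule that[of "real n"])
    fix a b assume ab: "real n \<le> a" "a \<le> b"
    have "integral\<^sup>L lborel (\<lambda>t. indicator {a..b} t * en t) \<le> integral\<^sup>L lborel (\<lambda>t. indicator {real
        n..} t * en t)"
      using en_integrable integrable_mult_indicator[of "{a..b}" lborel en] integrable_mult_indicator[of
          "{real n..}" lborel en] en_nonneg ab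
      by (intro integral_mono) (auto simp: indicator_def)
    then show "integral\<^sup>L lborel (\<lambda>t. indicator {a..b} t * en t) < e" using n by linarith
  qed
qed

lemma W_small_late:
  assumes "c > 0" shows "\<exists>t\<ge>T. W (\<gamma> t) < c"
proof (rule ccontr)
  assume "\<not> (\<exists>t\<ge>T. W (\<gamma> t) < c)"
  then have le: "c \<le> en t" if "t \<ge> T" for t using that by (auto simp: en_def not_less intro: order_trans)
  have "ennreal c * ennreal (real n) \<le> ennreal Tot" for n :: nat
  proof -
    have "ennreal c * ennreal (real n) = (\<integral>\<^sup>+t. ennreal c * indicator {T..T + real n} t \<partial>lborel)"
      by (subst nn_integral_cmult) auto
    also have "\<dots> \<le> (\<integral>\<^sup>+t. ennreal (en t) \<partial>lborel)"
      using le by (intro nn_integral_mono) (auto simp: indicator_def intro!: ennreal_leI)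
    finally show ?thesis unfolding Tot_eq(2) by (simp add: en_def)
  qed
  then have "c * real n \<le> Tot" for n :: nat
    using assms Tot_nonneg by (simp add: ennreal_mult[symmetric])
  moreover obtain n :: nat where "Tot / c < real n" using reals_Archimedean2 by blast
  ultimately show False using assms by (simp add: field_simps not_less[symmetric])
qed

text \<open>Finite energy forces \<open>W\<close> to be small at arbitrarily late times, hence the
  curve to be near some vertex. Once the remaining energy is below the cost of crossing the annulus,
  the curve stays within \<open>2 * r\<close> of it. The vertex is the same for all smaller
  \<open>r\<close>, since distinct vertices are \<open>4 * r0\<close> apart.\<close>

lemma converges_at_top: "\<exists>l\<in>X. (\<gamma> \<longlongrightarrow> l) at_top"
proof -
  obtain r0 where r0: "r0 > 0" "\<And>x y. x \<in> X \<Longrightarrow> y \<in> X \<Longrightarrow> x \<noteq> y \<Longrightarrow> 4 * r0 \<le> dist x y" using separation by blast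
  have near: "\<exists>x\<in>X. \<exists>T. \<forall>t\<ge>T. dist (\<gamma> t) x < 2 * r" if r: "0 < r" "r \<le> r0" for r
  proof -
    obtain c where c: "0 < c" "\<And>z. (\<forall>x\<in>X. r \<le> dist z x) \<Longrightarrow> c \<le> W z" using W_pos_away[OF r(1)] by blast
    have "sqrt (2 * c) * r > 0" using c r by simp
    then obtain T where T: "\<And>a b. T \<le> a \<Longrightarrow> a \<le> b \<Longrightarrow> integral\<^sup>L lborel (\<lambda>t. indicator {a..b} t * en t) <
        sqrt (2 * c) * r"
      using tail_small by blast
    obtain t1 where t1: "t1 \<ge> T" "W (\<gamma> t1) < c" using W_small_late[OF c(1)] by blast
    obtain x where x: "x \<in> X" "dist (\<gamma> t1) x < r" using c(2)[of "\<gamma> t1"] t1 by (meson not_le)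
    have sep: "4 * r \<le> dist x y" if "x \<in> X" "y \<in> X" "x \<noteq> y" for x y using r0(2)[OF that] r by linarith
    define \<kappa> where "\<kappa> z = sqrt (2 * c) * max r (min (2 * r) (dist z x))" for z
    have cal: "calibrates \<kappa> (\<lambda>z. sqrt (2 * W z))"
      unfolding \<kappa>_def[abs_def] by (rule annulus_calibrates[OF x(1) r(1) _ c(1)]) (use sep c in auto)
    have "dist (\<gamma> t) x < 2 * r" if t: "t \<ge> t1" for t
    proof (rule ccontr)
      assume "\<not> dist (\<gamma> t) x < 2 * r"
      then have "\<kappa> (\<gamma> t) = sqrt (2 * c) * (2 * r)" "\<kappa> (\<gamma> t1) = sqrt (2 * c) * r" using x(2) r
          by (auto simp: \<kappa>_def)
      then have "\<kappa> (\<gamma> t) - \<kappa> (\<gamma> t1) = sqrt (2 * c) * r" by simp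
      then show False using calibration_step[OF cal t] T[OF t1(1) t] by linarith
    qed
    then show ?thesis using x by blast
  qed
  obtain l T0 where l: "l \<in> X" "\<And>t. t \<ge> T0 \<Longrightarrow> dist (\<gamma> t) l < 2 * r0" using near[OF r0(1)] by blast
  have "(\<gamma> \<longlongrightarrow> l) at_top"
  proof (rule tendstoI)
    fix e :: real assume e: "e > 0"
    define r where "r = min r0 (e / 2)"
    have r: "0 < r" "r \<le> r0" "2 * r \<le> e" using e r0 by (auto simp: r_def)
    obtain x T where x: "x \<in> X" "\<And>t. t \<ge> T \<Longrightarrow> dist (\<gamma> t) x < 2 * r" using near[OF r(1,2)] by blast
    have "x = l"
    proof (rule ccontr)
      assume "x \<noteq> l"
      have "dist x l \<le> dist (\<gamma> (max T T0)) x + dist (\<gamma> (max T T0)) l" by (metis dist_commute dist_triangle)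
      then show False using r0(2)[OF x(1) l(1) \<open>x \<noteq> l\<close>] x(2)[of "max T T0"] l(2)[of "max T T0"] r by linarith
    qed
    then show "\<forall>\<^sub>F t in at_top. dist (\<gamma> t) l < e"
      unfolding eventually_at_top_linorder using x(2) r(3) by (intro exI[of _ T]) (auto intro: less_le_trans)
  qed
  then show ?thesis using l by blast
qed

lemma reversed: "finite_energy_curve X \<delta> W \<Psi> M (\<lambda>t. \<gamma> (- t)) (\<lambda>t. - q (- t))"
proof (unfold_locales)
  show "curve_on a b (\<lambda>t. \<gamma> (- t)) (\<lambda>t. - q (- t))" for a b
    unfolding curve_on_def
  proof (intro conjI allI impI)
    have "q absolutely_integrable_on {- b..- a}" using curve[of "- b" "- a"] by (simp add: curve_on_def)
    then have "(\<lambda>t. q (- t)) absolutely_integrable_on {a..b}"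
        using absolutely_integrable_reflect_real[where f=q and a="- b" and b="- a"] by simp
    then show "(\<lambda>t. - q (- t)) absolutely_integrable_on {a..b}"
      by (simp add: set_integrable_def)
    fix s t assume st: "a \<le> s \<and> s \<le> t \<and> t \<le> b"
    have "(q has_integral (\<gamma> (- s) - \<gamma> (- t))) {- t..- s}"
      using curve[of "- t" "- s"] st unfolding curve_on_def by auto
    then have "((\<lambda>t. q (- t)) has_integral (\<gamma> (- s) - \<gamma> (- t))) {s..t}"
        by (subst has_integral_reflect_real[symmetric]) simp
    from has_integral_neg[OF this] show "((\<lambda>t. - q (- t)) has_integral (\<gamma> (- t) - \<gamma> (- s))) {s..t}" by simp
  qed
  show "(\<lambda>t. - q (- t)) \<in> borel_measurable borel" by measurable
  have "(\<integral>\<^sup>+t. ennreal ((norm (q t))\<^sup>2 / 2 + W (\<gamma> t)) \<partial>lborel) = (\<integral>\<^sup>+t. ennreal ((norm (q t))\<^sup>2 / 2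
      + W (\<gamma> t)) \<partial>(distr lborel borel uminus))"
    by (simp add: lborel_distr_uminus)
  also have "\<dots> = (\<integral>\<^sup>+t. ennreal ((norm (- q (- t)))\<^sup>2 / 2 + W (\<gamma> (- t))) \<partial>lborel)"
    by (subst nn_integral_distr) auto
  finally show "(\<integral>\<^sup>+t. ennreal ((norm (- q (- t)))\<^sup>2 / 2 + W (\<gamma> (- t))) \<partial>lborel) < \<infinity>" using fin by simp
qed

lemma converges_at_bot: "\<exists>l\<in>X. (\<gamma> \<longlongrightarrow> l) at_bot"
proof -
  interpret rev: finite_energy_curve X \<delta> W \<Psi> M "\<lambda>t. \<gamma> (- t)" "\<lambda>t. - q (- t)" by (rule reversed)
  show ?thesis using rev.converges_at_top by (simp add: filterlim_at_bot_mirror)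
qed

text \<open>The barrier vanishes at the limit vertex, so its value at any time is at most the
  energy. This supplies the dominating function when limits are taken under slice integrals.\<close>

lemma bounded_by_energy: "norm (\<gamma> t) \<le> M + Tot"
proof -
  obtain l where l: "l \<in> X" "(\<gamma> \<longlongrightarrow> l) at_top" using converges_at_top by blast
  have "((\<lambda>s. max 0 (norm (\<gamma> s) - M) + Tot) \<longlongrightarrow> max 0 (norm l - M) + Tot) at_top" by (intro tendsto_intros l)
  moreover have "\<forall>\<^sub>F s in at_top. max 0 (norm (\<gamma> t) - M) \<le> max 0 (norm (\<gamma> s) - M) + Tot"
    using eventually_ge_at_top[of t]
  proof eventually_elim
    case (elim s) show ?case by (rule le_add_of_abs_diff_le, rule calibration_total[OF
        barrier_calibrates elim])
  qed
  ultimately have "max 0 (norm (\<gamma> t) - M) \<le> max 0 (norm l - M) + Tot" by (intro tendsto_lowerbound) auto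
  moreover have m0: "max 0 (norm l - M) = 0" using X_norm[OF l(1)] by (simp add: max_def)
  ultimately have "max 0 (norm (\<gamma> t) - M) \<le> Tot" unfolding m0 by simp
  then have "norm (\<gamma> t) - M \<le> Tot" by (rule order_trans[OF max.cobounded2])
  then show ?thesis by (simp add: add.commute diff_le_eq)
qed

lemma energy_ge:
  assumes "(\<gamma> \<longlongrightarrow> lp) at_top" "(\<gamma> \<longlongrightarrow> lm) at_bot" "lp \<in> X" "lm \<in> X"
  shows "\<delta> lm lp \<le> Tot"
proof -
  have cont: "isCont (\<Psi> lm) z" for z by (rule calibrates_continuous[OF \<Psi>_cal[OF assms(4)]])
  have a: "filterlim (\<lambda>n::nat. real n) at_top sequentially" by (rule filterlim_real_sequentially)
  have b: "filterlim (\<lambda>n::nat. - real n) at_bot sequentially" using a by (simp add: filterlim_uminus_at_top)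
  have "(\<lambda>n. \<bar>\<Psi> lm (\<gamma> (real n)) - \<Psi> lm (\<gamma> (- real n))\<bar>) \<longlonglongrightarrow> \<bar>\<Psi> lm lp - \<Psi> lm lm\<bar>"
    by (intro tendsto_intros isCont_tendsto_compose[OF cont] filterlim_compose[OF assms(1) a]
        filterlim_compose[OF assms(2) b])
  then have "\<bar>\<Psi> lm lp - \<Psi> lm lm\<bar> \<le> Tot"
    by (rule LIMSEQ_le_const2) (auto intro!: exI[of _ 0] calibration_total[OF \<Psi>_cal[OF assms(4)]])
  then show ?thesis using \<Psi>_vertex[OF assms(4,3)] \<Psi>_vertex[OF assms(4,4)] \<delta>_props[OF assms(4,4)] by simp
qed

end

subsection \<open>Rigidity of fields of low energy\<close>

lemma borel_measurable_vec_lambda [measurable (raw)]: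
  fixes f :: "'n::finite \<Rightarrow> 'a \<Rightarrow> 'b::euclidean_space"
  assumes "\<And>i. f i \<in> borel_measurable M"
  shows "(\<lambda>x. \<chi> i. f i x) \<in> borel_measurable M"
proof (subst borel_measurable_euclidean_space, intro ballI)
  fix b :: "'b^'n" assume "b \<in> Basis"
  then obtain i e where b: "b = axis i e" by (auto simp: Basis_vec_def)
  show "(\<lambda>x. (\<chi> i. f i x) \<bullet> b) \<in> borel_measurable M"
    using assms[of i] by (simp add: b inner_axis)
qed

lemma ex_borel_representative:
  fixes f :: "'a::euclidean_space \<Rightarrow> real^'n"
  assumes "\<And>i. (\<lambda>x. f x $ i) \<in> borel_measurable lebesgue"
  shows "\<exists>g\<in>borel_measurable borel. AE x in lborel. f x = g x"
proof -
  have "\<exists>g'\<in>borel_measurable lborel. AE x in lborel. f x $ i = g' x" for i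
    using assms by (rule completion_ex_borel_measurable_real)
  then obtain g where g: "\<And>i. g i \<in> borel_measurable lborel" "\<And>i. AE x in lborel. f x $ i = g i x" by metis
  have [measurable]: "g i \<in> borel_measurable borel" for i using g(1)[of i] by simp
  have "(\<lambda>x. \<chi> i. g i x) \<in> borel_measurable borel" by measurable
  moreover have "AE x in lborel. \<forall>i. f x $ i = g i x" using g(2) by (simp add: AE_all_countable)
  then have "AE x in lborel. f x = (\<chi> i. g i x)" by eventually_elim (simp add: vec_eq_iff)
  ultimately show ?thesis by (intro bexI[of _ "\<lambda>x. \<chi> i. g i x"])
qed

text \<open>On a bounded box |b| <= 1 + b^2 reduces local integrability to the local square
  integrability of \<open>f\<close>.\<close>

lemma L2_loc_representative_integrable:
  fixes f b :: "real^'n \<Rightarrow> real"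
  assumes "L2_loc f" and [measurable]: "b \<in> borel_measurable borel" and ae: "AE x in lborel. f x = b x"
  shows "integrable lborel (\<lambda>x. indicator (cball 0 r) x * b x)"
proof -
  obtain c where c: "cball (0::real^'n) r \<subseteq> cbox (- c) c"
      using bounded_subset_cbox_symmetric[OF bounded_cball] by blast
  have fm: "f \<in> borel_measurable lebesgue" using assms unfolding L2_loc_def by auto
  have "integrable (lebesgue_on (cbox (- c) c)) (\<lambda>x. (f x)\<^sup>2)" using assms(1) unfolding L2_loc_def by auto
  then have 1: "integrable lebesgue (\<lambda>x. indicator (cbox (- c) c) x *\<^sub>R (f x)\<^sup>2)"
    by (subst (asm) integrable_restrict_space) auto
  have "integrable lebesgue (\<lambda>x. indicator (cbox (- c) c) x *\<^sub>R (b x)\<^sup>2)"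
  proof (rule integrable_cong_AE_imp[OF 1])
    show "(\<lambda>x. indicator (cbox (- c) c) x *\<^sub>R (b x)\<^sup>2) \<in> borel_measurable lebesgue"
        by (intro measurable_completion) measurable
    show "AE x in lebesgue. indicator (cbox (- c) c) x *\<^sub>R (f x)\<^sup>2 = indicator (cbox (- c) c) x *\<^sub>R (b x)\<^sup>2"
      using AE_completion[OF ae] by eventually_elim simp
  qed
  then have 2: "integrable lborel (\<lambda>x. indicator (cbox (- c) c) x *\<^sub>R (b x)\<^sup>2)"
    by (subst (asm) integrable_completion) measurable
  have 3: "integrable lborel (\<lambda>x. indicator (cbox (- c) c) x + indicator (cbox (- c) c) x *\<^sub>R (b x)\<^sup>2)"
    using emeasure_bounded_finite[OF bounded_cbox, of "- c" c]
    by (intro Bochner_Integration.integrable_add 2 integrable_real_indicator) auto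
  show ?thesis
  proof (rule Bochner_Integration.integrable_bound[OF 3])
    show "AE x in lborel. norm (indicator (cball 0 r) x * b x) \<le> norm (indicator (cbox (- c) c) x
        + indicator (cbox (- c) c) x *\<^sub>R (b x)\<^sup>2)"
    proof (rule AE_I2)
      fix x
      have "\<bar>b x\<bar> \<le> 1 + (b x)\<^sup>2"
      proof -
        have "0 \<le> (\<bar>b x\<bar> - 1)\<^sup>2" by simp
        then have "2 * \<bar>b x\<bar> \<le> 1 + (b x)\<^sup>2" by (simp add: power2_diff)
        then show ?thesis by linarith
      qed
      then show "norm (indicator (cball 0 r) x * b x) \<le> norm (indicator (cbox (- c) c) x
          + indicator (cbox (- c) c) x *\<^sub>R (b x)\<^sup>2)"
        using c by (auto simp: indicator_def)
    qed
  qed measurable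
qed

lemma AE_lborel_orthogonal:
  fixes A :: "real^'n^'n"
  assumes A: "orthogonal_matrix A" and P: "AE x in lborel. P x"
  shows "AE x in lborel. P (A *v x)"
proof -
  obtain N where N: "N \<in> null_sets lborel" "{x. \<not> P x} \<subseteq> N" using P by (auto simp: eventually_ae_filter)
  have [measurable]: "N \<in> sets borel" using N by auto
  have "emeasure lborel ((\<lambda>x. A *v x) -` N) = emeasure (distr lborel borel (\<lambda>x. A *v x)) N"
    by (subst emeasure_distr) auto
  then have "(\<lambda>x. A *v x) -` N \<in> null_sets lborel"
    using N(1) measurable_sets[of "\<lambda>x. A *v x" borel borel N] by (auto simp: distr_orthogonal_lborel[OF
        A] null_sets_def)
  then show ?thesis using N(2) by (auto simp: eventually_ae_filter intro!: bexI[of _ "(\<lambda>x. A *v x) -` N"])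
qed

text \<open>An essential limit is realised along a sequence of times that satisfy \<open>P\<close>:
  a property eventual for \<open>F\<close> holds on a Borel set of positive measure, which no null
  set can cover. Slice averages are expressed through lines only at almost every time, hence the
  need for such times.\<close>

lemma ex_sequence_inf_ae_filter:
  fixes f :: "real \<Rightarrow> 'b::metric_space"
  assumes lim: "(f \<longlongrightarrow> l) (inf F (ae_filter lborel))" and P: "AE t in lborel. P t"
    and S: "\<And>n. eventually (\<lambda>t. t \<in> S n) F" "\<And>n Q. eventually Q F \<Longrightarrow> \<exists>A. A \<in> sets lborel
        \<and> emeasure lborel A > 0 \<and> (\<forall>t\<in>A. Q t)"
  shows "\<exists>t::nat \<Rightarrow> real. (\<forall>n. P (t n) \<and> t n \<in> S n) \<and> (\<lambda>n. f (t n)) \<longlonglongrightarrow> l"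
proof -
  have "\<exists>t. P t \<and> t \<in> S n \<and> dist (f t) l < 1 / (real n + 1)" for n
  proof -
    have "eventually (\<lambda>t. dist (f t) l < 1 / (real n + 1)) (inf F (ae_filter lborel))"
      using lim by (rule tendstoD) simp
    then obtain Q1 Q2 where Q: "eventually Q1 F" "AE t in lborel. Q2 t" "\<And>t. Q1 t \<Longrightarrow> Q2 t
        \<Longrightarrow> dist (f t) l < 1 / (real n + 1)"
      unfolding eventually_inf by blast
    have "eventually (\<lambda>t. Q1 t \<and> t \<in> S n) F" using Q(1) S(1) by (rule eventually_conj)
    then obtain A where A: "A \<in> sets lborel" "emeasure lborel A > 0" "\<And>t. t \<in> A \<Longrightarrow> Q1 t \<and> t \<in> S n"
        using S(2) by blast
    have "AE t in lborel. P t \<and> Q2 t" using P Q(2) by eventually_elim simp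
    then obtain N where N: "N \<in> null_sets lborel" "{t. \<not> (P t \<and> Q2 t)} \<subseteq> N"
        by (auto simp: eventually_ae_filter)
    have "\<not> A \<subseteq> N"
    proof
      assume "A \<subseteq> N"
      then have "emeasure lborel A \<le> emeasure lborel N" using N(1) by (intro emeasure_mono) auto
      then show False using A(2) null_setsD1[OF N(1)] by simp
    qed
    then obtain t where "t \<in> A" "t \<notin> N" by blast
    then show ?thesis using N(2) A(3)[of t] Q(3)[of t] by blast
  qed
  then obtain t where t: "\<And>n. P (t n) \<and> t n \<in> S n \<and> dist (f (t n)) l < 1 / (real n + 1)" by metis
  have "(\<lambda>n. f (t n)) \<longlonglongrightarrow> l"
  proof (rule metric_tendsto_imp_tendsto)
    show "(\<lambda>n. 1 / (real n + 1)) \<longlonglongrightarrow> 0" by real_asymp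
    show "\<forall>\<^sub>F n in sequentially. dist (f (t n)) l \<le> dist (1 / (real n + 1)) 0"
      using t by (intro always_eventually) (auto intro: less_imp_le)
  qed
  then show ?thesis using t by blast
qed

section \<open>Restriction of the field to almost every line\<close>

text \<open>The Borel versions \<open>ub\<close> and \<open>Db\<close> agree with \<open>u\<close>
  and \<open>Du\<close> off the Borel null set \<open>N\<close>; measurability on product spaces,
  and with it every exchange of \<open>almost every\<close> by Fubini, rests on them. Minimality
  enters only through the energy bound \<open>E\<close>.\<close>

locale representative = transition X \<delta> W \<Psi> M i1 R \<nu> um up
  for X :: "(real^'n) set" and \<delta> W \<Psi> M and i1 :: "'n::finite" and R :: "real^'n^'n" and \<nu> um up +
  fixes u ub :: "real^'n \<Rightarrow> real^'n" and Du Db :: "real^'n \<Rightarrow> real^'n^'n" and N :: "(real^'n) set"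
  assumes H: "H1div i1 R u Du" and BC: "bc i1 R \<nu> u um up" and E: "energy W i1 R u Du \<le> ennreal (\<delta> um up)"
    and ub_meas [measurable]: "ub \<in> borel_measurable borel"
    and Db_meas [measurable]: "\<And>i. (\<lambda>x. Db x $ i) \<in> borel_measurable borel"
    and N: "N \<in> null_sets lborel" and uN: "\<And>x. x \<notin> N \<Longrightarrow> u x = ub x" and DN: "\<And>x. x \<notin> N \<Longrightarrow> Du x = Db x"
begin

lemma N_sets [measurable]: "N \<in> sets borel" using N by auto

lemma AE_N: "AE x in lborel. x \<notin> N" using N by (rule AE_not_in)

lemma wg: "weak_grad u Du" using H by (simp add: H1div_def)

lemma loc_u: "integrable lborel (\<lambda>x. indicator (cball 0 r) x * ub x $ i)"
proof (rule L2_loc_representative_integrable)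
  show "L2_loc (\<lambda>x. u x $ i)" using wg by (simp add: weak_grad_def)
  show "AE x in lborel. u x $ i = ub x $ i" using AE_N by eventually_elim (simp add: uN)
qed measurable

lemma loc_D: "integrable lborel (\<lambda>x. indicator (cball 0 r) x * Db x $ i $ j)"
proof (rule L2_loc_representative_integrable)
  show "L2_loc (\<lambda>x. Du x $ i $ j)" using wg by (simp add: weak_grad_def)
  show "AE x in lborel. Du x $ i $ j = Db x $ i $ j" using AE_N by eventually_elim (simp add: DN)
qed measurable

lemma weak_b:
  assumes t: "test_fun \<phi> D\<phi>"
  shows "integral\<^sup>L lborel (\<lambda>x. ub x $ i * D\<phi> x $ j) = - integral\<^sup>L lborel (\<lambda>x. Db x $ i $ j * \<phi> x)"
proof -
  note [measurable] = test_fun_measurable[OF t]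
  have ae: "AE x in lebesgue. x \<notin> N" by (rule AE_completion[OF AE_N])
  have [measurable]: "\<phi> \<in> borel_measurable lebesgue" "(\<lambda>x. D\<phi> x $ j) \<in> borel_measurable lebesgue"
    "(\<lambda>x. ub x $ i) \<in> borel_measurable lebesgue" "(\<lambda>x. Db x $ i $ j) \<in> borel_measurable lebesgue"
    by (intro measurable_completion, measurable)+
  have [measurable]: "(\<lambda>x. u x $ i) \<in> borel_measurable lebesgue" "(\<lambda>x. Du x $ i $ j) \<in> borel_measurable
      lebesgue"
    using wg by (auto simp: weak_grad_def L2_loc_def)
  have "integral\<^sup>L lborel (\<lambda>x. ub x $ i * D\<phi> x $ j) = integral\<^sup>L lebesgue (\<lambda>x. ub x $ i * D\<phi> x $ j)"
    by (rule integral_completion[symmetric]) measurable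
  also have "\<dots> = integral\<^sup>L lebesgue (\<lambda>x. u x $ i * D\<phi> x $ j)"
    by (rule integral_cong_AE) (measurable, use ae uN in \<open>auto elim!: eventually_mono\<close>)
  also have "\<dots> = - integral\<^sup>L lebesgue (\<lambda>x. Du x $ i $ j * \<phi> x)"
    using wg t by (simp add: weak_grad_def)
  also have "integral\<^sup>L lebesgue (\<lambda>x. Du x $ i $ j * \<phi> x) = integral\<^sup>L lebesgue (\<lambda>x. Db x $ i $ j * \<phi> x)"
    by (rule integral_cong_AE) (measurable, use ae DN in \<open>auto elim!: eventually_mono\<close>)
  also have "\<dots> = integral\<^sup>L lborel (\<lambda>x. Db x $ i $ j * \<phi> x)"
    by (rule integral_completion) measurable
  finally show ?thesis .
qed

lemma translate:
  "AE x in lborel. ub (x + y) $ i - ub x $ i = integral\<^sup>L lborel (\<lambda>s. indicator {0..1} s * (Db (x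
      + s *\<^sub>R y) $ i \<bullet> y))"
  by (rule weak_translate[where p="\<lambda>x. Db x $ i"]) (auto intro: loc_u loc_D weak_b)

definition q :: "real^'n \<Rightarrow> real^'n" where "q x = (\<chi> i. Db x $ i \<bullet> \<nu>)"

lemma q_meas [measurable]: "q \<in> borel_measurable borel" unfolding q_def by measurable

text \<open>Integration against \<open>K h\<close> is oriented integration from \<open>0\<close> to \<open>h\<close>.\<close>

definition K :: "real \<Rightarrow> real \<Rightarrow> real" where
  "K h s = (if 0 \<le> s \<and> s \<le> h then 1 else 0) - (if h \<le> s \<and> s < 0 then 1 else 0)"

text \<open>For almost every \<open>x\<close> this is the absolutely continuous representative of
  \<open>ub\<close> on the line through \<open>x\<close>, with \<open>h\<close> the signed distance
  from \<open>x\<close>. Being built from increments, it has a value at every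
  \<open>h\<close>.\<close>

definition \<Gamma> :: "real^'n \<Rightarrow> real \<Rightarrow> real^'n" where
  "\<Gamma> x h = (\<chi> i. ub x $ i + integral\<^sup>L lborel (\<lambda>s. K h s * q (x + s *\<^sub>R \<nu>) $ i))"

lemma \<Gamma>_meas [measurable (raw)]:
  assumes [measurable]: "f \<in> borel_measurable L" "h \<in> borel_measurable L"
  shows "(\<lambda>x. \<Gamma> (f x) (h x)) \<in> borel_measurable L"
  unfolding \<Gamma>_def K_def by measurable

text \<open>The increment formula for the vector \<open>h *\<^sub>R \<nu>\<close>, after the
  substitution of \<open>h * s\<close> for \<open>s\<close>. The kernel \<open>K\<close> covers both
  signs of \<open>h\<close>; its values at single points do not matter.\<close>

lemma line_rep: "AE x in lborel. ub (x + h *\<^sub>R \<nu>) = \<Gamma> x h"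
proof -
  have e: "integral\<^sup>L lborel (\<lambda>s. indicator {0..1} s * (Db (x + s *\<^sub>R (h *\<^sub>R \<nu>)) $ i \<bullet> (h *\<^sub>R \<nu>)))
     = integral\<^sup>L lborel (\<lambda>s. K h s * q (x + s *\<^sub>R \<nu>) $ i)" for x i
  proof (cases "h = 0")
    case True
    have "AE s in lborel. K h s * q (x + s *\<^sub>R \<nu>) $ i = 0"
      using AE_lborel_singleton[of 0] by eventually_elim (auto simp: K_def True)
    then have "integral\<^sup>L lborel (\<lambda>s. K h s * q (x + s *\<^sub>R \<nu>) $ i) = 0" by (rule integral_eq_zero_AE)
    then show ?thesis by (simp add: True)
  next
    case False
    have [measurable]: "(\<lambda>s. K h s) \<in> borel_measurable borel" unfolding K_def by measurable
    have "integral\<^sup>L lborel (\<lambda>s. K h s * q (x + s *\<^sub>R \<nu>) $ i) = \<bar>h\<bar> *\<^sub>R integral\<^sup>L lborel (\<lambda>s. K h (0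
        + h * s) * q (x + (0 + h * s) *\<^sub>R \<nu>) $ i)"
      by (rule lborel_integral_real_affine[OF False])
    also have "\<dots> = integral\<^sup>L lborel (\<lambda>s. \<bar>h\<bar> * (K h (h * s) * q (x + (h * s) *\<^sub>R \<nu>) $ i))" by simp
    also have "\<dots> = integral\<^sup>L lborel (\<lambda>s. indicator {0..1} s * (Db (x + s *\<^sub>R (h *\<^sub>R \<nu>)) $ i \<bullet> (h *\<^sub>R \<nu>)))"
    proof (rule integral_cong_AE)
      show "AE s in lborel. \<bar>h\<bar> * (K h (h * s) * q (x + (h * s) *\<^sub>R \<nu>) $ i) = indicator {0..1} s * (Db
          (x + s *\<^sub>R (h *\<^sub>R \<nu>)) $ i \<bullet> (h *\<^sub>R \<nu>))"
        using AE_lborel_singleton[of 0]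
      proof eventually_elim
        case (elim s)
        have "\<bar>h\<bar> * K h (h * s) = indicator {0..1} s * h"
        proof (cases "h > 0")
          case True
          then show ?thesis using elim by (auto simp: K_def indicator_def zero_le_mult_iff
              mult_le_cancel_left1 mult_less_0_iff)
        next
          case 2: False
          then have "h < 0" using False by simp
          then show ?thesis using elim by (auto simp: K_def indicator_def zero_le_mult_iff
              mult_le_cancel_left2 mult_le_cancel_left1 mult_less_0_iff)
        qed
        moreover have "q (x + (h * s) *\<^sub>R \<nu>) $ i = Db (x + s *\<^sub>R (h *\<^sub>R \<nu>)) $ i \<bullet> \<nu>"
            by (simp add: q_def mult.commute)
        ultimately show ?case by (metis (no_types, lifting) inner_scaleR_right mult.assoc)
      qed
    qed measurable
    finally show ?thesis by simp
  qed
  have "AE x in lborel. \<forall>i. ub (x + h *\<^sub>R \<nu>) $ i - ub x $ i = integral\<^sup>L lborel (\<lambda>s. indicator {0..1} s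
      * (Db (x + s *\<^sub>R (h *\<^sub>R \<nu>)) $ i \<bullet> (h *\<^sub>R \<nu>)))"
    using translate[of "h *\<^sub>R \<nu>"] by (simp only: AE_all_countable) blast
  then show ?thesis
  proof eventually_elim
    case (elim x)
    then have "ub (x + h *\<^sub>R \<nu>) $ i = ub x $ i + integral\<^sup>L lborel (\<lambda>s. K h s * q (x + s *\<^sub>R \<nu>) $ i)" for i
      unfolding e by (metis add.commute diff_add_cancel)
    then show ?case by (simp add: \<Gamma>_def vec_eq_iff)
  qed
qed

text \<open>For fixed \<open>h\<close> the bad base points form a null set that depends on
  \<open>h\<close>; Fubini reverses the order of the two quantifiers.\<close>

lemma line_AE: "AE x in lborel. AE h in lborel. x + h *\<^sub>R \<nu> \<notin> N \<and> ub (x + h *\<^sub>R \<nu>) = \<Gamma> x h"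
proof (subst lborel_pair.AE_commute)
  show "{z \<in> space (lborel \<Otimes>\<^sub>M lborel). fst z + snd z *\<^sub>R \<nu> \<notin> N \<and> ub (fst z + snd z *\<^sub>R \<nu>)
      = \<Gamma> (fst z) (snd z)} \<in> sets (lborel \<Otimes>\<^sub>M lborel)"
    by measurable
  show "AE h in lborel. AE x in lborel. x + h *\<^sub>R \<nu> \<notin> N \<and> ub (x + h *\<^sub>R \<nu>) = \<Gamma> x h"
  proof (rule AE_I2)
    fix h :: real
    show "AE x in lborel. x + h *\<^sub>R \<nu> \<notin> N \<and> ub (x + h *\<^sub>R \<nu>) = \<Gamma> x h"
      using AE_lborel_shift[OF AE_N, of "h *\<^sub>R \<nu>"] line_rep[of h] by eventually_elim simp
  qed
qed

lemma loc_q: "integrable lborel (\<lambda>x. indicator (cball 0 r) x * q x $ i)"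
proof -
  have "integrable lborel (\<lambda>x. \<Sum>j\<in>UNIV. (indicator (cball 0 r) x * Db x $ i $ j) * \<nu> $ j)"
    by (intro Bochner_Integration.integrable_sum integrable_mult_left loc_D)
  then show ?thesis by (simp add: q_def inner_vec_def sum_distrib_left mult.assoc)
qed

text \<open>On almost every line \<open>q\<close> is locally integrable, and
  \<open>K t - K s\<close> is the indicator of \<open>{s..t}\<close> away from the points 0,
  \<open>s\<close> and \<open>t\<close>.\<close>

lemma curve_AE: "AE x in lborel. \<forall>a b. curve_on a b (\<Gamma> x) (\<lambda>s. q (x + s *\<^sub>R \<nu>))"
proof -
  have "AE x in lborel. \<forall>a b. integrable lborel (\<lambda>s. indicator {a..b} s * q (x + s *\<^sub>R \<nu>) $ i)" for i
    by (rule line_integrable_AE[OF _ loc_q]) measurable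
  then have "AE x in lborel. \<forall>i a b. integrable lborel (\<lambda>s. indicator {a..b} s * q (x + s *\<^sub>R \<nu>) $ i)"
    by (simp only: AE_all_countable) blast
  then show ?thesis
  proof eventually_elim
    case (elim x)
    define f where "f i s = q (x + s *\<^sub>R \<nu>) $ i" for i s
    have [measurable]: "f i \<in> borel_measurable borel" for i unfolding f_def by measurable
    have [measurable]: "K h \<in> borel_measurable borel" for h unfolding K_def by measurable
    have int: "integrable lborel (\<lambda>s. indicator {a..b} s * f i s)" for i a b using elim by (simp add: f_def)
    have intK: "integrable lborel (\<lambda>s. K h s * f i s)" for h i
      by (rule Bochner_Integration.integrable_bound[OF int[of "- \<bar>h\<bar>" "\<bar>h\<bar>" i]]) (auto simp: K_def
          indicator_def intro!: AE_I2)
    have diff: "\<Gamma> x t $ i - \<Gamma> x s $ i = integral\<^sup>L lborel (\<lambda>r. indicator {s..t} r * f i r)" if "s \<le> t"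
        for s t i
    proof -
      have "\<Gamma> x t $ i - \<Gamma> x s $ i = integral\<^sup>L lborel (\<lambda>r. K t r * f i r) - integral\<^sup>L lborel (\<lambda>r. K s r
          * f i r)"
        by (simp add: \<Gamma>_def f_def)
      also have "\<dots> = integral\<^sup>L lborel (\<lambda>r. K t r * f i r - K s r * f i r)"
        by (rule Bochner_Integration.integral_diff[symmetric, OF intK intK])
      also have "\<dots> = integral\<^sup>L lborel (\<lambda>r. indicator {s..t} r * f i r)"
      proof (rule integral_cong_AE)
        show "AE r in lborel. K t r * f i r - K s r * f i r = indicator {s..t} r * f i r"
          using AE_lborel_singleton[of 0] AE_lborel_singleton[of s] AE_lborel_singleton[of t]
        proof eventually_elim
          case (elim r)
          have "K t r - K s r = indicator {s..t} r" using elim that by (auto simp: K_def indicator_def)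
          then show ?case by (metis left_diff_distrib)
        qed
      qed measurable
      finally show ?thesis .
    qed
    show ?case
    proof (intro allI)
      fix a b :: real
      show "curve_on a b (\<Gamma> x) (\<lambda>s. q (x + s *\<^sub>R \<nu>))" unfolding curve_on_def
      proof (intro conjI allI impI)
        show "(\<lambda>s. q (x + s *\<^sub>R \<nu>)) absolutely_integrable_on {a..b}"
        proof (subst absolutely_integrable_componentwise_iff, intro ballI)
          fix e :: "real^'n" assume "e \<in> Basis"
          then obtain i where e: "e = axis i 1" by (auto simp: Basis_vec_def)
          have "integrable lebesgue (\<lambda>s. indicator {a..b} s *\<^sub>R f i s)"
            by (subst integrable_completion) (use int in auto)
          then show "(\<lambda>s. q (x + s *\<^sub>R \<nu>) \<bullet> e) absolutely_integrable_on {a..b}"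
            by (simp add: set_integrable_def e inner_axis f_def)
        qed
        fix s t assume st: "a \<le> s \<and> s \<le> t \<and> t \<le> b"
        show "((\<lambda>s. q (x + s *\<^sub>R \<nu>)) has_integral \<Gamma> x t - \<Gamma> x s) {s..t}"
        proof (subst has_integral_componentwise_iff, intro ballI)
          fix e :: "real^'n" assume "e \<in> Basis"
          then obtain i where e: "e = axis i 1" by (auto simp: Basis_vec_def)
          have si: "set_integrable lborel {s..t} (f i)" unfolding set_integrable_def using int[of s t i]
              by simp
          have "(f i has_integral (\<Gamma> x t $ i - \<Gamma> x s $ i)) {s..t}"
            using set_borel_integral_eq_integral[OF si] diff[of s t i] st
            by (simp add: has_integral_integral set_lebesgue_integral_def)
          then show "((\<lambda>r. q (x + r *\<^sub>R \<nu>) \<bullet> e) has_integral (\<Gamma> x t - \<Gamma> x s) \<bullet> e) {s..t}"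
            by (simp add: e inner_axis f_def[abs_def])
        qed
      qed
    qed
  qed
qed

section \<open>Splitting the energy into lines and tangential derivatives\<close>

definition e0 :: "real^'n \<Rightarrow> ennreal" where "e0 x = ennreal ((norm (q x))\<^sup>2 / 2 + W (ub x))"

definition L :: "real^'n \<Rightarrow> ennreal" where "L x = (\<integral>\<^sup>+s. e0 (x + s *\<^sub>R \<nu>) \<partial>lborel)"

definition dd :: "real^'n \<Rightarrow> real" where "dd x = (\<Sum>i\<in>UNIV. (norm (Db x $ i - (Db x $ i \<bullet> \<nu>) *\<^sub>R \<nu>))\<^sup>2)"

lemma e0_meas [measurable]: "e0 \<in> borel_measurable borel" unfolding e0_def by measurable
lemma L_meas [measurable]: "L \<in> borel_measurable borel" unfolding L_def by measurable
lemma dd_meas [measurable]: "dd \<in> borel_measurable borel" unfolding dd_def by measurable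
lemma dd_nonneg: "0 \<le> dd x" unfolding dd_def by (intro sum_nonneg) auto

lemma norm_Db: "(norm (Db x))\<^sup>2 = (norm (q x))\<^sup>2 + dd x"
proof -
  have p: "(norm a)\<^sup>2 = (a \<bullet> \<nu>)\<^sup>2 + (norm (a - (a \<bullet> \<nu>) *\<^sub>R \<nu>))\<^sup>2" for a :: "real^'n"
  proof -
    have \<nu>1: "\<nu> \<bullet> \<nu> = 1" using norm_\<nu> by (simp add: dot_square_norm)
    show ?thesis unfolding power2_norm_eq_inner
      by (simp add: inner_diff_left inner_diff_right \<nu>1 inner_commute[of \<nu> a] power2_eq_square)
  qed
  have "(norm (Db x))\<^sup>2 = (\<Sum>i\<in>UNIV. (norm (Db x $ i))\<^sup>2)"
    by (simp add: norm_vec_def[of "Db x"] L2_set_def sum_nonneg)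
  also have "\<dots> = (\<Sum>i\<in>UNIV. (Db x $ i \<bullet> \<nu>)\<^sup>2) + dd x" unfolding dd_def sum.distrib[symmetric]
      by (rule sum.cong) (auto intro: p)
  also have "(\<Sum>i\<in>UNIV. (Db x $ i \<bullet> \<nu>)\<^sup>2) = (norm (q x))\<^sup>2"
    unfolding norm_vec_def[of "q x"] L2_set_def by (simp add: q_def sum_nonneg)
  finally show ?thesis .
qed

text \<open>Pythagoras in each row of the gradient separates the derivative along
  \<open>\<nu>\<close> from the tangential ones; the former is integrated together with the
  potential line by line.\<close>

lemma energy_split:
  "energy W i1 R u Du = (\<integral>\<^sup>+x. L x * indicator D0 x \<partial>lborel) + (\<integral>\<^sup>+x. ennreal (dd x / 2) * indicator
      (fund_dom i1 R) x \<partial>lborel)"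
proof -
  have "energy W i1 R u Du = (\<integral>\<^sup>+x. ennreal ((norm (Du x))\<^sup>2 / 2 + W (u x)) * indicator (fund_dom i1 R)
      x \<partial>lborel)"
    unfolding energy_def nn_integral_completion ..
  also have "\<dots> = (\<integral>\<^sup>+x. e0 x * indicator (fund_dom i1 R) x + ennreal (dd x / 2) * indicator (fund_dom i1
      R) x \<partial>lborel)"
  proof (rule nn_integral_cong_AE)
    show "AE x in lborel. ennreal ((norm (Du x))\<^sup>2 / 2 + W (u x)) * indicator (fund_dom i1 R) x
        = e0 x * indicator (fund_dom i1 R) x + ennreal (dd x / 2) * indicator (fund_dom i1 R) x"
      using AE_N
    proof eventually_elim
      case (elim x)
      have "ennreal ((norm (Du x))\<^sup>2 / 2 + W (u x)) = e0 x + ennreal (dd x / 2)"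
        unfolding e0_def DN[OF elim] uN[OF elim] norm_Db using W_nonneg[of "ub x"] dd_nonneg[of x]
        by (subst ennreal_plus[symmetric]) (auto simp: add_divide_distrib add_ac)
      then show ?case by (simp add: distrib_right)
    qed
  qed
  also have "\<dots> = (\<integral>\<^sup>+x. e0 x * indicator (fund_dom i1 R) x \<partial>lborel) + (\<integral>\<^sup>+x. ennreal (dd x / 2) *
      indicator (fund_dom i1 R) x \<partial>lborel)"
    by (rule nn_integral_add) measurable
  also have "(\<integral>\<^sup>+x. e0 x * indicator (fund_dom i1 R) x \<partial>lborel) = (\<integral>\<^sup>+x. L x * indicator D0 x \<partial>lborel)"
    unfolding L_def by (rule nn_integral_fund_dom) measurable
  finally show ?thesis .
qed

lemma L_total: "(\<integral>\<^sup>+x. L x * indicator D0 x \<partial>lborel) \<le> ennreal (\<delta> um up)"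
  using E unfolding energy_split by (meson add_increasing2 order_trans zero_le order_refl)

lemma good_AE: "AE x in lborel. x \<in> D0 \<longrightarrow>
  finite_energy_curve X \<delta> W \<Psi> M (\<Gamma> x) (\<lambda>s. q (x + s *\<^sub>R \<nu>)) \<and>
  (\<integral>\<^sup>+s. ennreal ((norm (q (x + s *\<^sub>R \<nu>)))\<^sup>2 / 2 + W (\<Gamma> x s)) \<partial>lborel) = L x"
proof -
  have "(\<integral>\<^sup>+x. L x * indicator D0 x \<partial>lborel) \<noteq> \<infinity>" using L_total by (auto simp: top_unique)
  then have "AE x in lborel. L x * indicator D0 x \<noteq> \<infinity>" by (intro nn_integral_PInf_AE) measurable
  then show ?thesis using line_AE curve_AE
  proof eventually_elim
    case (elim x)
    have eq: "(\<integral>\<^sup>+s. ennreal ((norm (q (x + s *\<^sub>R \<nu>)))\<^sup>2 / 2 + W (\<Gamma> x s)) \<partial>lborel) = L x"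
      unfolding L_def e0_def
    proof (rule nn_integral_cong_AE)
      show "AE s in lborel. ennreal ((norm (q (x + s *\<^sub>R \<nu>)))\<^sup>2 / 2 + W (\<Gamma> x s)) = ennreal ((norm (q (x
          + s *\<^sub>R \<nu>)))\<^sup>2 / 2 + W (ub (x + s *\<^sub>R \<nu>)))"
        using elim(2) by eventually_elim simp
    qed
    show ?case
    proof (intro impI conjI eq)
      assume "x \<in> D0"
      then have "L x < \<infinity>" using elim(1) by (simp add: less_top)
      then show "finite_energy_curve X \<delta> W \<Psi> M (\<Gamma> x) (\<lambda>s. q (x + s *\<^sub>R \<nu>))"
        using elim(3) eq by unfold_locales auto
    qed
  qed
qed

text \<open>The periods of \<open>u\<close> form a group, so those in the definition of periodicity
  generate the whole lattice.\<close>

lemma periodic: "u (x + transpose R *v (\<chi> k. if k = i1 then 0 else of_int (m k))) = u x"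
proof -
  define P where "P = {v. \<forall>x. u (x + v) = u x}"
  have P0: "0 \<in> P" by (simp add: P_def)
  have Padd: "v + w \<in> P" if "v \<in> P" "w \<in> P" for v w using that by (simp add: P_def add.assoc[symmetric])
  have Pneg: "- v \<in> P" if "v \<in> P" for v
  proof -
    have "u (x + - v) = u x" for x
    proof -
      have "u ((x + - v) + v) = u (x + - v)" using that unfolding P_def by blast
      then show ?thesis by simp
    qed
    then show ?thesis by (simp add: P_def)
  qed
  have Pnat: "real n *\<^sub>R v \<in> P" if "v \<in> P" for n v
    by (induction n) (auto simp: P0 scaleR_add_left intro: Padd that)
  have Pint: "of_int z *\<^sub>R v \<in> P" if "v \<in> P" for z v
  proof (cases "z \<ge> 0")
    case True then show ?thesis using Pnat[OF that, of "nat z"] by simp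
  next
    case False then show ?thesis using Pneg[OF Pnat[OF that, of "nat (- z)"]] by simp
  qed
  have ax: "transpose R *v axis k 1 \<in> P" if "k \<noteq> i1" for k
    using H that by (simp add: P_def H1div_def periodic_R_def del: transpose_matrix_vector)
  have Psum: "(\<Sum>k\<in>A. f k) \<in> P" if "finite A" "\<And>k. k \<in> A \<Longrightarrow> f k \<in> P" for A :: "'n set" and f
    using that by (induction A rule: finite_induct) (auto simp: P0 Padd)
  have "(\<chi> k. if k = i1 then 0 else real_of_int (m k)) = (\<Sum>k\<in>UNIV - {i1}. of_int (m k) *\<^sub>R axis k 1)"
    by (auto simp: vec_eq_iff axis_def if_distrib sum.If_cases cong: if_cong)
  then have "transpose R *v (\<chi> k. if k = i1 then 0 else of_int (m k)) = (\<Sum>k\<in>UNIV - {i1}. of_int (m k)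
      *\<^sub>R (transpose R *v axis k 1))"
    by (simp add: matrix_vector_mult_scaleR linear_sum[OF matrix_vector_mul_linear, of "transpose R",
        unfolded o_def] del: transpose_matrix_vector)
  also have "\<dots> \<in> P" by (intro Psum Pint ax) auto
  finally show ?thesis by (simp add: P_def)
qed

text \<open>\<open>H1div\<close> states periodicity for \<open>u\<close>; the gradient inherits it
  almost everywhere by uniqueness of weak derivatives, after translation of the test
  function.\<close>

lemma Db_periodic:
  assumes v: "\<And>x. u (x + v) = u x"
  shows "AE x in lborel. Db (x + v) = Db x"
proof -
  have "AE x in lborel. Db (x + v) $ i $ j - Db x $ i $ j = 0" for i j
  proof (rule fundamental_lemma)
    show "(\<lambda>x. Db (x + v) $ i $ j - Db x $ i $ j) \<in> borel_measurable borel" by measurable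
    have locs: "integrable lborel (\<lambda>x. indicator (cball 0 r) x * Db (x + v) $ i $ j)" for r
    proof -
      have "integrable (distr lborel borel ((+) (- v))) (\<lambda>x. indicator (cball 0 r) x * Db (x
          + v) $ i $ j) = integrable lborel (\<lambda>x. indicator (cball 0 r) (x - v) * Db x $ i $ j)"
        by (subst integrable_distr_eq) (auto simp: algebra_simps)
      moreover have "integrable lborel (\<lambda>x. indicator (cball 0 r) (x - v) * Db x $ i $ j)"
      proof (rule Bochner_Integration.integrable_bound[OF loc_D[of "r + norm v" i j]])
        show "AE x in lborel. norm (indicator (cball 0 r) (x - v) * Db x $ i $ j)
            \<le> norm (indicator (cball 0 (r + norm v)) x * Db x $ i $ j)"
        proof (rule AE_I2)
          fix x show "norm (indicator (cball 0 r) (x - v) * Db x $ i $ j) \<le> norm (indicator (cball 0 (r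
              + norm v)) x * Db x $ i $ j)"
            using norm_triangle_sub[of x v] by (auto simp: indicator_def)
        qed
      qed measurable
      ultimately show ?thesis by (simp add: lborel_distr_plus)
    qed
    show "integrable lborel (\<lambda>x. indicator (cball 0 r) x * (Db (x + v) $ i $ j - Db x $ i $ j))" for r
      unfolding right_diff_distrib by (intro Bochner_Integration.integrable_diff locs loc_D)
    fix \<phi> :: "real^'n \<Rightarrow> real" and D\<phi> assume t: "test_fun \<phi> D\<phi>"
    note [measurable] = test_fun_measurable[OF t]
    obtain \<rho> C where \<rho>: "\<rho> > 0" "C > 0" "\<And>x. norm x > \<rho> \<Longrightarrow> \<phi> x = 0" "\<And>x. norm x > \<rho> \<Longrightarrow> D\<phi> x = 0"
      "\<And>x. \<bar>\<phi> x\<bar> \<le> C" "\<And>x. norm (D\<phi> x) \<le> C" using test_fun_bounds[OF t] by metis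
    have t': "test_fun (\<lambda>x. \<phi> (x - v)) (\<lambda>x. D\<phi> (x - v))" using test_fun_translate[OF t, of "- v"] by simp
    have "integral\<^sup>L lborel (\<lambda>x. Db (x + v) $ i $ j * \<phi> x) = integral\<^sup>L lborel (\<lambda>x. Db (x
        + v) $ i $ j * \<phi> ((x + v) - v))" by simp
    also have "\<dots> = integral\<^sup>L lborel (\<lambda>x. Db x $ i $ j * \<phi> (x - v))"
        by (rule integral_lborel_shift) measurable
    also have "\<dots> = - integral\<^sup>L lborel (\<lambda>x. ub x $ i * D\<phi> (x - v) $ j)" using weak_b[OF t', of i j] by simp
    also have "integral\<^sup>L lborel (\<lambda>x. ub x $ i * D\<phi> (x - v) $ j) = integral\<^sup>L lborel (\<lambda>x. ub (x
        + v) $ i * D\<phi> ((x + v) - v) $ j)"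
      by (rule integral_lborel_shift[symmetric]) measurable
    also have "\<dots> = integral\<^sup>L lborel (\<lambda>x. ub x $ i * D\<phi> x $ j)"
    proof (rule integral_cong_AE)
      show "AE x in lborel. ub (x + v) $ i * D\<phi> (x + v - v) $ j = ub x $ i * D\<phi> x $ j"
        using AE_N AE_lborel_shift[OF AE_N, of v] by eventually_elim (simp add: uN[symmetric] v)
    qed measurable
    also have "- \<dots> = integral\<^sup>L lborel (\<lambda>x. Db x $ i $ j * \<phi> x)" using weak_b[OF t, of i j] by simp
    finally have e: "integral\<^sup>L lborel (\<lambda>x. Db (x + v) $ i $ j * \<phi> x) = integral\<^sup>L lborel (\<lambda>x. Db x $ i
        $ j * \<phi> x)" .
    have i1: "integrable lborel (\<lambda>x. Db (x + v) $ i $ j * \<phi> x)"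
      by (rule loc_integrable_test_mult[OF _ _ locs, where \<rho>=\<rho> and C=C]) (use \<rho> in auto)
    have i2: "integrable lborel (\<lambda>x. Db x $ i $ j * \<phi> x)"
      by (rule loc_integrable_test_mult[OF _ _ loc_D, where \<rho>=\<rho> and C=C]) (use \<rho> in auto)
    show "integral\<^sup>L lborel (\<lambda>x. (Db (x + v) $ i $ j - Db x $ i $ j) * \<phi> x) = 0"
      unfolding left_diff_distrib Bochner_Integration.integral_diff[OF i1 i2] e by simp
  qed
  then have "AE x in lborel. \<forall>i j. Db (x + v) $ i $ j - Db x $ i $ j = 0"
      by (simp only: AE_all_countable) blast
  then show ?thesis by eventually_elim (simp add: vec_eq_iff)
qed

section \<open>From limits of slice averages to limits along lines\<close>

text \<open>The slice point with coordinates \<open>y\<close> at height \<open>t\<close> lies on the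
  line through the rotated \<open>y\<close>, at parameter \<open>t - y $ i1\<close>. By Fubini, for
  almost every \<open>t\<close> the continuous representatives may be used at almost every
  \<open>y\<close>, which expresses the average through lines with base points in the cell.\<close>

lemma slice_AE: "AE t in lborel. slice_avg i1 R \<nu> u t = integral\<^sup>L lborel (\<lambda>y. indicator (cbox 0 One) y
    *\<^sub>R \<Gamma> (transpose R *v y) (t - y $ i1))"
proof -
  define P where "P y t \<longleftrightarrow> transpose R *v y + (t - y $ i1) *\<^sub>R \<nu> \<notin> N \<and> ub (transpose R *v y + (t
      - y $ i1) *\<^sub>R \<nu>) = \<Gamma> (transpose R *v y) (t - y $ i1)" for y t
  have oT: "orthogonal_matrix (transpose R)" using orth by (simp add: orthogonal_matrix_transpose)
  have "AE y in lborel. AE t in lborel. P y t"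
    using AE_lborel_orthogonal[OF oT line_AE]
  proof eventually_elim
    case (elim y)
    show ?case using AE_lborel_shift[OF elim, of "- (y $ i1)"]
        by (simp add: P_def del: transpose_matrix_vector)
  qed
  moreover have "{z \<in> space (lborel \<Otimes>\<^sub>M lborel). P (fst z) (snd z)} \<in> sets (lborel \<Otimes>\<^sub>M lborel)"
    unfolding P_def by measurable
  ultimately have "AE t in lborel. AE y in lborel. P y t" using lborel_pair.AE_commute by blast
  then show ?thesis
  proof eventually_elim
    case (elim t)
    have arg: "t *\<^sub>R \<nu> + transpose R *v (\<chi> k. if k = i1 then 0 else y $ k) = transpose R *v y + (t
        - y $ i1) *\<^sub>R \<nu>" for y
    proof -
      have "(\<chi> k. if k = i1 then 0 else y $ k) = y - (y $ i1) *\<^sub>R axis i1 1"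
          by (simp add: vec_eq_iff axis_def)
      then have "transpose R *v (\<chi> k. if k = i1 then 0 else y $ k) = transpose R *v y - (y $ i1) *\<^sub>R \<nu>"
        by (simp add: matrix_vector_mult_diff_distrib matrix_vector_mult_scaleR \<nu>_eq
            del: transpose_matrix_vector)
      then show ?thesis by (simp add: algebra_simps del: transpose_matrix_vector)
    qed
    define h where "h y = indicator (cbox 0 One) y *\<^sub>R \<Gamma> (transpose R *v y) (t - y $ i1)" for y
    have [measurable]: "h \<in> borel_measurable borel" unfolding h_def by measurable
    have hl: "h \<in> borel_measurable lebesgue" by (intro measurable_completion) measurable
    have ae: "AE y in lebesgue. h y = indicator (cbox 0 One) y *\<^sub>R u (transpose R *v y + (t - y $ i1) *\<^sub>R \<nu>)"
      using AE_completion[OF elim] by eventually_elim (simp add: P_def h_def uN del: transpose_matrix_vector)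
    have "slice_avg i1 R \<nu> u t = integral\<^sup>L lebesgue (\<lambda>y. indicator (cbox 0 One) y *\<^sub>R u (transpose R *v
        y + (t - y $ i1) *\<^sub>R \<nu>))"
      unfolding slice_avg_def arg by (rule integral_restrict_space) auto
    \<comment> \<open>The slice of \<open>u\<close> is Lebesgue measurable because it agrees almost
      everywhere with the Borel function \<open>h\<close>.\<close>
    also have "\<dots> = integral\<^sup>L lebesgue h"
      by (rule integral_cong_AE[OF borel_measurable_AE[OF hl ae] hl]) (use ae in \<open>auto
          elim!: eventually_mono\<close>)
    also have "\<dots> = integral\<^sup>L lborel h" by (rule integral_completion) measurable
    finally show ?case by (simp add: h_def[abs_def] del: transpose_matrix_vector)
  qed
qed

lemma cube_AE: "AE y in lborel. (y::real^'n) \<in> cbox 0 One \<longleftrightarrow> transpose R *v y \<in> D0"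
proof -
  define C :: "(real^'n) set" where "C = {x. \<forall>k. x $ k \<in> {0..<1}}"
  have sub: "C \<subseteq> cbox 0 One" by (auto simp: C_def mem_unit_box less_imp_le)
  have [measurable]: "C \<in> sets borel" unfolding C_def by (rule unit_cube_sets)
  have "emeasure lborel (cbox 0 One - C) = emeasure lborel (cbox 0 One :: (real^'n) set) - emeasure lborel C"
    using sub emeasure_unit_cube[where 'n='n] by (intro emeasure_Diff) (auto simp: C_def)
  also have "\<dots> = 0" using emeasure_unit_cube[where 'n='n] by (simp add: C_def emeasure_lborel_cbox_eq)
  finally have "cbox 0 One - C \<in> null_sets lborel" by (auto simp: null_sets_def)
  from AE_not_in[OF this] show ?thesis
  proof eventually_elim
    case (elim y)
    have "transpose R *v y \<in> D0 \<longleftrightarrow> y \<in> C"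
      unfolding D0_def C_def by (simp add: orthogonal_matrix_mul_transpose(1)[OF orth]
          del: transpose_matrix_vector)
    then show ?case using elim sub by blast
  qed
qed

text \<open>A priori the limit vertex may vary from line to line. Each curve is bounded by
  \<open>M\<close> plus the energy of its line, which is integrable over the cell; dominated
  convergence therefore identifies the mean of the limit vertices as \<open>w\<close>.\<close>

lemma limit_AE:
  assumes conv: "AE x in lborel. x \<in> D0 \<longrightarrow> (\<exists>l\<in>X. (\<Gamma> x \<longlongrightarrow> l) FF)"
    and t: "\<And>c. filterlim (\<lambda>n. t n - c) FF sequentially" and w: "w \<in> X"
    and lim: "(\<lambda>n. integral\<^sup>L lborel (\<lambda>y. indicator (cbox 0 One) y *\<^sub>R \<Gamma> (transpose R *v y) (t n
        - y $ i1))) \<longlonglongrightarrow> w"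
  shows "AE x in lborel. x \<in> D0 \<longrightarrow> (\<Gamma> x \<longlongrightarrow> w) FF"
proof -
  note [simp del] = transpose_matrix_vector
  have oT: "orthogonal_matrix (transpose R)" using orth by (simp add: orthogonal_matrix_transpose)
  define s where "s n y = indicator (cbox 0 One) y *\<^sub>R \<Gamma> (transpose R *v y) (t n - y $ i1)"
      for n and y :: "real^'n"
  have [measurable]: "s n \<in> borel_measurable borel" for n unfolding s_def by measurable
  \<comment> \<open>Defined through \<open>lim\<close> in order to be Borel measurable; the
    convergence itself is known almost everywhere.\<close>
  define f where "f y = lim (\<lambda>n. s n y)" for y
  have [measurable]: "f \<in> borel_measurable borel" unfolding f_def
      by (rule borel_measurable_lim_metric) measurable
  define T where "T y = indicator (cbox 0 One) y * (M + enn2real (L (transpose R *v y)))" for y :: "real^'n"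
  have [measurable]: "T \<in> borel_measurable borel" unfolding T_def by measurable
  have good: "AE y in lborel. y \<in> cbox 0 One \<longrightarrow>
     (finite_energy_curve X \<delta> W \<Psi> M (\<Gamma> (transpose R *v y)) (\<lambda>s. q (transpose R *v y + s *\<^sub>R \<nu>)) \<and>
      (\<integral>\<^sup>+s. ennreal ((norm (q (transpose R *v y + s *\<^sub>R \<nu>)))\<^sup>2 / 2 + W (\<Gamma> (transpose R *v y) s))
          \<partial>lborel) = L (transpose R *v y)) \<and>
      (\<exists>l\<in>X. (\<Gamma> (transpose R *v y) \<longlongrightarrow> l) FF)"
    using AE_lborel_orthogonal[OF oT good_AE] AE_lborel_orthogonal[OF oT conv] cube_AE
        by eventually_elim blast
  have fl: "AE y in lborel. (\<lambda>n. s n y) \<longlonglongrightarrow> f y \<and> (y \<in> cbox 0 One \<longrightarrow> f y \<in> X \<and> (\<Gamma> (transpose R *v y) \<longlongrightarrow> f y)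
      FF) \<and> (y \<notin> cbox 0 One \<longrightarrow> f y = 0)"
    using good
  proof eventually_elim
    case (elim y)
    show ?case
    proof (cases "y \<in> cbox 0 One")
      case True
      then obtain l where l: "l \<in> X" "(\<Gamma> (transpose R *v y) \<longlongrightarrow> l) FF" using elim by blast
      have "(\<lambda>n. \<Gamma> (transpose R *v y) (t n - y $ i1)) \<longlonglongrightarrow> l" by (rule filterlim_compose[OF l(2) t])
      then have "(\<lambda>n. s n y) \<longlonglongrightarrow> l" using True by (simp add: s_def)
      moreover from this have "f y = l" unfolding f_def by (rule limI)
      ultimately show ?thesis using True l by simp
    next
      case False
      then have "(\<lambda>n. s n y) = (\<lambda>n. 0)" by (simp add: s_def)
      then show ?thesis using False by (simp add: f_def lim_const)
    qed
  qed
  have M0: "0 \<le> M" using X_norm[OF um] norm_ge_zero[of um] by linarith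
  have T_int: "integrable lborel T"
  proof (rule integrableI_bounded)
    have "(\<integral>\<^sup>+y. ennreal (norm (T y)) \<partial>lborel) \<le> (\<integral>\<^sup>+y. ennreal M * indicator (cbox 0 One) y
        + L (transpose R *v y) * indicator D0 (transpose R *v y) \<partial>lborel)"
    proof (rule nn_integral_mono_AE)
      show "AE y in lborel. ennreal (norm (T y)) \<le> ennreal M * indicator (cbox 0 One) y
          + L (transpose R *v y) * indicator D0 (transpose R *v y)"
        using cube_AE
      proof eventually_elim
        case (elim y)
        show ?case
        proof (cases "y \<in> cbox 0 One")
          case True
          have "ennreal (norm (T y)) = ennreal M + ennreal (enn2real (L (transpose R *v y)))"
            using True M0 by (simp add: T_def)
          also have "\<dots> \<le> ennreal M + L (transpose R *v y)"
            by (intro add_left_mono) (cases "L (transpose R *v y)", auto)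
          finally show ?thesis using True elim by simp
        qed (simp add: T_def)
      qed
    qed
    also have "\<dots> = (\<integral>\<^sup>+y. ennreal M * indicator (cbox 0 One) y \<partial>(lborel :: (real^'n) measure))
        + (\<integral>\<^sup>+y. L (transpose R *v y) * indicator D0 (transpose R *v y) \<partial>lborel)"
      by (rule nn_integral_add) measurable
    also have "(\<integral>\<^sup>+y. ennreal M * indicator (cbox 0 One) y \<partial>(lborel :: (real^'n) measure)) = ennreal M"
      by (subst nn_integral_cmult) (auto simp: emeasure_lborel_cbox_eq)
    also have "(\<integral>\<^sup>+y. L (transpose R *v y) * indicator D0 (transpose R *v y) \<partial>lborel)
        = (\<integral>\<^sup>+x. L x * indicator D0 x \<partial>(distr lborel borel (\<lambda>y. transpose R *v y)))"
      by (subst nn_integral_distr) measurable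
    also have "\<dots> = (\<integral>\<^sup>+x. L x * indicator D0 x \<partial>lborel)" by (simp add: distr_orthogonal_lborel[OF oT])
    also have "ennreal M + \<dots> < \<infinity>" using L_total by (auto simp: less_top[symmetric] top_unique)
    finally show "(\<integral>\<^sup>+y. ennreal (norm (T y)) \<partial>lborel) < \<infinity>" .
  qed measurable
  have bound: "AE y in lborel. norm (s n y) \<le> T y" for n
    using good
  proof eventually_elim
    case (elim y)
    show ?case
    proof (cases "y \<in> cbox 0 One")
      case True
      then interpret c: finite_energy_curve X \<delta> W \<Psi> M "\<Gamma> (transpose R *v y)" "\<lambda>s. q (transpose R *v y
          + s *\<^sub>R \<nu>)" using elim by blast
      have "c.Tot = enn2real (L (transpose R *v y))" using elim True by (simp add: c.Tot_def c.en_def)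
      then show ?thesis using True c.bounded_by_energy[of "t n - y $ i1"] by (simp add: s_def T_def)
    qed (simp add: s_def T_def)
  qed
  have flim: "AE y in lborel. (\<lambda>n. s n y) \<longlonglongrightarrow> f y" using fl by eventually_elim blast
  have f_int: "integrable lborel f"
    by (rule integrable_dominated_convergence[OF _ _ T_int flim bound]) auto
  have "(\<lambda>n. integral\<^sup>L lborel (s n)) \<longlonglongrightarrow> integral\<^sup>L lborel f"
    by (rule integral_dominated_convergence[OF _ _ T_int flim bound]) auto
  moreover have "(\<lambda>n. integral\<^sup>L lborel (s n)) \<longlonglongrightarrow> w" using lim by (simp add: s_def[abs_def])
  ultimately have fw: "integral\<^sup>L lborel f = w" by (rule LIMSEQ_unique)
  \<comment> \<open>The average of an X-valued map is the vertex w only if the map is constantly w.\<close>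
  obtain G c where G: "\<And>y. y \<in> X \<Longrightarrow> G \<bullet> y + c = (if y = w then 1 else (0::real))"
    using barycentric_functional[OF indep w] by blast
  \<comment> \<open>On the cube this is 1 minus the barycentric coordinate of \<open>w\<close> at
    \<open>f y\<close>; almost everywhere off the cube it is 0.\<close>
  define k where "k y = indicator (cbox 0 One) y * (1 - c) - G \<bullet> f y" for y :: "real^'n"
  have ind_int: "integrable lborel (\<lambda>y::real^'n. indicator (cbox 0 One) y * (1 - c))"
    by (intro integrable_mult_left integrable_real_indicator) (auto simp: emeasure_lborel_cbox_eq)
  have k_int: "integrable lborel k" unfolding k_def
    by (intro Bochner_Integration.integrable_diff ind_int integrable_inner_right) (use f_int in auto)
  have k0: "AE y in lborel. 0 \<le> k y"
    using fl
  proof eventually_elim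
    case (elim y)
    show ?case
    proof (cases "y \<in> cbox 0 One")
      case True then show ?thesis using elim G[of "f y"] by (auto simp: k_def split: if_splits)
    next
      case False then show ?thesis using elim by (simp add: k_def)
    qed
  qed
  have "integral\<^sup>L lborel k = 0"
  proof -
    have "integral\<^sup>L lborel k = integral\<^sup>L lborel (\<lambda>y::real^'n. indicator (cbox 0 One) y * (1 - c))
        - integral\<^sup>L lborel (\<lambda>y. G \<bullet> f y)"
      unfolding k_def by (rule Bochner_Integration.integral_diff[OF ind_int]) (intro
          integrable_inner_right, use f_int in auto)
    also have "integral\<^sup>L lborel (\<lambda>y. G \<bullet> f y) = G \<bullet> w" using f_int fw by (subst integral_inner_right) auto
    also have "integral\<^sup>L lborel (\<lambda>y::real^'n. indicator (cbox 0 One) y * (1 - c)) = 1 - c" by simp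
    finally show ?thesis using G[OF w] by simp
  qed
  then have "AE y in lborel. k y = 0" using integral_nonneg_eq_0_iff_AE[OF k_int k0] by simp
  then have "AE y in lborel. y \<in> cbox 0 One \<longrightarrow> (\<Gamma> (transpose R *v y) \<longlongrightarrow> w) FF"
    using fl
  proof eventually_elim
    case (elim y)
    show ?case
    proof
      assume y: "y \<in> cbox 0 One"
      then have "f y = w" using elim G[of "f y"] by (auto simp: k_def split: if_splits)
      then show "(\<Gamma> (transpose R *v y) \<longlongrightarrow> w) FF" using elim y by auto
    qed
  qed
  from AE_lborel_orthogonal[OF orth this] show ?thesis
  proof eventually_elim
    case (elim x)
    have "R *v x \<in> cbox 0 One" if "x \<in> D0" using that unfolding D0_def
        by (auto simp: mem_unit_box less_imp_le)
    then show ?case using elim by (simp add: orthogonal_matrix_mul_transpose(2)[OF orth])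
  qed
qed

lemma \<Gamma>_limit_top: "AE x in lborel. x \<in> D0 \<longrightarrow> (\<Gamma> x \<longlongrightarrow> up) at_top"
proof -
  have lim: "(slice_avg i1 R \<nu> u \<longlongrightarrow> up) (inf at_top (ae_filter lborel))" using BC by (simp add: bc_def)
  have "\<exists>t::nat \<Rightarrow> real. (\<forall>n. slice_avg i1 R \<nu> u (t n) = integral\<^sup>L lborel (\<lambda>y. indicator (cbox 0 One) y
      *\<^sub>R \<Gamma> (transpose R *v y) (t n - y $ i1)) \<and> t n \<in> {real n..}) \<and>
      (\<lambda>n. slice_avg i1 R \<nu> u (t n)) \<longlonglongrightarrow> up"
  proof (rule ex_sequence_inf_ae_filter[OF lim slice_AE])
    fix Q :: "real \<Rightarrow> bool" assume "eventually Q at_top"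
    then obtain T where "\<And>t. t \<ge> T \<Longrightarrow> Q t" by (auto simp: eventually_at_top_linorder)
    then show "\<exists>A. A \<in> sets lborel \<and> emeasure lborel A > 0 \<and> (\<forall>t\<in>A. Q t)"
      by (intro exI[of _ "{T..T + 1}"]) auto
  qed (auto simp: eventually_ge_at_top)
  then obtain t where t: "\<And>n. slice_avg i1 R \<nu> u (t n) = integral\<^sup>L lborel (\<lambda>y. indicator (cbox 0 One) y
      *\<^sub>R \<Gamma> (transpose R *v y) (t n - y $ i1))"
    "\<And>n. real n \<le> t n" "(\<lambda>n. slice_avg i1 R \<nu> u (t n)) \<longlonglongrightarrow> up"
    unfolding atLeast_iff by blast
  show ?thesis
  proof (rule limit_AE)
    show "AE x in lborel. x \<in> D0 \<longrightarrow> (\<exists>l\<in>X. (\<Gamma> x \<longlongrightarrow> l) at_top)"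
      using good_AE by eventually_elim (auto intro: finite_energy_curve.converges_at_top)
    show "filterlim (\<lambda>n. t n - c) at_top sequentially" for c
    proof (rule filterlim_at_top_mono)
      show "filterlim (\<lambda>n. real n - c) at_top sequentially" by real_asymp
      show "\<forall>\<^sub>F n in sequentially. real n - c \<le> t n - c" using t(2) by (intro always_eventually) simp
    qed
    show "(\<lambda>n. integral\<^sup>L lborel (\<lambda>y. indicator (cbox 0 One) y *\<^sub>R \<Gamma> (transpose R *v y) (t n - y $ i1))) \<longlonglongrightarrow> up"
      using t(3) unfolding t(1) .
  qed (rule up)
qed

lemma \<Gamma>_limit_bot: "AE x in lborel. x \<in> D0 \<longrightarrow> (\<Gamma> x \<longlongrightarrow> um) at_bot"
proof -
  have lim: "(slice_avg i1 R \<nu> u \<longlongrightarrow> um) (inf at_bot (ae_filter lborel))" using BC by (simp add: bc_def)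
  have "\<exists>t::nat \<Rightarrow> real. (\<forall>n. slice_avg i1 R \<nu> u (t n) = integral\<^sup>L lborel (\<lambda>y. indicator (cbox 0 One) y
      *\<^sub>R \<Gamma> (transpose R *v y) (t n - y $ i1)) \<and> t n \<in> {..- real n}) \<and>
      (\<lambda>n. slice_avg i1 R \<nu> u (t n)) \<longlonglongrightarrow> um"
  proof (rule ex_sequence_inf_ae_filter[OF lim slice_AE])
    fix Q :: "real \<Rightarrow> bool" assume "eventually Q at_bot"
    then obtain T where "\<And>t. t \<le> T \<Longrightarrow> Q t" by (auto simp: eventually_at_bot_linorder)
    then show "\<exists>A. A \<in> sets lborel \<and> emeasure lborel A > 0 \<and> (\<forall>t\<in>A. Q t)"
      by (intro exI[of _ "{T - 1..T}"]) auto
  qed (auto simp: eventually_le_at_bot)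
  then obtain t where t: "\<And>n. slice_avg i1 R \<nu> u (t n) = integral\<^sup>L lborel (\<lambda>y. indicator (cbox 0 One) y
      *\<^sub>R \<Gamma> (transpose R *v y) (t n - y $ i1))"
    "\<And>n. t n \<le> - real n" "(\<lambda>n. slice_avg i1 R \<nu> u (t n)) \<longlonglongrightarrow> um"
    unfolding atMost_iff by blast
  show ?thesis
  proof (rule limit_AE)
    show "AE x in lborel. x \<in> D0 \<longrightarrow> (\<exists>l\<in>X. (\<Gamma> x \<longlongrightarrow> l) at_bot)"
      using good_AE by eventually_elim (auto intro: finite_energy_curve.converges_at_bot)
    show "filterlim (\<lambda>n. t n - c) at_bot sequentially" for c
    proof (rule filterlim_at_bot_mono)
      show "filterlim (\<lambda>n. - real n - c) at_bot sequentially" by real_asymp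
      show "\<forall>\<^sub>F n in sequentially. t n - c \<le> - real n - c" using t(2) by (intro always_eventually) simp
    qed
    show "(\<lambda>n. integral\<^sup>L lborel (\<lambda>y. indicator (cbox 0 One) y *\<^sub>R \<Gamma> (transpose R *v y) (t n - y $ i1))) \<longlonglongrightarrow> um"
      using t(3) unfolding t(1) .
  qed (rule um)
qed

section \<open>The equality case\<close>

lemma L_ge: "AE x in lborel. x \<in> D0 \<longrightarrow> ennreal (\<delta> um up) \<le> L x"
  using good_AE \<Gamma>_limit_top \<Gamma>_limit_bot
proof eventually_elim
  case (elim x)
  show ?case
  proof
    assume x: "x \<in> D0"
    then interpret c: finite_energy_curve X \<delta> W \<Psi> M "\<Gamma> x" "\<lambda>s. q (x + s *\<^sub>R \<nu>)" using elim by blast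
    have "\<delta> um up \<le> c.Tot" using c.energy_ge elim x um up by blast
    then have "ennreal (\<delta> um up) \<le> ennreal c.Tot" by (rule ennreal_leI)
    then show "ennreal (\<delta> um up) \<le> L x" unfolding c.Tot_eq(2) using elim x by simp
  qed
qed

lemma energy_eq: "energy W i1 R u Du = ennreal (\<delta> um up)"
  and dd_zero_fund_dom: "AE x in lborel. x \<in> fund_dom i1 R \<longrightarrow> dd x = 0"
proof -
  define I where "I = (\<integral>\<^sup>+x. ennreal (dd x / 2) * indicator (fund_dom i1 R) x \<partial>lborel)"
  have "ennreal (\<delta> um up) = (\<integral>\<^sup>+x. ennreal (\<delta> um up) * indicator D0 x \<partial>lborel)"
    by (subst nn_integral_cmult) (auto simp: emeasure_D0)
  also have "\<dots> \<le> (\<integral>\<^sup>+x. L x * indicator D0 x \<partial>lborel)"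
    using L_ge by (intro nn_integral_mono_AE) (auto elim!: eventually_mono simp: indicator_def)
  finally have l: "ennreal (\<delta> um up) \<le> (\<integral>\<^sup>+x. L x * indicator D0 x \<partial>lborel)" .
  have tot: "ennreal (\<delta> um up) + I \<le> ennreal (\<delta> um up)"
    using order_trans[OF add_right_mono[OF l, of I] E[unfolded energy_split I_def[symmetric]]] .
  have I0: "I = 0"
  proof (rule ccontr)
    assume "I \<noteq> 0"
    then have "ennreal (\<delta> um up) + 0 < ennreal (\<delta> um up) + I"
      by (subst ennreal_add_left_cancel_less) (auto simp: zero_less_iff_neq_zero)
    then show False using tot by simp
  qed
  show "energy W i1 R u Du = ennreal (\<delta> um up)"
    using E l unfolding energy_split I_def[symmetric] I0 by simp
  have "AE x in lborel. ennreal (dd x / 2) * indicator (fund_dom i1 R) x = 0"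
    using I0 unfolding I_def by (subst (asm) nn_integral_0_iff_AE) auto
  then show "AE x in lborel. x \<in> fund_dom i1 R \<longrightarrow> dd x = 0"
    using dd_nonneg by (auto elim!: eventually_mono simp: ennreal_eq_0_iff intro: antisym)
qed

text \<open>Subtracting integer parts of the transverse coordinates carries every point into the
  fundamental domain. The lattice is countable, so one null set serves all its translations.\<close>

lemma dd_zero: "AE x in lborel. dd x = 0"
proof -
  define v where "v m = transpose R *v (\<chi> k. if k = i1 then 0 else real_of_int (m k))" for m :: "'n \<Rightarrow> int"
  have c: "countable (range v)"
  proof -
    have "countable (UNIV :: ('n \<Rightarrow> int) set)"
      using countable_PiE[of "UNIV :: 'n set" "\<lambda>_. UNIV :: int set"] by (simp add: PiE_UNIV_domain)
    then show ?thesis by (rule countable_image)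
  qed
  have "AE x in lborel. Db (x + v m) = Db x \<and> (x + v m \<in> fund_dom i1 R \<longrightarrow> dd (x + v m) = 0)" for m
    using Db_periodic[OF periodic, of m] AE_lborel_shift[OF dd_zero_fund_dom, of "v m"]
        unfolding v_def[symmetric]
    by eventually_elim blast
  then have "AE x in lborel. \<forall>w\<in>range v. Db (x + w) = Db x \<and> (x + w \<in> fund_dom i1 R \<longrightarrow> dd (x + w) = 0)"
    by (subst AE_ball_countable[OF c]) auto
  then show ?thesis
  proof eventually_elim
    case (elim x)
    define m where "m k = - \<lfloor>(R *v x) $ k\<rfloor>" for k
    have "R *v (x + v m) = R *v x + (\<chi> k. if k = i1 then 0 else real_of_int (m k))"
      by (simp add: v_def matrix_vector_right_distrib orthogonal_matrix_mul_transpose(1)[OF orth]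
          del: transpose_matrix_vector)
    then have "x + v m \<in> fund_dom i1 R"
      unfolding fund_dom_def by (auto simp: m_def) linarith
    then have "dd (x + v m) = 0" "Db (x + v m) = Db x" using elim by blast+
    then show ?case by (simp add: dd_def)
  qed
qed

text \<open>Where \<open>dd\<close> vanishes, each row of \<open>Db\<close> is a multiple of
  \<open>\<nu>\<close> and thus orthogonal to \<open>\<tau>\<close>. By Fubini this holds along
  almost every segment in direction \<open>\<tau>\<close>, so the increment is 0.\<close>

lemma tangential_invariance:
  assumes \<tau>: "\<tau> \<bullet> \<nu> = 0"
  shows "AE x in lborel. ub (x + \<tau>) = ub x"
proof -
  have "AE s in lborel. AE x in lborel. dd (x + (s::real) *\<^sub>R \<tau>) = 0"
    by (rule AE_I2) (rule AE_lborel_shift[OF dd_zero])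
  then have z: "AE x in lborel. AE s in lborel. dd (x + (s::real) *\<^sub>R \<tau>) = 0"
    by (subst lborel_pair.AE_commute) measurable
  have "AE x in lborel. \<forall>i. ub (x + \<tau>) $ i - ub x $ i = integral\<^sup>L lborel (\<lambda>s. indicator {0..1} s * (Db
      (x + s *\<^sub>R \<tau>) $ i \<bullet> \<tau>))"
    using translate[of \<tau>] by (simp only: AE_all_countable) blast
  then show ?thesis using z
  proof eventually_elim
    case (elim x)
    have "integral\<^sup>L lborel (\<lambda>s. indicator {0..1} s * (Db (x + s *\<^sub>R \<tau>) $ i \<bullet> \<tau>)) = 0" for i
    proof (rule integral_eq_zero_AE)
      show "AE s in lborel. indicator {0..1} s * (Db (x + s *\<^sub>R \<tau>) $ i \<bullet> \<tau>) = 0"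
        using elim(2)
      proof eventually_elim
        case (elim s)
        then have "norm (Db (x + s *\<^sub>R \<tau>) $ i - (Db (x + s *\<^sub>R \<tau>) $ i \<bullet> \<nu>) *\<^sub>R \<nu>) = 0"
          unfolding dd_def by (subst (asm) sum_nonneg_eq_0_iff) auto
        then have "Db (x + s *\<^sub>R \<tau>) $ i = (Db (x + s *\<^sub>R \<tau>) $ i \<bullet> \<nu>) *\<^sub>R \<nu>" by simp
        then have "Db (x + s *\<^sub>R \<tau>) $ i \<bullet> \<tau> = 0" using \<tau> by (metis inner_commute inner_scaleR_left
            mult_zero_right)
        then show ?case by simp
      qed
    qed
    then show ?case using elim(1) by (simp add: vec_eq_iff)
  qed
qed

text \<open>Splitting \<open>y\<close> into a tangential part and a multiple of \<open>\<nu>\<close>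
  gives \<open>ub (x + y) = \<Gamma> x (y \<bullet> \<nu>)\<close> for fixed \<open>y\<close> and
  almost every \<open>x\<close>. Fubini provides a single base point \<open>x0\<close>, with all
  good properties, for which it holds at almost every \<open>y\<close>; the curve through
  \<open>x0\<close> is the profile.\<close>

lemma one_dimensional:
  "\<exists>g g'. H1dot_line g g' \<and> (g \<longlongrightarrow> up) at_top \<and> (g \<longlongrightarrow> um) at_bot \<and>
     (AE x in lebesgue. u x = g (x \<bullet> \<nu>)) \<and> energy W i1 R u Du = ennreal (\<delta> um up)"
proof -
  have "AE y in lborel. AE x in lborel. ub (x + y) = \<Gamma> x (y \<bullet> \<nu>)"
  proof (rule AE_I2)
    fix y :: "real^'n"
    define \<tau> where "\<tau> = y - (y \<bullet> \<nu>) *\<^sub>R \<nu>"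
    have "\<tau> \<bullet> \<nu> = 0" using norm_\<nu> by (simp add: \<tau>_def inner_diff_left dot_square_norm)
    from AE_lborel_shift[OF tangential_invariance[OF this], of "(y \<bullet> \<nu>) *\<^sub>R \<nu>"] line_rep[of "y \<bullet> \<nu>"]
    show "AE x in lborel. ub (x + y) = \<Gamma> x (y \<bullet> \<nu>)"
      by eventually_elim (simp add: \<tau>_def add.assoc)
  qed
  then have AEx: "AE x in lborel. AE y in lborel. ub (x + y) = \<Gamma> x (y \<bullet> \<nu>)"
    by (subst lborel_pair.AE_commute) measurable
  have "\<exists>x\<in>D0. finite_energy_curve X \<delta> W \<Psi> M (\<Gamma> x) (\<lambda>s. q (x + s *\<^sub>R \<nu>)) \<and> (\<Gamma> x \<longlongrightarrow> up) at_top
      \<and> (\<Gamma> x \<longlongrightarrow> um) at_bot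
     \<and> (AE y in lborel. ub (x + y) = \<Gamma> x (y \<bullet> \<nu>))"
  proof (rule ccontr)
    assume no: "\<not> ?thesis"
    have "AE x in lborel. x \<notin> D0"
      using good_AE \<Gamma>_limit_top \<Gamma>_limit_bot AEx by eventually_elim (use no in blast)
    then have "emeasure lborel D0 = 0" by (subst (asm) AE_iff_null_sets[symmetric]) (auto simp: null_setsD1)
    then show False using emeasure_D0 by simp
  qed
  then obtain x0 where x0: "finite_energy_curve X \<delta> W \<Psi> M (\<Gamma> x0) (\<lambda>s. q (x0 + s *\<^sub>R \<nu>))"
      "(\<Gamma> x0 \<longlongrightarrow> up) at_top" "(\<Gamma> x0 \<longlongrightarrow> um) at_bot"
     "AE y in lborel. ub (x0 + y) = \<Gamma> x0 (y \<bullet> \<nu>)" by blast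
  interpret c: finite_energy_curve X \<delta> W \<Psi> M "\<Gamma> x0" "\<lambda>s. q (x0 + s *\<^sub>R \<nu>)" by (rule x0(1))
  \<comment> \<open>The curve is parametrised from \<open>x0\<close>, the profile by the coordinate
    \<open>x \<bullet> \<nu>\<close>; \<open>c0\<close> is the offset.\<close>
  define c0 where "c0 = x0 \<bullet> \<nu>"
  define f where "f s = q (x0 + s *\<^sub>R \<nu>)" for s
  have [measurable]: "f \<in> borel_measurable borel" unfolding f_def by measurable
  define g where "g t = \<Gamma> x0 (t - c0)" for t
  define g' where "g' t = f (t - c0)" for t
  have comp: "g' = f \<circ> (+) (- c0)" by (auto simp: g'_def)
  have "H1dot_line g g'" unfolding H1dot_line_def
  proof (intro conjI allI impI)
    show "g' \<in> borel_measurable lebesgue" unfolding g'_def by (intro measurable_completion) measurable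
    fix a b :: real assume ab: "a \<le> b"
    have cu: "curve_on (a - c0) (b - c0) (\<Gamma> x0) f" using c.curve by (simp add: f_def[abs_def])
    then have hi: "(f has_integral (g b - g a)) {a - c0..b - c0}" using ab unfolding curve_on_def g_def
        by auto
    then show gi: "(g' has_integral (g b - g a)) {a..b}"
      unfolding comp by (subst has_integral_shift_Icc_real) simp
    have "(\<lambda>s. norm (f s)) integrable_on {a - c0..b - c0}"
      using cu unfolding curve_on_def absolutely_integrable_on_def by blast
    then obtain J where "((\<lambda>s. norm (f s)) has_integral J) {a - c0..b - c0}" by blast
    then have "((\<lambda>s. norm (f s)) \<circ> (+) (- c0) has_integral J) {a..b}"
      by (subst has_integral_shift_Icc_real) simp
    then have "(\<lambda>t. norm (g' t)) integrable_on {a..b}" unfolding comp by (auto simp: o_def)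
    then show "g' absolutely_integrable_on {a..b}"
      using gi unfolding absolutely_integrable_on_def by blast
  next
    have "integrable (distr lborel borel ((+) (- c0))) (\<lambda>t. (norm (f t))\<^sup>2)"
      using c.q_square_integrable by (simp add: lborel_distr_plus f_def)
    then have "integrable lborel (\<lambda>t. (norm (g' t))\<^sup>2)"
      by (subst (asm) integrable_distr_eq) (auto simp: g'_def)
    then show "integrable lebesgue (\<lambda>t. (norm (g' t))\<^sup>2)"
      by (subst integrable_completion) (auto simp: g'_def)
  qed
  moreover have "(g \<longlongrightarrow> up) at_top" unfolding g_def
    by (rule filterlim_compose[OF x0(2)]) real_asymp
  moreover have "(g \<longlongrightarrow> um) at_bot" unfolding g_def
    by (rule filterlim_compose[OF x0(3)]) real_asymp
  moreover have "AE x in lebesgue. u x = g (x \<bullet> \<nu>)"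
  proof (rule AE_completion)
    show "AE x in lborel. u x = g (x \<bullet> \<nu>)"
      using AE_lborel_shift[OF x0(4), of "- x0"] AE_N
      by eventually_elim (simp add: uN g_def c0_def inner_diff_left)
  qed
  ultimately show ?thesis using energy_eq by blast
qed

end

theorem theorem2p11:
  fixes X :: "(real^'n) set" and \<delta> :: "real^'n \<Rightarrow> real^'n \<Rightarrow> real" and i1 :: 'n
  assumes "CARD('n) \<ge> 2"
    and "\<not> affine_dependent X" and "card X = CARD('n) + 1"
    and "metric_on X \<delta>"
  shows "\<exists>W :: real^'n \<Rightarrow> real.
    (\<exists>L. L-lipschitz_on UNIV W) \<and> (\<forall>z. 0 \<le> W z) \<and>
    (\<exists>M. \<forall>z. M \<le> norm z \<longrightarrow> W z = 1) \<and>
    {z. W z = 0} = X \<and>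
    (\<forall>x\<in>X. \<forall>y\<in>X. geod W x y = \<delta> x y) \<and>
    (\<forall>um\<in>X. \<forall>up\<in>X. \<forall>\<nu> R u Du.
       norm \<nu> = 1 \<and> \<nu> \<bullet> (up - um) = 0 \<and> SO_matrix R \<and> R *v \<nu> = axis i1 1 \<and>
       H1div i1 R u Du \<and> bc i1 R \<nu> u um up \<and>
       (\<forall>v Dv. H1div i1 R v Dv \<and> bc i1 R \<nu> v um up \<longrightarrow> energy W i1 R u Du \<le> energy W i1 R v Dv)
       \<longrightarrow> (\<exists>g g'. H1dot_line g g' \<and> (g \<longlongrightarrow> up) at_top \<and> (g \<longlongrightarrow> um) at_bot \<and>
              (AE x in lebesgue. u x = g (x \<bullet> \<nu>)) \<and>
              energy W i1 R u Du = ennreal (\<delta> um up)))"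
proof -
  interpret S: simplex_metric X \<delta> using assms by unfold_locales
  \<comment> \<open>The cutoff ends one unit beyond \<open>S.M\<close>, so \<open>S.M + 1\<close> is
    the radius from which the potential is 1.\<close>
  interpret C: calibrated_potential X \<delta> S.W S.Psi "S.M + 1"
    by unfold_locales
      (fact S.indep S.finX S.metric S.W_lipschitz S.W_nonneg S.W_far S.W_zero S.W_edge S.Psi_calibrates
          S.Psi_vertex)+
  have main: "\<exists>g g'. H1dot_line g g' \<and> (g \<longlongrightarrow> up) at_top \<and> (g \<longlongrightarrow> um) at_bot \<and>
              (AE x in lebesgue. u x = g (x \<bullet> \<nu>)) \<and> energy S.W i1 R u Du = ennreal (\<delta> um up)"
    if um: "um \<in> X" and up: "up \<in> X" and a: "\<nu> \<bullet> (up - um) = 0" "SO_matrix R" "R *v \<nu> = axis i1 1"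
      and H: "H1div i1 R u Du" and BC: "bc i1 R \<nu> u um up"
      and min: "\<And>v Dv. H1div i1 R v Dv \<Longrightarrow> bc i1 R \<nu> v um up \<Longrightarrow> energy S.W i1 R u Du \<le> energy S.W i1 R v Dv"
    for um up \<nu> R u Du
  proof -
    interpret T: transition X \<delta> S.W S.Psi "S.M + 1" i1 R \<nu> um up
      using um up a by unfold_locales
    obtain v Dv where v: "H1div i1 R v Dv" "bc i1 R \<nu> v um up" "energy S.W i1 R v Dv \<le> ennreal (\<delta> um up)"
      using T.competitor by blast
    \<comment> \<open>Comparison with the one-dimensional competitor: the step at which minimality
      is used.\<close>
    have E: "energy S.W i1 R u Du \<le> ennreal (\<delta> um up)" using min[OF v(1,2)] v(3) by (rule order_trans)
    have wg: "weak_grad u Du" using H by (simp add: H1div_def)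
    then obtain ub where ub: "ub \<in> borel_measurable borel" "AE x in lborel. u x = ub x"
      using ex_borel_representative[of u] unfolding weak_grad_def L2_loc_def by blast
    have "\<forall>i. \<exists>r. r \<in> borel_measurable borel \<and> (AE x in lborel. Du x $ i = r x)"
    proof
      fix i
      show "\<exists>r. r \<in> borel_measurable borel \<and> (AE x in lborel. Du x $ i = r x)"
        using ex_borel_representative[of "\<lambda>x. Du x $ i"] wg unfolding weak_grad_def L2_loc_def by blast
    qed
    from choice[OF this] obtain r where
      r: "\<And>i. r i \<in> borel_measurable borel" "\<And>i. AE x in lborel. Du x $ i = r i x" by blast
    have "AE x in lborel. \<forall>i. Du x $ i = r i x" using r(2) by (simp add: AE_all_countable)
    then have "AE x in lborel. u x = ub x \<and> Du x = (\<chi> i. r i x)"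
      using ub(2) by eventually_elim (simp add: vec_eq_iff)
    then obtain N where N: "N \<in> null_sets lborel" "{x. \<not> (u x = ub x \<and> Du x = (\<chi> i. r i x))} \<subseteq> N"
      by (auto simp: eventually_ae_filter)
    interpret P: representative X \<delta> S.W S.Psi "S.M + 1" i1 R \<nu> um up u ub Du "\<lambda>x. \<chi> i. r i x" N
      using H BC E ub(1) r(1) N by unfold_locales auto
    show ?thesis by (rule P.one_dimensional)
  qed
  show ?thesis
  proof (intro exI[of _ S.W] conjI)
    show "\<exists>M. \<forall>z. M \<le> norm z \<longrightarrow> S.W z = 1" using S.W_far by blast
    show "\<forall>um\<in>X. \<forall>up\<in>X. \<forall>\<nu> R u Du.
       norm \<nu> = 1 \<and> \<nu> \<bullet> (up - um) = 0 \<and> SO_matrix R \<and> R *v \<nu> = axis i1 1 \<and>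
       H1div i1 R u Du \<and> bc i1 R \<nu> u um up \<and>
       (\<forall>v Dv. H1div i1 R v Dv \<and> bc i1 R \<nu> v um up \<longrightarrow> energy S.W i1 R u Du \<le> energy S.W i1 R v Dv)
       \<longrightarrow> (\<exists>g g'. H1dot_line g g' \<and> (g \<longlongrightarrow> up) at_top \<and> (g \<longlongrightarrow> um) at_bot \<and>
              (AE x in lebesgue. u x = g (x \<bullet> \<nu>)) \<and> energy S.W i1 R u Du = ennreal (\<delta> um up))"
      using main by (intro ballI allI impI) blast
  qed (use S.W_lipschitz S.W_nonneg S.W_zero C.geod_eq in auto)
qed

end
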